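(* Let $n\in\mathbb{N}$ and let $Y$ be an infinite dimensional closed subspace of $\mathfrak{X}_{0,1}^n$. Then there exists a normalized weakly null sequence in $Y$ generating an isometric $c_0$ spreading model. Moreover, for $0\leqslant k\leqslant n-1$ there exists a sequence in $Y$ that generates an $\ell_1^{n-k}$ spreading model and no subsequence of it generates an $\ell_1^{n-k+1}$ one.
   Context: $c_{00}$ is the space of finitely supported real sequences with unit vector basis $\{e_i\}_{i\in\mathbb{N}}$; $E<F$ for finite sets means $\max E<\min F$, and $f<g$ for vectors means $\operatorname{supp}f<\operatorname{supp}g$. Schreier families: $\mathcal{S}_0=\{\{m\}:m\in\mathbb{N}\}$, $\mathcal{S}_1=\{F\subset\mathbb{N}:\#F\leqslant\min F\}$, and $\mathcal{S}_{m+1}=\{F_1\cup\cdots\cup F_k: F_1<\cdots<F_k\in\mathcal{S}_m,\ k\leqslant\min F_1\}$. The space $\mathfrak{X}_{0,1}^n$ ($n\geqslant1$): For $G\subset c_{00}$, an $\alpha$-average in $G$ is a vector $\alpha\in G$ of the form $\alpha=\frac1\ell\sum_{q=1}^d f_q$ with $f_1<\cdots<f_d\in G$, $d\leqslant\ell$, $\ell\geqslant2$; its size is $s(\alpha)=\ell$ (an $\alpha$-average is considered together with such a representation). A sequence $\{\alpha_q\}_{q=1}^d$ of $\alpha$-averages is $\mathcal{S}_k$-admissible if $\alpha_1<\cdots<\alpha_d$ and $\{\min\operatorname{supp}\alpha_q:q=1,\ldots,d\}\in\mathcal{S}_k$; a (finite or infinite) sequence of $\alpha$-averages is very fast growing if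 $\alpha_1<\alpha_2<\cdots$, $s(\alpha_1)<s(\alpha_2)<\cdots$ and $s(\alpha_q)>\max\operatorname{supp}\alpha_{q-1}$ for $q>1$. Set $W_0=\{\pm e_i\}_{i\in\mathbb{N}}$ and $W_{m+1}=W_m\cup W^\alpha_{m+1}\cup W^S_{m+1}$, where $W^\alpha_{m+1}=\{\frac1\ell\sum_{q=1}^d f_q: f_1<\cdots<f_d\in W_m,\ \ell\geqslant2,\ \ell\geqslant d\}$ and $W^S_{m+1}=\{\sum_{q=1}^d\alpha_q:\{\alpha_q\}_{q=1}^d\subset W_m$ an $\mathcal{S}_n$-admissible and very fast growing sequence of $\alpha$-averages$\}$. Let $W=\bigcup_m W_m$, acting on $c_{00}$ by the usual duality, $\|x\|=\sup\{f(x):f\in W\}$, and $\mathfrak{X}_{0,1}^n$ the completion of $(c_{00},\|\cdot\|)$. A sequence $\{x_i\}$ generates an $\ell_1^k$ spreading model if there is $C\geqslant1$ such that for every $F\in\mathcal{S}_k$, $\{x_i\}_{i\in F}$ is $C$-equivalent to the usual basis of $(\mathbb{R}^{\#F},\|\cdot\|_1)$. A sequence $\{x_i\}$ generates an isometric $c_0$ spreading model if its spreading model (in the Brunel–Sucheston sense) is isometric to the usual basis of $c_0$: there is $\delta_m\downarrow0$ such that $\big|\,\|\sum_{j=1}^m a_jx_{i_j}\|-\max_j|a_j|\,\big|<\delta_m$ for all $m\leqslant i_1<\cdots<i_m$ and $a_j\in[-1,1]$. *)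

theory Defs
  imports "HOL-Analysis.Analysis" "HOL-Probability.Discrete_Topology"
begin

text \<open>
  Throughout, the positive integers play the role of the index set of bases and sequences,
  because the condition \<open>card F \<le> Min F\<close> in the Schreier families is sensitive to whether
  indexing starts at 0 or at 1.  Coordinate 0 of a vector in \<open>c00\<close> is therefore required to
  vanish, and no member of a Schreier family contains 0.  A sequence is a function on \<open>nat\<close>
  whose term at 0 is irrelevant to the spreading model notions below.  All sequences of sets
  and functionals that are put in successive order are nonempty.
\<close>

definition supp :: "(nat \<Rightarrow> real) \<Rightarrow> nat set"
  where "supp x = {i. x i \<noteq> 0}"

definition c00 :: "(nat \<Rightarrow> real) set"
  where "c00 = {x. finite (supp x) \<and> x 0 = 0}"

definition unit_vec :: "nat \<Rightarrow> nat \<Rightarrow> real"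
  where "unit_vec i = (\<lambda>j. if j = i then 1 else 0)"

text \<open>\<open>E < F\<close>; only ever applied to nonempty finite sets.\<close>

definition set_before :: "nat set \<Rightarrow> nat set \<Rightarrow> bool"
  where "set_before E F \<longleftrightarrow> Max E < Min F"

definition successive_sets :: "nat \<Rightarrow> (nat \<Rightarrow> nat set) \<Rightarrow> bool"
  where "successive_sets d E \<longleftrightarrow>
    (\<forall>p\<in>{1..d}. \<forall>q\<in>{1..d}. p < q \<longrightarrow> set_before (E p) (E q))"

definition successive :: "nat \<Rightarrow> (nat \<Rightarrow> nat \<Rightarrow> real) \<Rightarrow> bool"
  where "successive d f \<longleftrightarrow> successive_sets d (\<lambda>q. supp (f q))"

fun schreier :: "nat \<Rightarrow> nat set set"
  where
    "schreier 0 = {{m} | m. 1 \<le> m}"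
  | "schreier (Suc 0) = {F. finite F \<and> F \<noteq> {} \<and> 0 \<notin> F \<and> card F \<le> Min F}"
  | "schreier (Suc (Suc m)) =
      {\<Union>i\<in>{1..k}. E i | k E. 1 \<le> k \<and> (\<forall>i\<in>{1..k}. E i \<in> schreier (Suc m)) \<and>
         successive_sets k E \<and> k \<le> Min (E 1)}"

definition average_of :: "(nat \<Rightarrow> real) set \<Rightarrow> (nat \<Rightarrow> real) \<Rightarrow> nat \<Rightarrow> bool"
  where "average_of G \<alpha> l \<longleftrightarrow> l \<ge> 2 \<and>
    (\<exists>d f. 1 \<le> d \<and> d \<le> l \<and> (\<forall>q\<in>{1..d}. f q \<in> G) \<and> successive d f \<and>
       \<alpha> = (\<lambda>i. (1 / real l) * (\<Sum>q=1..d. f q i)))"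

text \<open>
  \<open>alpha_average G \<alpha> l\<close>: \<open>\<alpha>\<close> is an \<open>\<alpha>\<close>-average in \<open>G\<close> with a representation of size \<open>l\<close>.
  As the size depends on the representation, sequences of averages carry a separate
  sequence of sizes.
\<close>

definition alpha_average :: "(nat \<Rightarrow> real) set \<Rightarrow> (nat \<Rightarrow> real) \<Rightarrow> nat \<Rightarrow> bool"
  where "alpha_average G \<alpha> l \<longleftrightarrow> \<alpha> \<in> G \<and> average_of G \<alpha> l"

definition admissible :: "nat \<Rightarrow> nat \<Rightarrow> (nat \<Rightarrow> nat \<Rightarrow> real) \<Rightarrow> bool"
  where "admissible k d \<alpha> \<longleftrightarrow>
    successive d \<alpha> \<and> {Min (supp (\<alpha> q)) | q. q \<in> {1..d}} \<in> schreier k"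

definition very_fast_growing :: "nat \<Rightarrow> (nat \<Rightarrow> nat \<Rightarrow> real) \<Rightarrow> (nat \<Rightarrow> nat) \<Rightarrow> bool"
  where "very_fast_growing d \<alpha> s \<longleftrightarrow>
    successive d \<alpha> \<and> strict_mono_on {1..d} s \<and>
    (\<forall>q\<in>{2..d}. s q > Max (supp (\<alpha> (q - 1))))"

primrec W_stage :: "nat \<Rightarrow> nat \<Rightarrow> (nat \<Rightarrow> real) set"
  where
    "W_stage n 0 = {unit_vec i | i. 1 \<le> i} \<union> {- unit_vec i | i. 1 \<le> i}"
  | "W_stage n (Suc m) = W_stage n m
      \<union> {\<alpha>. \<exists>l. average_of (W_stage n m) \<alpha> l}
      \<union> {(\<lambda>i. \<Sum>q=1..d. \<alpha> q i) | d \<alpha>. 1 \<le> d \<and>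
           (\<exists>s. (\<forall>q\<in>{1..d}. alpha_average (W_stage n m) (\<alpha> q) (s q)) \<and>
                admissible n d \<alpha> \<and> very_fast_growing d \<alpha> s)}"

definition W :: "nat \<Rightarrow> (nat \<Rightarrow> real) set"
  where "W n = (\<Union>m. W_stage n m)"

definition pairing :: "(nat \<Rightarrow> real) \<Rightarrow> (nat \<Rightarrow> real) \<Rightarrow> real"
  where "pairing f x = (\<Sum>i\<in>supp x. f i * x i)"

definition W_norm :: "nat \<Rightarrow> (nat \<Rightarrow> real) \<Rightarrow> real"
  where "W_norm n x = (SUP f\<in>W n. pairing f x)"

text \<open>
  \<open>is_completion V N J X\<close>: the set \<open>X\<close> in a Banach space, together with the embedding \<open>J\<close>,
  is a completion of the space \<open>V\<close> of functions, normed by \<open>N\<close>.  A completion being unique up to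
  linear isometry over \<open>V\<close>, statements about it are quantified over all pairs \<open>(J, X)\<close>;
  the lemma \<open>completion_exists\<close> shows that there is one for \<open>V = c00\<close> and \<open>N = W_norm n\<close>.
\<close>

definition is_completion ::
    "(nat \<Rightarrow> real) set \<Rightarrow> ((nat \<Rightarrow> real) \<Rightarrow> real) \<Rightarrow>
     ((nat \<Rightarrow> real) \<Rightarrow> 'a::banach) \<Rightarrow> 'a set \<Rightarrow> bool"
  where "is_completion V N J X \<longleftrightarrow>
    (\<forall>x\<in>V. \<forall>y\<in>V. J (\<lambda>i. x i + y i) = J x + J y) \<and>
    (\<forall>c. \<forall>x\<in>V. J (\<lambda>i. c * x i) = c *\<^sub>R J x) \<and>
    (\<forall>x\<in>V. norm (J x) = N x) \<and>
    X = closure (J ` V)"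

definition infinite_dimensional :: "'a::real_vector set \<Rightarrow> bool"
  where "infinite_dimensional Y \<longleftrightarrow> \<not> (\<exists>B. finite B \<and> span B = span Y)"

text \<open>The functionals are those of the dual of the normed space \<open>Y\<close> itself.\<close>

definition weakly_null_in :: "'a::real_normed_vector set \<Rightarrow> (nat \<Rightarrow> 'a) \<Rightarrow> bool"
  where "weakly_null_in Y x \<longleftrightarrow> range x \<subseteq> Y \<and>
    (\<forall>\<phi> :: 'a \<Rightarrow> real.
       (\<forall>u\<in>Y. \<forall>v\<in>Y. \<phi> (u + v) = \<phi> u + \<phi> v) \<and>
       (\<forall>c. \<forall>u\<in>Y. \<phi> (c *\<^sub>R u) = c * \<phi> u) \<and>
       (\<exists>K. \<forall>u\<in>Y. \<bar>\<phi> u\<bar> \<le> K * norm u)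
       \<longrightarrow> (\<lambda>i. \<phi> (x i)) \<longlonglongrightarrow> 0)"

definition equivalent_to_l1_basis :: "real \<Rightarrow> nat set \<Rightarrow> (nat \<Rightarrow> 'a::real_normed_vector) \<Rightarrow> bool"
  where "equivalent_to_l1_basis C F x \<longleftrightarrow>
    (\<forall>a :: nat \<Rightarrow> real.
       (1 / C) * (\<Sum>i\<in>F. \<bar>a i\<bar>) \<le> norm (\<Sum>i\<in>F. a i *\<^sub>R x i) \<and>
       norm (\<Sum>i\<in>F. a i *\<^sub>R x i) \<le> C * (\<Sum>i\<in>F. \<bar>a i\<bar>))"

definition l1_spreading_model :: "nat \<Rightarrow> (nat \<Rightarrow> 'a::real_normed_vector) \<Rightarrow> bool"
  where "l1_spreading_model k x \<longleftrightarrow>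
    (\<exists>C\<ge>1. \<forall>F\<in>schreier k. equivalent_to_l1_basis C F x)"

definition isometric_c0_spreading_model :: "(nat \<Rightarrow> 'a::real_normed_vector) \<Rightarrow> bool"
  where "isometric_c0_spreading_model x \<longleftrightarrow>
    (\<exists>\<delta> :: nat \<Rightarrow> real. decseq \<delta> \<and> \<delta> \<longlonglongrightarrow> 0 \<and>
       (\<forall>m\<ge>1. \<forall>(i :: nat \<Rightarrow> nat) (a :: nat \<Rightarrow> real).
          m \<le> i 1 \<and> strict_mono_on {1..m} i \<and> (\<forall>j\<in>{1..m}. a j \<in> {-1..1}) \<longrightarrow>
          \<bar>norm (\<Sum>j=1..m. a j *\<^sub>R x (i j)) - Max ((\<lambda>j. \<bar>a j\<bar>) ` {1..m})\<bar> < \<delta> m))"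


subsection \<open>Existence of the completion\<close>

instance bcontfun :: (metric_space, banach) banach ..

lemma W_stage_SucE:
  assumes "f \<in> W_stage n (Suc m)"
  obtains (old) "f \<in> W_stage n m"
  | (avg) l where "average_of (W_stage n m) f l"
  | (schr) d \<alpha> s where "f = (\<lambda>i. \<Sum>q=1..d. \<alpha> q i)" "1 \<le> d"
      "\<forall>q\<in>{1..d}. alpha_average (W_stage n m) (\<alpha> q) (s q)"
      "admissible n d \<alpha>" "very_fast_growing d \<alpha> s"
  using assms unfolding W_stage.simps by blast

lemma average_ofE:
  assumes "average_of G \<alpha> l"
  obtains d f where "l \<ge> 2" "1 \<le> d" "d \<le> l" "\<And>q. q \<in> {1..d} \<Longrightarrow> f q \<in> G"
    "successive d f" "\<alpha> = (\<lambda>i. (1 / real l) * (\<Sum>q=1..d. f q i))"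
  using assms unfolding average_of_def by blast

lemma W_stage_finite_supp: "f \<in> W_stage n m \<Longrightarrow> finite (supp f)"
proof (induction m arbitrary: f)
  case 0
  then show ?case by (auto simp: supp_def unit_vec_def)
next
  case (Suc m)
  have sum: "finite (supp (\<lambda>i. c * (\<Sum>q=1..d. g q i)))"
    if "\<And>q. q \<in> {1..d} \<Longrightarrow> g q \<in> W_stage n m" for c d and g :: "nat \<Rightarrow> nat \<Rightarrow> real"
  proof (rule finite_subset)
    show "supp (\<lambda>i. c * (\<Sum>q=1..d. g q i)) \<subseteq> (\<Union>q\<in>{1..d}. supp (g q))"
    proof
      fix i assume "i \<in> supp (\<lambda>i. c * (\<Sum>q=1..d. g q i))"
      then have "(\<Sum>q=1..d. g q i) \<noteq> 0" by (simp add: supp_def)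
      then obtain q where "q \<in> {1..d}" "g q i \<noteq> 0"
        by (rule sum.not_neutral_contains_not_neutral)
      then show "i \<in> (\<Union>q\<in>{1..d}. supp (g q))" unfolding supp_def by blast
    qed
    show "finite (\<Union>q\<in>{1..d}. supp (g q))" using Suc.IH that by blast
  qed
  from Suc.prems show ?case
  proof (cases rule: W_stage_SucE)
    case old
    then show ?thesis by (rule Suc.IH)
  next
    case (avg l)
    then show ?thesis
    proof (rule average_ofE)
      fix d :: nat and g :: "nat \<Rightarrow> nat \<Rightarrow> real"
      assume g: "\<And>q. q \<in> {1..d} \<Longrightarrow> g q \<in> W_stage n m"
        and f: "f = (\<lambda>i. (1 / real l) * (\<Sum>q=1..d. g q i))"
      show ?thesis unfolding f by (rule sum) (rule g)
    qed
  next
    case (schr d \<alpha> s)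
    then have "\<forall>q\<in>{1..d}. \<alpha> q \<in> W_stage n m" by (simp add: alpha_average_def)
    then show ?thesis using sum[of d \<alpha> 1] schr(1) by simp
  qed
qed

lemma W_stage_abs_le_1: "f \<in> W_stage n m \<Longrightarrow> \<bar>f i\<bar> \<le> 1"
proof (induction m arbitrary: f)
  case 0
  then show ?case by (auto simp: unit_vec_def)
next
  case (Suc m)
  from Suc.prems show ?case
  proof (cases rule: W_stage_SucE)
    case old
    then show ?thesis by (rule Suc.IH)
  next
    case (avg l)
    then obtain d g where l: "l \<ge> 2" "d \<le> l" and g: "\<And>q. q \<in> {1..d} \<Longrightarrow> g q \<in> W_stage n m"
      and f: "f = (\<lambda>i. (1 / real l) * (\<Sum>q=1..d. g q i))"
      by (rule average_ofE) blast
    have "\<bar>\<Sum>q=1..d. g q i\<bar> \<le> (\<Sum>q=1..d. \<bar>g q i\<bar>)" by (rule sum_abs)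
    also have "\<dots> \<le> (\<Sum>q=1..d. 1)" by (intro sum_mono Suc.IH g)
    also have "\<dots> \<le> real l" using l by simp
    finally show ?thesis using l by (simp add: f abs_mult)
  next
    case (schr d \<alpha> s)
    have mem: "\<alpha> q \<in> W_stage n m" if "q \<in> {1..d}" for q
      using schr(3) that by (simp add: alpha_average_def)
    have succ: "successive d \<alpha>"
      using schr(4) by (simp add: admissible_def)
    have less: "\<not> p < q"
      if pq: "p \<in> {1..d}" "q \<in> {1..d}" "\<alpha> p i \<noteq> 0" "\<alpha> q i \<noteq> 0" for p q
    proof
      assume "p < q"
      then have "Max (supp (\<alpha> p)) < Min (supp (\<alpha> q))"
        using succ pq(1,2) unfolding successive_def successive_sets_def set_before_def by simp
      moreover have "i \<le> Max (supp (\<alpha> p))"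
        by (rule Max_ge[OF W_stage_finite_supp[OF mem[OF pq(1)]]]) (simp add: supp_def pq)
      moreover have "Min (supp (\<alpha> q)) \<le> i"
        by (rule Min_le[OF W_stage_finite_supp[OF mem[OF pq(2)]]]) (simp add: supp_def pq)
      ultimately show False by simp
    qed
    have unique: "p = q"
      if "p \<in> {1..d}" "q \<in> {1..d}" "\<alpha> p i \<noteq> 0" "\<alpha> q i \<noteq> 0" for p q
      using less[OF that] less[OF that(2,1,4,3)] by linarith
    show ?thesis
    proof (cases "\<exists>p\<in>{1..d}. \<alpha> p i \<noteq> 0")
      case True
      then obtain p where p: "p \<in> {1..d}" "\<alpha> p i \<noteq> 0" by blast
      have "(\<Sum>q=1..d. \<alpha> q i) = (\<Sum>q\<in>{p}. \<alpha> q i)"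
        by (rule sum.mono_neutral_right) (use p unique in auto)
      then show ?thesis using Suc.IH[OF mem[OF p(1)]] schr(1) by simp
    next
      case False
      then show ?thesis using schr(1) by simp
    qed
  qed
qed

lemma supp_uminus: "supp (- f) = supp f"
  by (auto simp: supp_def)

lemma average_of_uminus:
  assumes "\<And>f. f \<in> G \<Longrightarrow> - f \<in> G" and "average_of G \<alpha> l"
  shows "average_of G (- \<alpha>) l"
proof -
  from assms(2) obtain d f where *: "l \<ge> 2" "1 \<le> d" "d \<le> l"
      "\<And>q. q \<in> {1..d} \<Longrightarrow> f q \<in> G"
      "successive d f" "\<alpha> = (\<lambda>i. (1 / real l) * (\<Sum>q=1..d. f q i))"
    by (rule average_ofE) blast
  have "\<forall>q\<in>{1..d}. (- f q) \<in> G" using * assms(1) by blast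
  moreover have "successive d (\<lambda>q. - f q)"
    using * by (simp add: successive_def supp_uminus)
  moreover have "- \<alpha> = (\<lambda>i. (1 / real l) * (\<Sum>q=1..d. (- f q) i))"
    using * by (simp add: fun_eq_iff sum_negf)
  ultimately show ?thesis
    unfolding average_of_def using *(1-3)
    by (intro conjI exI[of _ d] exI[of _ "\<lambda>q. - f q"])
qed

lemma W_stage_uminus: "f \<in> W_stage n m \<Longrightarrow> - f \<in> W_stage n m"
proof (induction m arbitrary: f)
  case 0
  then consider i where "1 \<le> i" "f = unit_vec i" | i where "1 \<le> i" "f = - unit_vec i"
    unfolding W_stage.simps by blast
  then show ?case
  proof cases
    case 1
    then show ?thesis unfolding W_stage.simps by blast
  next
    case 2
    then have "- f = unit_vec i" by (simp add: fun_eq_iff)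
    with 2 show ?thesis unfolding W_stage.simps by blast
  qed
next
  case (Suc m)
  from Suc.prems show ?case
  proof (cases rule: W_stage_SucE)
    case old
    then show ?thesis using Suc.IH by simp
  next
    case (avg l)
    then have "average_of (W_stage n m) (- f) l"
      using average_of_uminus Suc.IH by blast
    then show ?thesis unfolding W_stage.simps by blast
  next
    case (schr d \<alpha> s)
    have "\<forall>q\<in>{1..d}. alpha_average (W_stage n m) (- \<alpha> q) (s q)"
      using schr(3) average_of_uminus Suc.IH unfolding alpha_average_def by blast
    moreover have "admissible n d (\<lambda>q. - \<alpha> q)" "very_fast_growing d (\<lambda>q. - \<alpha> q) s"
      using schr by (simp_all add: admissible_def very_fast_growing_def successive_def supp_uminus)
    moreover have "- f = (\<lambda>i. \<Sum>q=1..d. (- \<alpha> q) i)"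
      using schr(1) by (simp add: fun_eq_iff sum_negf)
    ultimately have ex: "\<exists>d \<alpha>. - f = (\<lambda>i. \<Sum>q=1..d. \<alpha> q i) \<and> 1 \<le> d \<and>
        (\<exists>s. (\<forall>q\<in>{1..d}. alpha_average (W_stage n m) (\<alpha> q) (s q)) \<and>
          admissible n d \<alpha> \<and> very_fast_growing d \<alpha> s)"
      using schr(2)
      by (intro exI[of _ d] exI[of _ "\<lambda>q. - \<alpha> q"] conjI exI[of _ s])
    show ?thesis unfolding W_stage.simps by (rule UnI2, rule CollectI, rule ex)
  qed
qed

lemma W_nonempty: "W n \<noteq> {}"
proof -
  have "unit_vec 1 \<in> W_stage n 0" by auto
  then show ?thesis unfolding W_def by blast
qed

lemma W_uminus: "f \<in> W n \<Longrightarrow> - f \<in> W n"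
  unfolding W_def using W_stage_uminus by blast

lemma abs_pairing_le: "f \<in> W n \<Longrightarrow> \<bar>pairing f x\<bar> \<le> (\<Sum>i\<in>supp x. \<bar>x i\<bar>)"
  unfolding pairing_def
proof (rule order.trans[OF sum_abs], rule sum_mono)
  fix i assume "f \<in> W n"
  then have "\<bar>f i\<bar> \<le> 1" unfolding W_def using W_stage_abs_le_1 by blast
  then show "\<bar>f i * x i\<bar> \<le> \<bar>x i\<bar>" by (simp add: abs_mult mult_left_le_one_le)
qed

lemma pairing_eq: "\<lbrakk>finite A; supp x \<subseteq> A\<rbrakk> \<Longrightarrow> pairing f x = (\<Sum>i\<in>A. f i * x i)"
  unfolding pairing_def by (rule sum.mono_neutral_left) (auto simp: supp_def)

lemma pairing_add:
  assumes "x \<in> c00" "y \<in> c00"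
  shows "pairing f (\<lambda>i. x i + y i) = pairing f x + pairing f y"
proof -
  let ?A = "supp x \<union> supp y"
  have fin: "finite ?A" using assms by (simp add: c00_def)
  have "supp (\<lambda>i. x i + y i) \<subseteq> ?A" by (auto simp: supp_def)
  then show ?thesis
    using pairing_eq[OF fin, of x f] pairing_eq[OF fin, of y f] pairing_eq[OF fin, of _ f]
    by (simp add: distrib_left sum.distrib)
qed

lemma pairing_scale:
  assumes "x \<in> c00"
  shows "pairing f (\<lambda>i. c * x i) = c * pairing f x"
proof -
  have "pairing f (\<lambda>i. c * x i) = (\<Sum>i\<in>supp x. f i * (c * x i))"
    using assms by (intro pairing_eq) (auto simp: supp_def c00_def)
  then show ?thesis by (simp add: pairing_def sum_distrib_left mult.left_commute)
qed

theorem completion_exists: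
  "\<exists>(J :: (nat \<Rightarrow> real) \<Rightarrow> ((nat \<Rightarrow> real) discrete \<Rightarrow>\<^sub>C real)) X.
     is_completion c00 (W_norm n) J X"
proof -
  define ev where "ev x g = (if of_discrete g \<in> W n then pairing (of_discrete g) x else 0)"
    for x and g :: "(nat \<Rightarrow> real) discrete"
  have bound: "\<bar>ev x g\<bar> \<le> (\<Sum>i\<in>supp x. \<bar>x i\<bar>)" for x g
    using abs_pairing_le by (simp add: ev_def sum_nonneg)
  have "ev x \<in> bcontfun" for x
    by (rule bcontfun_normI[where b = "\<Sum>i\<in>supp x. \<bar>x i\<bar>"])
      (use bound in \<open>auto simp: continuous_on_open_invariant open_discrete\<close>)
  then have ev: "apply_bcontfun (Bcontfun (ev x)) = ev x" for x
    by (rule Bcontfun_inverse)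
  have bdd: "bdd_above ((\<lambda>f. pairing f x) ` W n)" for x
    using abs_pairing_le by (intro bdd_aboveI[of _ "\<Sum>i\<in>supp x. \<bar>x i\<bar>"]) (auto simp: abs_le_iff)
  have upper: "pairing f x \<le> W_norm n x" if "f \<in> W n" for f x
    unfolding W_norm_def using bdd that by (intro cSUP_upper)
  have pairing_uminus: "pairing (- f) x = - pairing f x" for f x
    by (simp add: pairing_def sum_negf)
  have upper_abs: "\<bar>pairing f x\<bar> \<le> W_norm n x" if "f \<in> W n" for f x
    using upper[OF that, of x] upper[OF W_uminus[OF that], of x]
    by (simp add: pairing_uminus abs_le_iff)
  have nonneg: "0 \<le> W_norm n x" for x
    using W_nonempty[of n] upper_abs[of _ x] by (meson abs_ge_zero ex_in_conv order.trans)
  have norm: "norm (Bcontfun (ev x)) = W_norm n x" for x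
  proof (rule antisym)
    show "norm (Bcontfun (ev x)) \<le> W_norm n x"
      by (rule norm_bound) (use upper_abs nonneg in \<open>simp add: ev ev_def\<close>)
    show "W_norm n x \<le> norm (Bcontfun (ev x))"
      unfolding W_norm_def
    proof (rule cSUP_least[OF W_nonempty])
      fix f assume "f \<in> W n"
      then have "pairing f x = apply_bcontfun (Bcontfun (ev x)) (discrete f)"
        by (simp add: ev ev_def discrete_inverse)
      also have "\<dots> \<le> norm (Bcontfun (ev x))"
        using norm_bounded[of "Bcontfun (ev x)" "discrete f"] by simp
      finally show "pairing f x \<le> norm (Bcontfun (ev x))" .
    qed
  qed
  have "is_completion c00 (W_norm n) (\<lambda>x. Bcontfun (ev x)) (closure ((\<lambda>x. Bcontfun (ev x)) ` c00))"
    unfolding is_completion_def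
    by (auto intro!: bcontfun_eqI simp: norm ev) (auto simp: ev_def pairing_add pairing_scale)
  then show ?thesis by blast
qed

end

theory Submission
  imports Defs
begin

text \<open>
  If every sum over \<open>S\<^sub>k\<close>-admissible very fast growing families of large averages is negligible on
  the terms of a bounded block sequence, then in a sufficiently sparse subsequence only the first
  average meeting a sum \<open>x\<^sub>1 + \<dots> + x\<^sub>m\<close> matters.  Consequently arithmetic means of the terms are
  negligible for \<open>S\<^sub>k\<^sub>+\<^sub>1\<close>-admissible families, and for \<open>k = n - 1\<close> an induction over the norming set
  yields upper \<open>c\<^sub>0\<close> estimates.  Conversely, if such sums are not negligible, then \<open>S\<^sub>1\<close> many terms
  of a subsequence satisfy a lower \<open>\<ell>\<^sub>1\<close> estimate, so that passing to arithmetic means keeps the norms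
  bounded below.  At most \<open>n\<close> steps of averaging therefore give a \<open>c\<^sub>0\<close> spreading model.  Sums of longer
  and longer pieces of that sequence are normed by averages, whence an \<open>\<ell>\<^sub>1\<^sup>n\<close> spreading model.  Its
  \<open>k\<close>-fold arithmetic means are normed by \<open>S\<^sub>k\<close>-admissible families, which leaves room for \<open>S\<^sub>n\<^sub>-\<^sub>k\<close>;
  a further \<open>n - k\<close> averagings produce a \<open>c\<^sub>0\<close> sequence, which excludes \<open>\<ell>\<^sub>1\<^sup>n\<^sup>-\<^sup>k\<^sup>+\<^sup>1\<close>.
\<close>

subsection \<open>Schreier families\<close>

definition before :: "nat set \<Rightarrow> nat set \<Rightarrow> bool"
  where "before E F \<longleftrightarrow> (\<forall>i\<in>E. \<forall>j\<in>F. i < j)"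

definition comparable :: "nat set \<Rightarrow> nat set \<Rightarrow> bool"
  where "comparable E F \<longleftrightarrow> before E F \<or> before F E"

lemma beforeD: "before E F \<Longrightarrow> i \<in> E \<Longrightarrow> j \<in> F \<Longrightarrow> i < j"
  by (simp add: before_def)

lemma before_mono: "before E F \<Longrightarrow> E' \<subseteq> E \<Longrightarrow> F' \<subseteq> F \<Longrightarrow> before E' F'"
  unfolding before_def by blast

lemma comparable_mono: "comparable E F \<Longrightarrow> E' \<subseteq> E \<Longrightarrow> F' \<subseteq> F \<Longrightarrow> comparable E' F'"
  unfolding comparable_def using before_mono by blast

lemma comparable_disjoint: "comparable E F \<Longrightarrow> i \<in> E \<Longrightarrow> i \<in> F \<Longrightarrow> False"
  unfolding comparable_def before_def by blast

lemma set_before_iff: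
  assumes "finite E" "E \<noteq> {}" "finite F" "F \<noteq> {}"
  shows "set_before E F \<longleftrightarrow> before E F"
  using assms by (auto simp: set_before_def before_def)

lemma comparable_Min_less:
  assumes "comparable E F" "finite E" "E \<noteq> {}" "finite F" "F \<noteq> {}" "Min E < Min F"
  shows "before E F"
  using assms unfolding comparable_def before_def
  by (metis Min_in less_asym)

lemma before_Min_less:
  assumes "before E F" "finite E" "E \<noteq> {}" "finite F" "F \<noteq> {}"
  shows "Min E < Min F"
  using assms unfolding before_def by simp

lemma comparable_Min_inj:
  assumes "comparable E F" "finite E" "E \<noteq> {}" "finite F" "F \<noteq> {}"
  shows "Min E \<noteq> Min F"
  using assms before_Min_less unfolding comparable_def by (metis less_irrefl)

lemma sorted_enumeration:
  fixes key :: "'b \<Rightarrow> nat"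
  assumes "finite S" "inj_on key S"
  obtains e where "bij_betw e {1..card S} S"
    "\<And>p q. p \<in> {1..card S} \<Longrightarrow> q \<in> {1..card S} \<Longrightarrow> p < q \<Longrightarrow> key (e p) < key (e q)"
proof -
  define d where "d = card S"
  have card: "card (key ` S) = d" and fin: "finite (key ` S)"
    using assms by (auto simp: d_def card_image)
  define e where "e = (\<lambda>q. inv_into S key (enumerate (key ` S) (q - 1)))"
  have b1: "bij_betw (\<lambda>q::nat. q - 1) {1..d} {..<d}"
    by (rule bij_betwI[where g = Suc]) auto
  have b2: "bij_betw (enumerate (key ` S)) {..<d} (key ` S)"
    using finite_bij_enumerate[OF fin] card by simp
  have b3: "bij_betw (inv_into S key) (key ` S) S"
    using assms(2) by (simp add: bij_betw_inv_into inj_on_imp_bij_betw)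
  have "bij_betw e {1..d} S"
    using bij_betw_trans[OF bij_betw_trans[OF b1 b2] b3] by (simp add: e_def comp_def)
  moreover have "key (e p) < key (e q)" if "p \<in> {1..d}" "q \<in> {1..d}" "p < q" for p q
  proof -
    have mem: "enumerate (key ` S) (q - 1) \<in> key ` S" if "q \<in> {1..d}" for q
      using that fin card by (intro finite_enumerate_in_set) auto
    have "key (e q) = enumerate (key ` S) (q - 1)" if "q \<in> {1..d}" for q
      using mem[OF that] by (simp add: e_def f_inv_into_f)
    moreover have "enumerate (key ` S) (p - 1) < enumerate (key ` S) (q - 1)"
      using that fin card by (intro finite_enumerate_mono) auto
    ultimately show ?thesis using that by simp
  qed
  ultimately show ?thesis using that unfolding d_def by blast
qed

lemma schreier_basic: "F \<in> schreier k \<Longrightarrow> finite F \<and> F \<noteq> {} \<and> 0 \<notin> F"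
proof (induction k arbitrary: F rule: schreier.induct)
  case (3 m F)
  then obtain k :: nat and E where E: "F = (\<Union>i\<in>{1..k}. E i)" "1 \<le> k" "\<forall>i\<in>{1..k}. E i \<in> schreier (Suc m)"
    unfolding schreier.simps by blast
  then have "\<forall>i\<in>{1..k}. finite (E i) \<and> E i \<noteq> {} \<and> 0 \<notin> E i" using "3.IH" by blast
  moreover have "1 \<in> {1..k}" using E(2) by simp
  ultimately show ?case unfolding E(1) by blast
qed auto

lemma schreier_Suc:
  "F \<in> schreier (Suc k) \<longleftrightarrow>
    (\<exists>P. finite P \<and> P \<noteq> {} \<and> P \<subseteq> schreier k \<and> pairwise comparable P \<and> F = \<Union>P \<and> card P \<le> Min F)"
  (is "_ \<longleftrightarrow> ?R")
proof (cases k)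
  case 0
  show ?thesis
  proof
    assume F: "F \<in> schreier (Suc k)"
    then have F: "finite F" "F \<noteq> {}" "0 \<notin> F" "card F \<le> Min F" using 0 by auto
    let ?P = "(\<lambda>m. {m}) ` F"
    have "?P \<subseteq> schreier k" using F 0 by (auto simp: Suc_le_eq intro!: gr0I)
    moreover have "pairwise comparable ?P"
      by (auto simp: pairwise_def comparable_def before_def)
    moreover have "card ?P \<le> Min F"
      using F by (simp add: card_image)
    ultimately show ?R using F by (intro exI[of _ ?P]) auto
  next
    assume ?R
    then obtain P where P: "finite P" "P \<noteq> {}" "P \<subseteq> schreier k" "F = \<Union>P" "card P \<le> Min F"
      by blast
    have s: "\<exists>m\<ge>1. E = {m}" if "E \<in> P" for E using that P 0 by auto
    have "card F \<le> (\<Sum>E\<in>P. card E)" unfolding P by (rule card_Union_le_sum_card)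
    also have "\<dots> = card P" using s by (subst sum.cong[OF refl, of _ _ "\<lambda>_. 1"]) fastforce+
    finally have "card F \<le> Min F" using P by simp
    moreover have "finite F" "F \<noteq> {}" "0 \<notin> F" using s P by fastforce+
    ultimately show "F \<in> schreier (Suc k)" using 0 by simp
  qed
next
  case (Suc m)
  show ?thesis
  proof
    assume "F \<in> schreier (Suc k)"
    then obtain p E where E: "F = (\<Union>i\<in>{1..p}. E i)" "1 \<le> p"
      "\<And>i. i \<in> {1..p} \<Longrightarrow> E i \<in> schreier k" "successive_sets p E" "p \<le> Min (E 1)"
      using Suc by auto
    have fin: "finite (E i) \<and> E i \<noteq> {}" if "i \<in> {1..p}" for i
      using schreier_basic[OF E(3)[OF that]] by blast
    have bef: "before (E i) (E j)" if "i \<in> {1..p}" "j \<in> {1..p}" "i < j" for i j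
    proof -
      have "set_before (E i) (E j)" using E(4) that unfolding successive_sets_def by simp
      then show ?thesis using fin[OF that(1)] fin[OF that(2)] set_before_iff[of "E i" "E j"] by simp
    qed
    let ?P = "E ` {1..p}"
    have pw: "pairwise comparable ?P"
      unfolding pairwise_def comparable_def using bef by (metis (no_types, lifting) imageE linorder_neqE_nat)
    have finF: "finite F" "F \<noteq> {}" using fin E(1,2) by auto
    have "Min (E 1) \<le> x" if "x \<in> F" for x
    proof -
      obtain i where i: "i \<in> {1..p}" "x \<in> E i" using \<open>x \<in> F\<close> E(1) by blast
      have 1: "1 \<in> {1..p}" using E(2) by simp
      show ?thesis
      proof (cases "i = 1")
        case True
        then show ?thesis using i fin by simp
      next
        case False
        then have "before (E 1) (E i)" using bef[OF 1 i(1)] i by auto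
        then have "Min (E 1) < x" using fin[OF 1] i by (auto simp: before_def)
        then show ?thesis by simp
      qed
    qed
    then have "Min (E 1) \<le> Min F" using finF by simp
    moreover have "card ?P \<le> p" using card_image_le[of "{1..p}" E] by simp
    ultimately have "card ?P \<le> Min F" using E(5) by linarith
    then show ?R using pw E by (intro exI[of _ ?P]) auto
  next
    assume ?R
    then obtain P where P: "finite P" "P \<noteq> {}" "P \<subseteq> schreier k" "pairwise comparable P"
      "F = \<Union>P" "card P \<le> Min F" by blast
    have fin: "finite E \<and> E \<noteq> {}" if "E \<in> P" for E
      using that P(3) schreier_basic by blast
    have "inj_on Min P"
    proof (rule inj_onI, rule ccontr)
      fix E E' assume *: "E \<in> P" "E' \<in> P" "Min E = Min E'" "E \<noteq> E'"
      then have "comparable E E'" using P(4) by (simp add: pairwise_def)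
      then show False using comparable_Min_inj[of E E'] fin[OF *(1)] fin[OF *(2)] *(3) by blast
    qed
    then obtain e where e: "bij_betw e {1..card P} P"
      "\<And>p q. p \<in> {1..card P} \<Longrightarrow> q \<in> {1..card P} \<Longrightarrow> p < q \<Longrightarrow> Min (e p) < Min (e q)"
      using sorted_enumeration[OF P(1)] by metis
    have mem: "e i \<in> P" if "i \<in> {1..card P}" for i
      using e(1) that by (auto simp: bij_betw_def)
    have "set_before (e i) (e j)" if "i \<in> {1..card P}" "j \<in> {1..card P}" "i < j" for i j
    proof -
      have "e i \<noteq> e j" using e(2)[OF that] by auto
      then have "comparable (e i) (e j)"
        using P(4) mem that by (auto simp: pairwise_def)
      then have "before (e i) (e j)"
        using e(2)[OF that] fin mem that by (intro comparable_Min_less) simp_all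
      then show ?thesis using set_before_iff[of "e i" "e j"] fin mem that by simp
    qed
    then have "successive_sets (card P) e" by (auto simp: successive_sets_def)
    moreover have 1: "1 \<le> card P" using P by (simp add: Suc_le_eq card_gt_0_iff)
    moreover have "Min F \<le> Min (e 1)"
    proof (rule Min_antimono)
      show "e 1 \<subseteq> F" using mem[of 1] 1 P(5) by auto
      show "e 1 \<noteq> {}" using mem[of 1] 1 fin by auto
      show "finite F" using P(1,5) fin by auto
    qed
    moreover have "F = (\<Union>i\<in>{1..card P}. e i)" using e(1) P(5) by (simp add: bij_betw_def)
    moreover have "\<forall>i\<in>{1..card P}. e i \<in> schreier k" using mem P(3) by blast
    ultimately show "F \<in> schreier (Suc k)"
      using P(6) Suc by (simp; blast intro: order.trans)
  qed
qed

lemma schreier_hereditary: "F \<in> schreier k \<Longrightarrow> G \<subseteq> F \<Longrightarrow> G \<noteq> {} \<Longrightarrow> G \<in> schreier k"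
proof (induction k arbitrary: F G)
  case (Suc k)
  obtain P where P: "finite P" "P \<noteq> {}" "P \<subseteq> schreier k" "pairwise comparable P"
      "F = \<Union>P" "card P \<le> Min F" using Suc.prems(1) unfolding schreier_Suc by blast
  let ?Q = "(\<lambda>E. E \<inter> G) ` {E\<in>P. E \<inter> G \<noteq> {}}"
  have "E \<inter> G \<in> schreier k" if "E \<in> P" "E \<inter> G \<noteq> {}" for E
    using Suc.IH[of E "E \<inter> G"] that P(3) by blast
  then have "?Q \<subseteq> schreier k" by blast
  moreover have "pairwise comparable ?Q"
    unfolding pairwise_def
  proof (intro ballI impI)
    fix A B assume "A \<in> ?Q" "B \<in> ?Q" "A \<noteq> B"
    then obtain E E' where E: "E \<in> P" "E' \<in> P" "E \<noteq> E'" "A = E \<inter> G" "B = E' \<inter> G" by blast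
    then have "comparable E E'" using P(4) by (simp add: pairwise_def)
    then show "comparable A B" unfolding E(4,5) by (rule comparable_mono) auto
  qed
  moreover have "G = \<Union>?Q" using Suc.prems P(5) by auto
  moreover have "finite F" using schreier_basic[OF Suc.prems(1)] by simp
  then have "Min F \<le> Min G" using Suc.prems by (intro Min_antimono) auto
  moreover have "card ?Q \<le> card P"
    by (rule order.trans[OF card_image_le]) (use P in \<open>auto intro: card_mono\<close>)
  moreover have "?Q \<noteq> {}" using Suc.prems(3) \<open>G = \<Union>?Q\<close> by blast
  ultimately show ?case unfolding schreier_Suc using P(1,6)
    by (intro exI[of _ ?Q]) auto
qed auto

lemma schreier_spreading:
  assumes "F \<in> schreier k" "\<And>x. x \<in> F \<Longrightarrow> x \<le> g x"
    "\<And>x y. x \<in> F \<Longrightarrow> y \<in> F \<Longrightarrow> x < y \<Longrightarrow> g x < (g y :: nat)"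
  shows "g ` F \<in> schreier k"
  using assms
proof (induction k arbitrary: F)
  case 0
  then obtain m where "F = {m}" "1 \<le> m" by auto
  then show ?case using 0(2)[of m] by auto
next
  case (Suc k)
  obtain P where P: "finite P" "P \<noteq> {}" "P \<subseteq> schreier k" "pairwise comparable P"
      "F = \<Union>P" "card P \<le> Min F" using Suc.prems(1) unfolding schreier_Suc by blast
  have F: "finite F" "F \<noteq> {}" using schreier_basic[OF Suc.prems(1)] by simp_all
  let ?Q = "(\<lambda>E. g ` E) ` P"
  have "g ` E \<in> schreier k" if "E \<in> P" for E
  proof (rule Suc.IH)
    have "E \<subseteq> F" using that P(5) by blast
    then show "\<And>x. x \<in> E \<Longrightarrow> x \<le> g x" "\<And>x y. x \<in> E \<Longrightarrow> y \<in> E \<Longrightarrow> x < y \<Longrightarrow> g x < g y"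
      using Suc.prems(2,3) by blast+
  qed (use that P(3) in blast)
  then have "?Q \<subseteq> schreier k" by blast
  moreover have "pairwise comparable ?Q"
    unfolding pairwise_def
  proof (intro ballI impI)
    fix A B assume "A \<in> ?Q" "B \<in> ?Q" "A \<noteq> B"
    then obtain E E' where E: "E \<in> P" "E' \<in> P" "E \<noteq> E'" "A = g ` E" "B = g ` E'" by blast
    then have "comparable E E'" using P(4) by (simp add: pairwise_def)
    moreover have "E \<subseteq> F" "E' \<subseteq> F" using E P(5) by auto
    ultimately show "comparable A B" using Suc.prems(3) E(4,5)
      unfolding comparable_def before_def by blast
  qed
  moreover have "Min F \<le> Min (g ` F)"
    using F Suc.prems(2) by (auto intro: order.trans[OF Min_le])
  moreover have "card ?Q \<le> card P" using P(1) by (rule card_image_le)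
  moreover have "g ` F = \<Union>?Q" using P(5) by auto
  ultimately show ?case unfolding schreier_Suc using P(1,2,6)
    by (intro exI[of _ ?Q]) auto
qed

lemma schreier_singleton: "1 \<le> m \<Longrightarrow> {m} \<in> schreier k"
proof (induction k)
  case (Suc k)
  then show ?case unfolding schreier_Suc by (intro exI[of _ "{{m}}"]) auto
qed auto

lemma schreier_Suc_mono: "schreier k \<subseteq> schreier (Suc k)"
proof
  fix F assume F: "F \<in> schreier k"
  then have "1 \<le> Min F" using schreier_basic[OF F] by (metis Min_in One_nat_def Suc_leI gr0I)
  then show "F \<in> schreier (Suc k)" using F unfolding schreier_Suc by (intro exI[of _ "{F}"]) auto
qed

lemma schreier_mono: "k \<le> l \<Longrightarrow> schreier k \<subseteq> schreier l"
  using lift_Suc_mono_le[of schreier] schreier_Suc_mono by blast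

lemma schreier_convolution:
  assumes "F \<in> schreier a" "\<And>j. j \<in> F \<Longrightarrow> E j \<in> schreier b"
    "\<And>j i. j \<in> F \<Longrightarrow> i \<in> E j \<Longrightarrow> j \<le> i"
    "\<And>j j'. j \<in> F \<Longrightarrow> j' \<in> F \<Longrightarrow> j < j' \<Longrightarrow> before (E j) (E j')"
  shows "(\<Union>j\<in>F. E j) \<in> schreier (a + b)"
  using assms
proof (induction a arbitrary: F)
  case 0
  then obtain m where "F = {m}" by auto
  then show ?case using 0(2)[of m] by auto
next
  case (Suc a)
  obtain P where P: "finite P" "P \<noteq> {}" "P \<subseteq> schreier a" "pairwise comparable P"
      "F = \<Union>P" "card P \<le> Min F" using Suc.prems(1) unfolding schreier_Suc by blast
  have F: "finite F" "F \<noteq> {}" using schreier_basic[OF Suc.prems(1)] by simp_all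
  let ?U = "\<lambda>p. \<Union>j\<in>p. E j"
  let ?Q = "?U ` P"
  have "?U p \<in> schreier (a + b)" if "p \<in> P" for p
  proof -
    have "p \<subseteq> F" using that P(5) by blast
    with that P(3) show ?thesis using Suc.prems(2-4) by (intro Suc.IH) (simp_all add: subset_iff)
  qed
  then have "?Q \<subseteq> schreier (a + b)" by blast
  moreover have "pairwise comparable ?Q"
    unfolding pairwise_def
  proof (intro ballI impI)
    fix A B assume "A \<in> ?Q" "B \<in> ?Q" "A \<noteq> B"
    then obtain p q where E: "p \<in> P" "q \<in> P" "p \<noteq> q" "A = ?U p" "B = ?U q" by blast
    have "comparable p q" using P(4) E by (simp add: pairwise_def)
    moreover have "p \<subseteq> F" "q \<subseteq> F" using E P(5) by auto
    ultimately show "comparable A B"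
      using Suc.prems(4) unfolding comparable_def before_def E(4,5) by blast
  qed
  moreover have U: "(\<Union>j\<in>F. E j) = \<Union>?Q" using P(5) by auto
  moreover have "Min F \<le> Min (\<Union>j\<in>F. E j)"
  proof (rule Min.boundedI)
    have "\<forall>j\<in>F. finite (E j) \<and> E j \<noteq> {}" using schreier_basic[OF Suc.prems(2)] by simp
    then show "finite (\<Union>j\<in>F. E j)" "(\<Union>j\<in>F. E j) \<noteq> {}" using F by auto
    fix i assume "i \<in> (\<Union>j\<in>F. E j)"
    then obtain j where "j \<in> F" "i \<in> E j" by blast
    then show "Min F \<le> i" using Suc.prems(3)[of j i] Min_le[OF F(1), of j] by simp
  qed
  moreover have "card ?Q \<le> card P" using P(1) by (rule card_image_le)
  ultimately show ?case unfolding add_Suc schreier_Suc using P(1,2,6)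
    by (intro exI[of _ ?Q]) auto
qed

subsection \<open>The norming set in terms of sets of functionals\<close>

definition avg_in :: "(nat \<Rightarrow> real) set \<Rightarrow> (nat \<Rightarrow> real) \<Rightarrow> nat \<Rightarrow> bool"
  where "avg_in G \<alpha> l \<longleftrightarrow> l \<ge> 2 \<and>
    (\<exists>\<F>. finite \<F> \<and> \<F> \<noteq> {} \<and> card \<F> \<le> l \<and> \<F> \<subseteq> G \<and>
       pairwise (\<lambda>f g. comparable (supp f) (supp g)) \<F> \<and>
       \<alpha> = (\<lambda>i. (\<Sum>f\<in>\<F>. f i) / real l))"

definition prec :: "(nat \<Rightarrow> real) \<times> nat \<Rightarrow> (nat \<Rightarrow> real) \<times> nat \<Rightarrow> bool"
  where "prec a b \<longleftrightarrow> before (supp (fst a)) (supp (fst b)) \<and> snd a < snd b \<and>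
    (\<forall>i\<in>supp (fst a). i < snd b)"

definition family :: "nat \<Rightarrow> ((nat \<Rightarrow> real) \<times> nat) set \<Rightarrow> bool"
  where "family n \<A> \<longleftrightarrow> finite \<A> \<and> (\<forall>a\<in>\<A>. avg_in (W n) (fst a) (snd a)) \<and>
    pairwise (\<lambda>a b. prec a b \<or> prec b a) \<A>"

definition mins :: "((nat \<Rightarrow> real) \<times> nat) set \<Rightarrow> nat set"
  where "mins \<A> = (\<lambda>a. Min (supp (fst a))) ` \<A>"

definition famsum :: "((nat \<Rightarrow> real) \<times> nat) set \<Rightarrow> nat \<Rightarrow> real"
  where "famsum \<A> = (\<lambda>i. \<Sum>a\<in>\<A>. fst a i)"

lemma comparable_sum_at:
  fixes h :: "'b \<Rightarrow> nat \<Rightarrow> real"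
  assumes "finite S" "a \<in> S" "pairwise (\<lambda>a b. comparable (supp (h a)) (supp (h b))) S" "i \<in> supp (h a)"
  shows "(\<Sum>b\<in>S. h b i) = h a i"
proof -
  have "h b i = 0" if "b \<in> S - {a}" for b
  proof (rule ccontr)
    assume "h b i \<noteq> 0"
    then have "i \<in> supp (h b)" by (simp add: supp_def)
    moreover have "comparable (supp (h b)) (supp (h a))"
      using assms(2,3) that by (simp add: pairwise_def)
    ultimately show False using assms(4) comparable_disjoint by blast
  qed
  then have "(\<Sum>b\<in>S. h b i) = (\<Sum>b\<in>{a}. h b i)"
    using assms(1,2) by (intro sum.mono_neutral_right) auto
  then show ?thesis by simp
qed

lemma supp_comparable_sum:
  fixes h :: "'b \<Rightarrow> nat \<Rightarrow> real"
  assumes "finite S" "pairwise (\<lambda>a b. comparable (supp (h a)) (supp (h b))) S"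
  shows "supp (\<lambda>i. \<Sum>b\<in>S. h b i) = (\<Union>b\<in>S. supp (h b))"
proof
  show "supp (\<lambda>i. \<Sum>b\<in>S. h b i) \<subseteq> (\<Union>b\<in>S. supp (h b))"
    unfolding supp_def by auto (meson sum.neutral)
  show "(\<Union>b\<in>S. supp (h b)) \<subseteq> supp (\<lambda>i. \<Sum>b\<in>S. h b i)"
  proof
    fix i assume "i \<in> (\<Union>b\<in>S. supp (h b))"
    then obtain a where a: "a \<in> S" "i \<in> supp (h a)" by blast
    show "i \<in> supp (\<lambda>i. \<Sum>b\<in>S. h b i)"
      using comparable_sum_at[OF assms(1) a(1) assms(2) a(2)] a(2) by (simp add: supp_def)
  qed
qed

lemma supp_avg:
  assumes "finite \<F>" "pairwise (\<lambda>f g. comparable (supp f) (supp g)) \<F>" "l \<ge> 2"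
  shows "supp (\<lambda>i. (\<Sum>f\<in>\<F>. f i) / real l) = (\<Union>f\<in>\<F>. supp f)"
proof -
  have "supp (\<lambda>i. (\<Sum>f\<in>\<F>. f i) / real l) = supp (\<lambda>i. \<Sum>f\<in>\<F>. f i)"
    using assms(3) by (simp add: supp_def)
  then show ?thesis using supp_comparable_sum[OF assms(1), of "\<lambda>f. f"] assms(2) by simp
qed

lemma successive_before:
  assumes "successive d f" "\<And>q. q \<in> {1..d} \<Longrightarrow> finite (supp (f q)) \<and> supp (f q) \<noteq> {}"
    "p \<in> {1..d}" "q \<in> {1..d}" "p < q"
  shows "before (supp (f p)) (supp (f q))"
proof -
  have "set_before (supp (f p)) (supp (f q))"
    using assms(1,3-5) unfolding successive_def successive_sets_def by simp
  then show ?thesis using assms(2)[OF assms(3)] assms(2)[OF assms(4)]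
    set_before_iff[of "supp (f p)" "supp (f q)"] by simp
qed

lemma successive_inj:
  assumes "successive d f" "\<And>q. q \<in> {1..d} \<Longrightarrow> finite (supp (f q)) \<and> supp (f q) \<noteq> {}"
  shows "inj_on f {1..d}"
proof (rule inj_onI, rule ccontr)
  fix p q assume pq: "p \<in> {1..d}" "q \<in> {1..d}" "f p = f q" "p \<noteq> q"
  have "before (supp (f p)) (supp (f q)) \<or> before (supp (f q)) (supp (f p))"
    using successive_before[OF assms pq(1,2)] successive_before[OF assms pq(2,1)] pq(4) by linarith
  moreover have "supp (f q) \<noteq> {}" using assms(2)[OF pq(2)] by simp
  ultimately show False using pq(3) unfolding before_def by auto
qed

lemma average_of_imp_avg_in:
  assumes "\<And>f. f \<in> G \<Longrightarrow> finite (supp f) \<and> supp f \<noteq> {}" "average_of G \<alpha> l"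
  shows "avg_in G \<alpha> l"
proof -
  obtain d f where *: "l \<ge> 2" "1 \<le> d" "d \<le> l" "\<And>q. q \<in> {1..d} \<Longrightarrow> f q \<in> G"
      "successive d f" "\<alpha> = (\<lambda>i. (1 / real l) * (\<Sum>q=1..d. f q i))"
    using assms(2) by (rule average_ofE) blast
  have fin: "finite (supp (f q)) \<and> supp (f q) \<noteq> {}" if "q \<in> {1..d}" for q
    using assms(1)[OF *(4)[OF that]] .
  note inj = successive_inj[OF *(5) fin]
  have "comparable (supp (f p)) (supp (f q))" if "p \<in> {1..d}" "q \<in> {1..d}" "f p \<noteq> f q" for p q
  proof (cases "p < q")
    case True
    then show ?thesis using successive_before[OF *(5) fin that(1,2)] by (simp add: comparable_def)
  next
    case False
    then have "q < p" using that(3) by (metis linorder_neqE_nat)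
    then show ?thesis using successive_before[OF *(5) fin that(2,1)] by (simp add: comparable_def)
  qed
  then have "pairwise (\<lambda>f g. comparable (supp f) (supp g)) (f ` {1..d})"
    by (auto simp: pairwise_def)
  moreover have "\<alpha> = (\<lambda>i. (\<Sum>g\<in>f ` {1..d}. g i) / real l)"
    using *(6) sum.reindex[OF inj, of "\<lambda>g. g _"] by (simp add: comp_def)
  moreover have "card (f ` {1..d}) \<le> l" using card_image[OF inj] *(3) by simp
  moreover have "f ` {1..d} \<subseteq> G" using *(4) by blast
  moreover have "f ` {1..d} \<noteq> {}" using *(2) by simp
  ultimately show ?thesis unfolding avg_in_def using *(1)
    by (intro conjI exI[of _ "f ` {1..d}"]) simp_all
qed

lemma avg_in_imp_average_of:
  assumes "\<And>f. f \<in> G \<Longrightarrow> finite (supp f) \<and> supp f \<noteq> {}" "avg_in G \<alpha> l"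
  shows "average_of G \<alpha> l"
proof -
  obtain \<F> where *: "l \<ge> 2" "finite \<F>" "\<F> \<noteq> {}" "card \<F> \<le> l" "\<F> \<subseteq> G"
      "pairwise (\<lambda>f g. comparable (supp f) (supp g)) \<F>" "\<alpha> = (\<lambda>i. (\<Sum>f\<in>\<F>. f i) / real l)"
    using assms(2) unfolding avg_in_def by blast
  have fin: "finite (supp f) \<and> supp f \<noteq> {}" if "f \<in> \<F>" for f using that *(5) assms(1) by blast
  have "inj_on (\<lambda>f. Min (supp f)) \<F>"
  proof (rule inj_onI, rule ccontr)
    fix f g assume a: "f \<in> \<F>" "g \<in> \<F>" "Min (supp f) = Min (supp g)" "f \<noteq> g"
    then have "comparable (supp f) (supp g)" using *(6) by (simp add: pairwise_def)
    then show False using comparable_Min_inj[of "supp f" "supp g"] fin[OF a(1)] fin[OF a(2)] a(3) by simp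
  qed
  then obtain e where e: "bij_betw e {1..card \<F>} \<F>"
    "\<And>p q. p \<in> {1..card \<F>} \<Longrightarrow> q \<in> {1..card \<F>} \<Longrightarrow> p < q \<Longrightarrow> Min (supp (e p)) < Min (supp (e q))"
    using sorted_enumeration[OF *(2), of "\<lambda>f. Min (supp f)"] by metis
  have mem: "e q \<in> \<F>" if "q \<in> {1..card \<F>}" for q using e(1) that by (auto simp: bij_betw_def)
  have "set_before (supp (e p)) (supp (e q))"
    if "p \<in> {1..card \<F>}" "q \<in> {1..card \<F>}" "p < q" for p q
  proof -
    note less = e(2)[OF that]
    then have "e p \<noteq> e q" by auto
    then have "comparable (supp (e p)) (supp (e q))"
      using *(6) mem that by (simp add: pairwise_def)
    then have "before (supp (e p)) (supp (e q))"
      using less fin[OF mem[OF that(1)]] fin[OF mem[OF that(2)]] by (intro comparable_Min_less) simp_all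
    then show ?thesis using fin[OF mem[OF that(1)]] fin[OF mem[OF that(2)]]
      set_before_iff[of "supp (e p)" "supp (e q)"] by simp
  qed
  then have succ: "successive (card \<F>) e" by (simp add: successive_def successive_sets_def)
  have sum: "(\<Sum>q=1..card \<F>. e q i) = (\<Sum>f\<in>\<F>. f i)" for i
    using sum.reindex_bij_betw[OF e(1), of "\<lambda>f. f i"] by simp
  have "1 \<le> card \<F>" using *(2,3) by (simp add: Suc_le_eq card_gt_0_iff)
  then show ?thesis unfolding average_of_def
    using *(1,4,5,7) succ mem sum by (intro conjI exI[of _ "card \<F>"] exI[of _ e]) auto
qed

lemma W_stage_supp: "f \<in> W_stage n m \<Longrightarrow> supp f \<noteq> {} \<and> 0 \<notin> supp f"
proof (induction m arbitrary: f)
  case 0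
  then show ?case by (auto simp: supp_def unit_vec_def)
next
  case (Suc m)
  have fin: "finite (supp f) \<and> supp f \<noteq> {}" if "f \<in> W_stage n m" for f
    using Suc.IH[OF that] W_stage_finite_supp[OF that] by blast
  from Suc.prems show ?case
  proof (cases rule: W_stage_SucE)
    case old
    then show ?thesis by (rule Suc.IH)
  next
    case (avg l)
    then have "avg_in (W_stage n m) f l" using average_of_imp_avg_in fin by blast
    then obtain \<F> where *: "l \<ge> 2" "finite \<F>" "\<F> \<noteq> {}" "card \<F> \<le> l" "\<F> \<subseteq> W_stage n m"
      "pairwise (\<lambda>f g. comparable (supp f) (supp g)) \<F>" "f = (\<lambda>i. (\<Sum>f\<in>\<F>. f i) / real l)"
      unfolding avg_in_def by blast
    then have "supp f = (\<Union>f\<in>\<F>. supp f)" using supp_avg by simp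
    moreover have "\<forall>g\<in>\<F>. supp g \<noteq> {} \<and> 0 \<notin> supp g" using *(5) Suc.IH by (simp add: subset_iff)
    ultimately show ?thesis using *(3) by auto
  next
    case (schr d \<alpha> s)
    then have mem: "\<alpha> q \<in> W_stage n m" if "q \<in> {1..d}" for q using that by (simp add: alpha_average_def)
    have bef: "before (supp (\<alpha> p)) (supp (\<alpha> q))" if "p \<in> {1..d}" "q \<in> {1..d}" "p < q" for p q
      using schr(4) fin[OF mem] that by (intro successive_before[of d]) (auto simp: admissible_def)
    have "pairwise (\<lambda>p q. comparable (supp (\<alpha> p)) (supp (\<alpha> q))) {1..d}"
      unfolding pairwise_def comparable_def using bef by (metis linorder_neqE_nat)
    then have "supp f = (\<Union>q\<in>{1..d}. supp (\<alpha> q))"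
      unfolding schr(1) by (intro supp_comparable_sum) auto
    moreover have "1 \<in> {1..d}" using schr(2) by simp
    moreover have "\<forall>q\<in>{1..d}. supp (\<alpha> q) \<noteq> {} \<and> 0 \<notin> supp (\<alpha> q)" using Suc.IH[OF mem] by simp
    ultimately show ?thesis by blast
  qed
qed

lemma W_supp: "f \<in> W n \<Longrightarrow> finite (supp f) \<and> supp f \<noteq> {} \<and> 0 \<notin> supp f"
  unfolding W_def using W_stage_supp W_stage_finite_supp by blast

lemma W_stage_mono: "m \<le> m' \<Longrightarrow> W_stage n m \<subseteq> W_stage n m'"
  by (rule lift_Suc_mono_le[of "W_stage n"]) auto

lemma finite_subset_W_stage:
  assumes "finite \<F>" "\<F> \<subseteq> W n"
  obtains m where "\<F> \<subseteq> W_stage n m"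
proof -
  have "\<exists>m. f \<in> W_stage n m" if "f \<in> \<F>" for f using that assms(2) unfolding W_def by blast
  then obtain m where m: "\<And>f. f \<in> \<F> \<Longrightarrow> f \<in> W_stage n (m f)" by metis
  have "f \<in> W_stage n (Max (m ` \<F>))" if "f \<in> \<F>" for f
    using m[OF that] W_stage_mono[of "m f" "Max (m ` \<F>)" n] assms(1) that by auto
  then show ?thesis using that by blast
qed

lemma avg_in_mono: "avg_in G \<alpha> l \<Longrightarrow> G \<subseteq> H \<Longrightarrow> avg_in H \<alpha> l"
  unfolding avg_in_def by blast

lemma avg_in_W_stage:
  assumes "avg_in (W n) \<alpha> l"
  obtains m where "avg_in (W_stage n m) \<alpha> l"
proof -
  obtain \<F> where *: "l \<ge> 2" "finite \<F>" "\<F> \<noteq> {}" "card \<F> \<le> l" "\<F> \<subseteq> W n"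
      "pairwise (\<lambda>f g. comparable (supp f) (supp g)) \<F>" "\<alpha> = (\<lambda>i. (\<Sum>f\<in>\<F>. f i) / real l)"
    using assms(1) unfolding avg_in_def by blast
  obtain m where "\<F> \<subseteq> W_stage n m" using finite_subset_W_stage *(2,5) by blast
  then have "avg_in (W_stage n m) \<alpha> l" unfolding avg_in_def using * by blast
  then show ?thesis by (rule that)
qed

lemma W_stage_fin: "f \<in> W_stage n m \<Longrightarrow> finite (supp f) \<and> supp f \<noteq> {}"
  using W_stage_supp W_stage_finite_supp by blast

lemma average_of_stage_iff: "average_of (W_stage n m) \<alpha> l \<longleftrightarrow> avg_in (W_stage n m) \<alpha> l"
  using average_of_imp_avg_in[of "W_stage n m" \<alpha> l] avg_in_imp_average_of[of "W_stage n m" \<alpha> l]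
    W_stage_fin[of _ n m] by blast

lemma avg_in_stage_Suc: "avg_in (W_stage n m) \<alpha> l \<Longrightarrow> \<alpha> \<in> W_stage n (Suc m)"
proof -
  assume "avg_in (W_stage n m) \<alpha> l"
  then have "average_of (W_stage n m) \<alpha> l" by (simp add: average_of_stage_iff)
  then show ?thesis unfolding W_stage.simps by blast
qed

lemma W_avg: "avg_in (W n) \<alpha> l \<Longrightarrow> \<alpha> \<in> W n"
  by (erule avg_in_W_stage) (auto simp: W_def dest: avg_in_stage_Suc)

lemma unit_vec_W: "1 \<le> i \<Longrightarrow> unit_vec i \<in> W n"
  unfolding W_def by (rule UN_I[of 0]) (simp, simp, blast)

lemma family_fin: "family n \<A> \<Longrightarrow> a \<in> \<A> \<Longrightarrow> finite (supp (fst a)) \<and> supp (fst a) \<noteq> {} \<and> 0 \<notin> supp (fst a)"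
  using W_supp[OF W_avg[of n "fst a" "snd a"]] by (simp add: family_def)

lemma family_comparable:
  assumes "family n \<A>"
  shows "pairwise (\<lambda>a b. comparable (supp (fst a)) (supp (fst b))) \<A>"
  using assms by (auto simp: family_def pairwise_def comparable_def prec_def)

lemma family_subset: "family n \<A> \<Longrightarrow> \<B> \<subseteq> \<A> \<Longrightarrow> family n \<B>"
  unfolding family_def pairwise_def by (meson finite_subset subsetD)

lemma supp_famsum:
  assumes "family n \<A>"
  shows "supp (famsum \<A>) = (\<Union>a\<in>\<A>. supp (fst a))"
proof -
  have "finite \<A>" using assms by (simp add: family_def)
  then show ?thesis unfolding famsum_def
    by (rule supp_comparable_sum[OF _ family_comparable[OF assms]])
qed

abbreviation mass :: "((nat \<Rightarrow> real) \<times> nat) set \<Rightarrow> (nat \<Rightarrow> real) \<Rightarrow> real"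
  where "mass \<A> x \<equiv> (\<Sum>a\<in>\<A>. \<bar>pairing (fst a) x\<bar>)"

lemma family_prec:
  assumes "family n \<A>" "a \<in> \<A>" "b \<in> \<A>" "Min (supp (fst a)) < Min (supp (fst b))"
  shows "prec a b"
proof -
  have "a \<noteq> b" using assms(4) by auto
  then have "prec a b \<or> prec b a" using assms(1-3) by (simp add: family_def pairwise_def)
  moreover have "\<not> prec b a"
  proof
    assume "prec b a"
    then have "Min (supp (fst b)) < Min (supp (fst a))"
      using family_fin[OF assms(1,2)] family_fin[OF assms(1,3)]
      by (intro before_Min_less) (simp_all add: prec_def)
    then show False using assms(4) by simp
  qed
  ultimately show ?thesis by blast
qed

lemma family_Min_inj:
  assumes "family n \<A>"
  shows "inj_on (\<lambda>a. Min (supp (fst a))) \<A>"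
proof (rule inj_onI, rule ccontr)
  fix f g assume a: "f \<in> \<A>" "g \<in> \<A>" "Min (supp (fst f)) = Min (supp (fst g))" "f \<noteq> g"
  then have "comparable (supp (fst f)) (supp (fst g))"
    using family_comparable[OF assms] by (simp add: pairwise_def)
  then show False using comparable_Min_inj[of "supp (fst f)" "supp (fst g)"]
      family_fin[OF assms(1) a(1)] family_fin[OF assms(1) a(2)] a(3) by simp
qed

lemma W_family:
  assumes "family n \<A>" "mins \<A> \<in> schreier n"
  shows "famsum \<A> \<in> W n"
proof -
  have fin: "finite \<A>" using assms(1) by (simp add: family_def)
  obtain e where e: "bij_betw e {1..card \<A>} \<A>"
    "\<And>p q. p \<in> {1..card \<A>} \<Longrightarrow> q \<in> {1..card \<A>} \<Longrightarrow> p < q \<Longrightarrow>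
       Min (supp (fst (e p))) < Min (supp (fst (e q)))"
    using sorted_enumeration[OF fin family_Min_inj[OF assms(1)]] by metis
  define d where "d = card \<A>"
  define \<alpha> where "\<alpha> = (\<lambda>q. fst (e q))"
  define s where "s = (\<lambda>q. snd (e q))"
  have mem: "e q \<in> \<A>" if "q \<in> {1..d}" for q using e(1) that by (auto simp: bij_betw_def d_def)
  have sfin: "finite (supp (\<alpha> q)) \<and> supp (\<alpha> q) \<noteq> {}" if "q \<in> {1..d}" for q
    using family_fin[OF assms(1) mem[OF that]] by (simp add: \<alpha>_def)
  have prec: "prec (e p) (e q)" if "p \<in> {1..d}" "q \<in> {1..d}" "p < q" for p q
    using family_prec[OF assms(1) mem[OF that(1)] mem[OF that(2)]] e(2)[of p q] that by (simp add: d_def)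
  have "set_before (supp (\<alpha> p)) (supp (\<alpha> q))" if "p \<in> {1..d}" "q \<in> {1..d}" "p < q" for p q
    using prec[OF that] sfin[OF that(1)] sfin[OF that(2)] set_before_iff[of "supp (\<alpha> p)" "supp (\<alpha> q)"]
    by (simp add: prec_def \<alpha>_def)
  then have succ: "successive d \<alpha>" by (simp add: successive_def successive_sets_def)
  have "strict_mono_on {1..d} s"
    using prec by (auto simp: strict_mono_on_def prec_def s_def)
  moreover have "s q > Max (supp (\<alpha> (q - 1)))" if "q \<in> {2..d}" for q
  proof -
    have q: "q - 1 \<in> {1..d}" "q \<in> {1..d}" "q - 1 < q" using that by auto
    then have "\<forall>i\<in>supp (\<alpha> (q - 1)). i < s q" using prec[OF q] by (simp add: prec_def \<alpha>_def s_def)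
    then show ?thesis using sfin[OF q(1)] by simp
  qed
  ultimately have vfg: "very_fast_growing d \<alpha> s" using succ by (simp add: very_fast_growing_def)
  have "{Min (supp (\<alpha> q)) | q. q \<in> {1..d}} = mins \<A>"
  proof -
    have "\<A> = e ` {1..d}" using e(1) by (simp add: bij_betw_def d_def)
    then show ?thesis unfolding mins_def \<alpha>_def by (auto simp: image_image)
  qed
  then have adm: "admissible n d \<alpha>" using succ assms(2) by (simp add: admissible_def)
  have avg: "avg_in (W n) (\<alpha> q) (s q)" if "q \<in> {1..d}" for q
    using assms(1) mem[OF that] by (simp add: family_def \<alpha>_def s_def)
  have "\<exists>m. avg_in (W_stage n m) (\<alpha> q) (s q)" if "q \<in> {1..d}" for q
    by (rule avg_in_W_stage[OF avg[OF that]]) blast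
  then obtain m where m: "\<And>q. q \<in> {1..d} \<Longrightarrow> avg_in (W_stage n (m q)) (\<alpha> q) (s q)" by metis
  define M where "M = Max (m ` {1..d})"
  have "alpha_average (W_stage n (Suc M)) (\<alpha> q) (s q)" if "q \<in> {1..d}" for q
  proof -
    have "m q \<le> M" using that by (simp add: M_def)
    then have 1: "avg_in (W_stage n M) (\<alpha> q) (s q)"
      using m[OF that] W_stage_mono[of "m q" M n] avg_in_mono by blast
    have "W_stage n M \<subseteq> W_stage n (Suc M)" by (rule W_stage_mono) simp
    then show ?thesis unfolding alpha_average_def
      using avg_in_stage_Suc[OF 1] avg_in_mono[OF 1, of "W_stage n (Suc M)"] \<open>W_stage n M \<subseteq> _\<close>
      by (simp add: average_of_stage_iff del: W_stage.simps)
  qed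
  moreover have "1 \<le> d"
    using fin assms(2) schreier_basic[of "mins \<A>"] by (auto simp: d_def mins_def Suc_le_eq card_gt_0_iff)
  moreover have "famsum \<A> = (\<lambda>i. \<Sum>q=1..d. \<alpha> q i)"
    using sum.reindex_bij_betw[OF e(1), of "\<lambda>a. fst a _"] by (simp add: famsum_def d_def \<alpha>_def)
  ultimately have "\<exists>d \<alpha>. famsum \<A> = (\<lambda>i. \<Sum>q=1..d. \<alpha> q i) \<and> 1 \<le> d \<and>
      (\<exists>s. (\<forall>q\<in>{1..d}. alpha_average (W_stage n (Suc M)) (\<alpha> q) (s q)) \<and>
        admissible n d \<alpha> \<and> very_fast_growing d \<alpha> s)"
    using adm vfg by blast
  then have "famsum \<A> \<in> W_stage n (Suc (Suc M))"
    unfolding W_stage.simps(2)[of n "Suc M"] by blast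
  then show ?thesis unfolding W_def by blast
qed

lemma W_induct [consumes 1, case_names unit avg family]:
  assumes "f \<in> W n"
    and unit: "\<And>i c. 1 \<le> i \<Longrightarrow> \<bar>c\<bar> = 1 \<Longrightarrow> P (\<lambda>j. c * unit_vec i j)"
    and avg: "\<And>l \<alpha>. avg_in {g \<in> W n. P g} \<alpha> l \<Longrightarrow> P \<alpha>"
    and fam: "\<And>\<A>. family n \<A> \<Longrightarrow> mins \<A> \<in> schreier n \<Longrightarrow>
      (\<And>a. a \<in> \<A> \<Longrightarrow> avg_in {g \<in> W n. P g} (fst a) (snd a)) \<Longrightarrow> P (famsum \<A>)"
  shows "P f"
proof -
  have "P f" if "f \<in> W_stage n m" for m using that
  proof (induction m arbitrary: f)
    case 0
    then consider i where "1 \<le> i" "f = unit_vec i" | i where "1 \<le> i" "f = - unit_vec i"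
      unfolding W_stage.simps by blast
    then show ?case
    proof cases
      case 1
      then show ?thesis using unit[of i 1] by simp
    next
      case 2
      then have "f = (\<lambda>j. (-1) * unit_vec i j)" by (simp add: fun_eq_iff)
      then show ?thesis using unit[of i "-1"] 2(1) by simp
    qed
  next
    case (Suc m)
    have subW: "W_stage n m \<subseteq> W n" unfolding W_def by blast
    have sub: "W_stage n m \<subseteq> {g \<in> W n. P g}" using Suc.IH unfolding W_def by blast
    from Suc.prems show ?case
    proof (cases rule: W_stage_SucE)
      case old
      then show ?thesis by (rule Suc.IH)
    next
      case (avg l)
      then have "avg_in (W_stage n m) f l" by (simp add: average_of_stage_iff)
      then show ?thesis using assms(3) avg_in_mono[OF _ sub] by blast
    next
      case (schr d \<alpha> s)
      have mem: "\<alpha> q \<in> W_stage n m" if "q \<in> {1..d}" for q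
        using schr(3) that by (simp add: alpha_average_def)
      have av: "avg_in (W_stage n m) (\<alpha> q) (s q)" if "q \<in> {1..d}" for q
        using schr(3) that by (simp add: alpha_average_def average_of_stage_iff)
      have succ: "successive d \<alpha>" using schr(4) by (simp add: admissible_def)
      have fin: "finite (supp (\<alpha> q)) \<and> supp (\<alpha> q) \<noteq> {}" if "q \<in> {1..d}" for q
        using W_stage_fin[OF mem[OF that]] .
      have bef: "before (supp (\<alpha> p)) (supp (\<alpha> q))" if "p \<in> {1..d}" "q \<in> {1..d}" "p < q" for p q
        by (rule successive_before[OF succ _ that]) (rule fin)
      have inj: "inj_on \<alpha> {1..d}" by (rule successive_inj[OF succ]) (rule fin)
      define \<A> where "\<A> = (\<lambda>q. (\<alpha> q, s q)) ` {1..d}"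
      have prec: "prec (\<alpha> p, s p) (\<alpha> q, s q)" if "p \<in> {1..d}" "q \<in> {1..d}" "p < q" for p q
      proof -
        have 1: "s p < s q" using schr(5) that by (simp add: very_fast_growing_def strict_mono_on_def)
        have q: "q \<in> {2..d}" "q - 1 \<in> {1..d}" using that by auto
        then have 2: "Max (supp (\<alpha> (q - 1))) < s q" using schr(5) by (simp add: very_fast_growing_def)
        have 3: "i < s q" if "i \<in> supp (\<alpha> (q - 1))" for i
          using 2 Max_ge[of "supp (\<alpha> (q - 1))" i] fin[OF q(2)] that by simp
        have "i < s q" if i: "i \<in> supp (\<alpha> p)" for i
        proof (cases "p = q - 1")
          case True
          then show ?thesis using 3 i by simp
        next
          case False
          then have "before (supp (\<alpha> p)) (supp (\<alpha> (q - 1)))"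
            using bef[of p "q - 1"] \<open>p < q\<close> \<open>p \<in> {1..d}\<close> q(2) by simp
          moreover obtain j where "j \<in> supp (\<alpha> (q - 1))" using fin[OF q(2)] by blast
          ultimately show ?thesis using 3[of j] beforeD[of "supp (\<alpha> p)" "supp (\<alpha> (q - 1))" i j] i by simp
        qed
        then show ?thesis using 1 bef[OF that] by (simp add: prec_def)
      qed
      have "pairwise (\<lambda>a b. prec a b \<or> prec b a) \<A>"
        unfolding pairwise_def
      proof (intro ballI impI)
        fix a b assume "a \<in> \<A>" "b \<in> \<A>" "a \<noteq> b"
        then obtain p q where "p \<in> {1..d}" "q \<in> {1..d}" "p \<noteq> q" "a = (\<alpha> p, s p)" "b = (\<alpha> q, s q)"
          unfolding \<A>_def by blast
        then show "prec a b \<or> prec b a" using prec by (cases "p < q") simp_all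
      qed
      moreover have "avg_in (W n) (fst a) (snd a)" if "a \<in> \<A>" for a
        using that av avg_in_mono[of "W_stage n m" _ _ "W n"] subW by (auto simp: \<A>_def)
      ultimately have F: "family n \<A>" unfolding family_def by (simp add: \<A>_def)
      have "mins \<A> = {Min (supp (\<alpha> q)) | q. q \<in> {1..d}}"
        unfolding mins_def \<A>_def image_image by auto
      then have M: "mins \<A> \<in> schreier n" using schr(4) by (simp add: admissible_def)
      have A: "avg_in {g \<in> W n. P g} (fst a) (snd a)" if "a \<in> \<A>" for a
        using that av avg_in_mono[OF _ sub] by (auto simp: \<A>_def)
      have inj2: "inj_on (\<lambda>q. (\<alpha> q, s q)) {1..d}"
      proof (rule inj_onI)
        fix p q assume "p \<in> {1..d}" "q \<in> {1..d}" "(\<alpha> p, s p) = (\<alpha> q, s q)"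
        then show "p = q" using inj_onD[OF inj, of p q] by simp
      qed
      have "famsum \<A> = f" unfolding schr(1) famsum_def \<A>_def
        by (simp only: sum.reindex[OF inj2] comp_def fst_conv)
      then show ?thesis using fam[OF F M A] by simp
    qed
  qed
  then show ?thesis using assms(1) unfolding W_def by blast
qed

subsection \<open>Pairings and the norm\<close>

lemma bdd_above_pairing: "bdd_above ((\<lambda>f. pairing f x) ` W n)"
  using abs_pairing_le by (intro bdd_aboveI[of _ "\<Sum>i\<in>supp x. \<bar>x i\<bar>"]) (auto simp: abs_le_iff)

lemma abs_pairing_le_W_norm:
  assumes "f \<in> W n"
  shows "\<bar>pairing f x\<bar> \<le> W_norm n x"
proof -
  have "pairing f x \<le> W_norm n x" if "f \<in> W n" for f
    unfolding W_norm_def by (rule cSUP_upper[OF that bdd_above_pairing])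
  from this[OF assms] this[OF W_uminus[OF assms]] show ?thesis
    by (simp add: pairing_def sum_negf abs_le_iff)
qed

lemma W_norm_le: "(\<And>f. f \<in> W n \<Longrightarrow> pairing f x \<le> C) \<Longrightarrow> W_norm n x \<le> C"
  unfolding W_norm_def by (rule cSUP_least[OF W_nonempty])

lemma W_norm_nonneg: "0 \<le> W_norm n x"
proof -
  have "\<bar>pairing (unit_vec 1) x\<bar> \<le> W_norm n x" by (rule abs_pairing_le_W_norm[OF unit_vec_W]) simp
  then show ?thesis by linarith
qed

lemma W_norm_approx:
  assumes "r < W_norm n x"
  obtains f where "f \<in> W n" "r < pairing f x"
  using assms less_cSUP_iff[OF W_nonempty bdd_above_pairing] unfolding W_norm_def by blast

definition lc :: "(nat \<Rightarrow> real) \<Rightarrow> nat set \<Rightarrow> (nat \<Rightarrow> nat \<Rightarrow> real) \<Rightarrow> nat \<Rightarrow> real"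
  where "lc c I x = (\<lambda>t. \<Sum>i\<in>I. c i * x i t)"

lemma supp_lc: "supp (lc c I x) \<subseteq> (\<Union>i\<in>I. supp (x i))"
proof
  fix t assume "t \<in> supp (lc c I x)"
  then have "(\<Sum>i\<in>I. c i * x i t) \<noteq> 0" by (simp add: supp_def lc_def)
  then obtain i where "i \<in> I" "c i * x i t \<noteq> 0" by (rule sum.not_neutral_contains_not_neutral)
  then show "t \<in> (\<Union>i\<in>I. supp (x i))" by (auto simp: supp_def)
qed

lemma lc_c00: "finite I \<Longrightarrow> (\<And>i. i \<in> I \<Longrightarrow> x i \<in> c00) \<Longrightarrow> lc c I x \<in> c00"
  using supp_lc[of c I x] by (auto simp: c00_def lc_def intro: finite_subset)

lemma pairing_lc:
  assumes "finite I" "\<And>i. i \<in> I \<Longrightarrow> x i \<in> c00"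
  shows "pairing f (lc c I x) = (\<Sum>i\<in>I. c i * pairing f (x i))"
proof -
  let ?A = "\<Union>i\<in>I. supp (x i)"
  have fin: "finite ?A" using assms by (auto simp: c00_def)
  have "pairing f (lc c I x) = (\<Sum>t\<in>?A. f t * lc c I x t)"
    by (rule pairing_eq[OF fin supp_lc])
  also have "\<dots> = (\<Sum>t\<in>?A. \<Sum>i\<in>I. c i * (f t * x i t))"
    by (simp add: lc_def sum_distrib_left mult.left_commute)
  also have "\<dots> = (\<Sum>i\<in>I. c i * (\<Sum>t\<in>?A. f t * x i t))"
    by (subst sum.swap) (simp add: sum_distrib_left)
  also have "\<dots> = (\<Sum>i\<in>I. c i * pairing f (x i))"
  proof (rule sum.cong[OF refl])
    fix i assume "i \<in> I"
    then have "supp (x i) \<subseteq> ?A" by blast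
    then show "c i * (\<Sum>t\<in>?A. f t * x i t) = c i * pairing f (x i)" by (simp add: pairing_eq[OF fin])
  qed
  finally show ?thesis .
qed

lemma pairing_sum_left: "pairing (\<lambda>i. \<Sum>a\<in>S. h a i) x = (\<Sum>a\<in>S. pairing (h a) x)"
  unfolding pairing_def by (simp add: sum_distrib_right) (rule sum.swap)

lemma pairing_divide_left: "pairing (\<lambda>i. f i / r) x = pairing f x / r"
  unfolding pairing_def by (simp add: sum_divide_distrib)

lemma pairing_disjoint: "supp f \<inter> supp x = {} \<Longrightarrow> pairing f x = 0"
  unfolding pairing_def by (rule sum.neutral) (auto simp: supp_def)

subsection \<open>Very fast growing families\<close>

lemma family_first:
  assumes "family n \<A>" "\<A> \<noteq> {}"
  obtains a where "a \<in> \<A>" "\<And>b. b \<in> \<A> \<Longrightarrow> b \<noteq> a \<Longrightarrow> prec a b"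
proof -
  let ?k = "\<lambda>a. Min (supp (fst a))"
  have fin: "finite \<A>" using assms(1) by (simp add: family_def)
  have "Min (?k ` \<A>) \<in> ?k ` \<A>" using fin assms(2) by simp
  then obtain a where a: "a \<in> \<A>" "?k a = Min (?k ` \<A>)" by auto
  have "prec a b" if "b \<in> \<A>" "b \<noteq> a" for b
  proof (rule family_prec[OF assms(1) a(1) that(1)])
    have "?k a \<le> ?k b" using a(2) fin that(1) by simp
    moreover have "?k a \<noteq> ?k b" using inj_onD[OF family_Min_inj[OF assms(1)], of a b] a(1) that by blast
    ultimately show "?k a < ?k b" by simp
  qed
  then show ?thesis using that a(1) by blast
qed

lemma mins_subset_schreier:
  "mins \<A> \<in> schreier k \<Longrightarrow> \<B> \<subseteq> \<A> \<Longrightarrow> \<B> \<noteq> {} \<Longrightarrow> mins \<B> \<in> schreier k"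
  by (rule schreier_hereditary) (auto simp: mins_def)

lemma family_image:
  assumes "family n \<A>"
    and g: "\<And>a. a \<in> \<A> \<Longrightarrow> snd (g a) = snd a \<and> supp (fst (g a)) \<subseteq> supp (fst a) \<and>
      avg_in (W n) (fst (g a)) (snd a)"
  shows "family n (g ` \<A>)" and "inj_on g \<A>" and "mins \<A> \<in> schreier k \<Longrightarrow> mins (g ` \<A>) \<in> schreier k"
proof -
  have prec: "prec (g a) (g b)" if "prec a b" "a \<in> \<A>" "b \<in> \<A>" for a b
    using that(1) g[OF that(2)] g[OF that(3)] before_mono[of "supp (fst a)" "supp (fst b)"]
    unfolding prec_def by auto
  have "pairwise (\<lambda>a b. prec a b \<or> prec b a) (g ` \<A>)"
    unfolding pairwise_def
  proof (intro ballI impI)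
    fix a b assume "a \<in> g ` \<A>" "b \<in> g ` \<A>" "a \<noteq> b"
    then obtain a' b' where *: "a' \<in> \<A>" "b' \<in> \<A>" "a = g a'" "b = g b'" "a' \<noteq> b'" by blast
    then have "prec a' b' \<or> prec b' a'" using assms(1) by (simp add: family_def pairwise_def)
    then show "prec a b \<or> prec b a" using prec * by blast
  qed
  then show F: "family n (g ` \<A>)" using assms(1) g by (simp add: family_def)
  show "inj_on g \<A>"
  proof (rule inj_onI, rule ccontr)
    fix a b assume *: "a \<in> \<A>" "b \<in> \<A>" "g a = g b" "a \<noteq> b"
    then have "prec a b \<or> prec b a" using assms(1) by (simp add: family_def pairwise_def)
    then have "snd a \<noteq> snd b" by (auto simp: prec_def)
    then show False using g[OF *(1)] g[OF *(2)] *(3) by simp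
  qed
  assume S: "mins \<A> \<in> schreier k"
  let ?k = "\<lambda>a. Min (supp (fst a))"
  define \<phi> where "\<phi> = (\<lambda>m. ?k (g (inv_into \<A> ?k m)))"
  have \<phi>: "\<phi> (?k a) = ?k (g a)" if "a \<in> \<A>" for a
    unfolding \<phi>_def using inv_into_f_f[OF family_Min_inj[OF assms(1)] that] by simp
  have fin: "finite (supp (fst (g a))) \<and> supp (fst (g a)) \<noteq> {}" if "a \<in> \<A>" for a
    using family_fin[OF F, of "g a"] that by simp
  have "mins (g ` \<A>) = \<phi> ` mins \<A>"
    unfolding mins_def image_image using \<phi> by auto
  also have "\<dots> \<in> schreier k"
  proof (rule schreier_spreading[OF S])
    fix m assume "m \<in> mins \<A>"
    then obtain a where a: "a \<in> \<A>" "m = ?k a" unfolding mins_def by blast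
    have "?k a \<le> ?k (g a)"
      using g[OF a(1)] fin[OF a(1)] family_fin[OF assms(1) a(1)] by (intro Min_antimono) auto
    then show "m \<le> \<phi> m" using \<phi>[OF a(1)] a(2) by simp
  next
    fix m m' assume "m \<in> mins \<A>" "m' \<in> mins \<A>" "m < m'"
    then obtain a b where a: "a \<in> \<A>" "m = ?k a" and b: "b \<in> \<A>" "m' = ?k b" unfolding mins_def by blast
    then have "prec a b" using family_prec[OF assms(1) a(1) b(1)] \<open>m < m'\<close> by simp
    then have "before (supp (fst (g a))) (supp (fst (g b)))"
      using prec a(1) b(1) by (simp add: prec_def)
    then have "?k (g a) < ?k (g b)" using fin[OF a(1)] fin[OF b(1)] by (intro before_Min_less) auto
    then show "\<phi> m < \<phi> m'" using \<phi> a b by simp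
  qed
  finally show "mins (g ` \<A>) \<in> schreier k" .
qed

lemma avg_in_W_uminus:
  assumes "avg_in (W n) \<alpha> l"
  shows "avg_in (W n) (- \<alpha>) l"
proof -
  have fin: "finite (supp f) \<and> supp f \<noteq> {}" if "f \<in> W n" for f using W_supp[OF that] by simp
  have "average_of (W n) \<alpha> l" by (rule avg_in_imp_average_of[OF fin assms])
  then have "average_of (W n) (- \<alpha>) l" by (rule average_of_uminus[rotated]) (rule W_uminus)
  then show ?thesis by (rule average_of_imp_avg_in[rotated]) (rule fin)
qed

lemma family_abs_sum:
  assumes "family n \<A>" "mins \<A> \<in> schreier n"
  shows "mass \<A> x \<le> W_norm n x"
proof -
  define g where "g = (\<lambda>a. if pairing (fst a) x < 0 then (- fst a, snd a :: nat) else a)"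
  have g: "snd (g a) = snd a \<and> supp (fst (g a)) \<subseteq> supp (fst a) \<and> avg_in (W n) (fst (g a)) (snd a)"
    if "a \<in> \<A>" for a
    using assms(1) that avg_in_W_uminus by (auto simp: g_def supp_uminus family_def)
  note I = family_image[OF assms(1) g]
  have neg: "pairing (- f) x = - pairing f x" for f by (simp add: pairing_def sum_negf)
  have "pairing (famsum (g ` \<A>)) x = (\<Sum>a\<in>\<A>. pairing (fst (g a)) x)"
    using I(2) by (simp add: famsum_def pairing_sum_left sum.reindex)
  also have "\<dots> = mass \<A> x"
    by (rule sum.cong) (auto simp: g_def neg)
  finally show ?thesis
    using abs_pairing_le_W_norm[OF W_family[OF I(1) I(3)[OF _ assms(2)]], of x] by simp
qed

definition rst :: "nat set \<Rightarrow> (nat \<Rightarrow> real) \<Rightarrow> nat \<Rightarrow> real"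
  where "rst E f = (\<lambda>i. if i \<in> E then f i else 0)"

lemma supp_rst: "supp (rst E f) = supp f \<inter> E"
  by (auto simp: supp_def rst_def)

lemma pairing_rst: "supp x \<subseteq> E \<Longrightarrow> pairing (rst E f) x = pairing f x"
  unfolding pairing_def by (rule sum.cong) (auto simp: rst_def)

lemma avg_in_rst:
  assumes "avg_in {g \<in> W n. supp g \<inter> E \<noteq> {} \<longrightarrow> rst E g \<in> W n} \<alpha> l" "supp \<alpha> \<inter> E \<noteq> {}"
  shows "avg_in (W n) (rst E \<alpha>) l"
proof -
  obtain \<F> where *: "l \<ge> 2" "finite \<F>" "\<F> \<noteq> {}" "card \<F> \<le> l"
      "\<F> \<subseteq> {g \<in> W n. supp g \<inter> E \<noteq> {} \<longrightarrow> rst E g \<in> W n}"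
      "pairwise (\<lambda>f g. comparable (supp f) (supp g)) \<F>" "\<alpha> = (\<lambda>i. (\<Sum>f\<in>\<F>. f i) / real l)"
    using assms(1) unfolding avg_in_def by blast
  define \<G> where "\<G> = {f \<in> \<F>. supp f \<inter> E \<noteq> {}}"
  have comp: "comparable (supp f) (supp g)" if "f \<in> \<G>" "g \<in> \<G>" "f \<noteq> g" for f g
    using that *(6) by (simp add: pairwise_def \<G>_def)
  have inj: "inj_on (rst E) \<G>"
  proof (rule inj_onI, rule ccontr)
    fix f g assume a: "f \<in> \<G>" "g \<in> \<G>" "rst E f = rst E g" "f \<noteq> g"
    then have "supp f \<inter> E = supp g \<inter> E" using supp_rst by metis
    moreover obtain i where "i \<in> supp f \<inter> E" using a(1) by (auto simp: \<G>_def)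
    ultimately show False using comparable_disjoint[OF comp[OF a(1,2,4)], of i] by blast
  qed
  have fin: "finite \<G>" using *(2) by (simp add: \<G>_def)
  have "supp \<alpha> = (\<Union>f\<in>\<F>. supp f)" unfolding *(7) using *(2,6,1) by (rule supp_avg)
  then have ne: "\<G> \<noteq> {}" using assms(2) by (auto simp: \<G>_def)
  have "rst E \<alpha> i = (\<Sum>f\<in>rst E ` \<G>. f i) / real l" for i
  proof -
    have "(\<Sum>f\<in>rst E ` \<G>. f i) = (\<Sum>f\<in>\<G>. rst E f i)" using inj by (simp add: sum.reindex)
    also have "\<dots> = (\<Sum>f\<in>\<F>. rst E f i)"
      using *(2) by (intro sum.mono_neutral_left) (auto simp: \<G>_def rst_def supp_def)
    finally show ?thesis unfolding *(7) rst_def by simp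
  qed
  moreover have "card (rst E ` \<G>) \<le> l"
    using card_image_le[OF fin, of "rst E"] card_mono[OF *(2), of \<G>] *(4) by (simp add: \<G>_def)
  moreover have "rst E ` \<G> \<subseteq> W n" using *(5) by (auto simp: \<G>_def)
  moreover have "pairwise (\<lambda>f g. comparable (supp f) (supp g)) (rst E ` \<G>)"
    unfolding pairwise_def
  proof (intro ballI impI)
    fix a b assume "a \<in> rst E ` \<G>" "b \<in> rst E ` \<G>" "a \<noteq> b"
    then obtain f g where "f \<in> \<G>" "g \<in> \<G>" "f \<noteq> g" "a = rst E f" "b = rst E g" by blast
    then show "comparable (supp a) (supp b)"
      using comparable_mono[OF comp] by (simp add: supp_rst)
  qed
  ultimately show ?thesis unfolding avg_in_def using *(1) fin ne
    by (intro conjI exI[of _ "rst E ` \<G>"]) auto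
qed

lemma signed_unit_vec_W:
  assumes "1 \<le> i" "\<bar>c\<bar> = 1"
  shows "(\<lambda>j. c * unit_vec i j) \<in> W n"
proof (cases "c = 1")
  case True
  then show ?thesis using unit_vec_W[OF assms(1)] by simp
next
  case False
  then have "c = -1" using assms(2) by linarith
  then have "(\<lambda>j. c * unit_vec i j) = - unit_vec i" by (simp add: fun_eq_iff)
  then show ?thesis using W_uminus[OF unit_vec_W[OF assms(1)]] by simp
qed

lemma W_rst_aux:
  assumes "f \<in> W n"
  shows "supp f \<inter> E \<noteq> {} \<longrightarrow> rst E f \<in> W n"
  using assms
proof (induction rule: W_induct)
  case (unit i c)
  have "supp (\<lambda>j. c * unit_vec i j) = {i}" using unit(2) by (auto simp: supp_def unit_vec_def)
  moreover have "rst E (\<lambda>j. c * unit_vec i j) = (\<lambda>j. c * unit_vec i j)" if "i \<in> E"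
    using that by (auto simp: rst_def unit_vec_def)
  ultimately show ?case using signed_unit_vec_W[OF unit] by simp
next
  case (avg l \<alpha>)
  then show ?case using W_avg[OF avg_in_rst] by blast
next
  case (family \<A>)
  show ?case
  proof
    assume ne: "supp (famsum \<A>) \<inter> E \<noteq> {}"
    define \<B> where "\<B> = {a \<in> \<A>. supp (fst a) \<inter> E \<noteq> {}}"
    have sub: "\<B> \<subseteq> \<A>" by (auto simp: \<B>_def)
    have "\<B> \<noteq> {}" using ne unfolding \<B>_def supp_famsum[OF family(1)] by blast
    then have S: "mins \<B> \<in> schreier n" using mins_subset_schreier[OF family(2) sub] by blast
    define g where "g = (\<lambda>a. (rst E (fst a), snd a :: nat))"
    have g: "snd (g a) = snd a \<and> supp (fst (g a)) \<subseteq> supp (fst a) \<and> avg_in (W n) (fst (g a)) (snd a)"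
      if "a \<in> \<B>" for a
      using avg_in_rst[OF family(3), of a] that by (simp add: g_def supp_rst \<B>_def)
    note I = family_image[OF family_subset[OF family(1) sub] g]
    have "famsum (g ` \<B>) = rst E (famsum \<A>)"
    proof
      fix i
      have "famsum (g ` \<B>) i = (\<Sum>a\<in>\<B>. rst E (fst a) i)"
        using I(2) by (simp add: famsum_def sum.reindex g_def)
      also have "\<dots> = (\<Sum>a\<in>\<A>. rst E (fst a) i)"
        using family(1) by (intro sum.mono_neutral_left) (auto simp: family_def \<B>_def rst_def supp_def)
      finally show "famsum (g ` \<B>) i = rst E (famsum \<A>) i" by (simp add: rst_def famsum_def)
    qed
    then show "rst E (famsum \<A>) \<in> W n" using W_family[OF I(1) I(3)[OF _ S]] by simp
  qed
qed

lemma W_rst: "f \<in> W n \<Longrightarrow> supp f \<inter> E \<noteq> {} \<Longrightarrow> rst E f \<in> W n"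
  using W_rst_aux by blast

lemma family_restrict:
  assumes "family n \<A>" "mins \<A> \<in> schreier k" "a0 \<in> \<A>" "supp (fst a0) \<inter> E \<noteq> {}"
  obtains \<B> where "family n \<B>" "mins \<B> \<in> schreier k" "\<And>b. b \<in> \<B> \<Longrightarrow> supp (fst b) \<subseteq> E \<and> snd b \<in> snd ` \<A>"
    "\<And>x. supp x \<subseteq> E \<Longrightarrow> mass \<B> x = mass \<A> x"
proof -
  define \<B> where "\<B> = {a \<in> \<A>. supp (fst a) \<inter> E \<noteq> {}}"
  have sub: "\<B> \<subseteq> \<A>" by (auto simp: \<B>_def)
  have "\<B> \<noteq> {}" using assms(3,4) unfolding \<B>_def by blast
  then have S: "mins \<B> \<in> schreier k" using mins_subset_schreier[OF assms(2) sub] by blast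
  define g where "g = (\<lambda>a. (rst E (fst a), snd a :: nat))"
  have "{g \<in> W n. supp g \<inter> E \<noteq> {} \<longrightarrow> rst E g \<in> W n} = W n" using W_rst_aux[of _ n E] by auto
  then have "avg_in {g \<in> W n. supp g \<inter> E \<noteq> {} \<longrightarrow> rst E g \<in> W n} (fst a) (snd a)" if "a \<in> \<A>" for a
    using assms(1) that by (simp add: family_def)
  then have g: "snd (g a) = snd a \<and> supp (fst (g a)) \<subseteq> supp (fst a) \<and> avg_in (W n) (fst (g a)) (snd a)"
    if "a \<in> \<B>" for a
    using avg_in_rst[of n E "fst a" "snd a"] that by (simp add: g_def supp_rst \<B>_def)
  note I = family_image[OF family_subset[OF assms(1) sub] g]
  show ?thesis
  proof (rule that[of "g ` \<B>"])
    show "family n (g ` \<B>)" "mins (g ` \<B>) \<in> schreier k" using I(1) I(3)[OF _ S] by blast+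
    show "supp (fst b) \<subseteq> E \<and> snd b \<in> snd ` \<A>" if "b \<in> g ` \<B>" for b
      using that sub unfolding g_def by (force simp: supp_rst)
    fix x :: "nat \<Rightarrow> real" assume x: "supp x \<subseteq> E"
    have "mass (g ` \<B>) x = mass \<B> x"
      using I(2) by (simp add: sum.reindex g_def pairing_rst[OF x])
    also have "\<dots> = mass \<A> x"
    proof (rule sum.mono_neutral_left)
      show "finite \<A>" using assms(1) by (simp add: family_def)
      show "\<forall>a\<in>\<A> - \<B>. \<bar>pairing (fst a) x\<bar> = 0"
        using x by (auto simp: \<B>_def intro!: pairing_disjoint)
    qed (use sub in auto)
    finally show "mass (g ` \<B>) x = mass \<A> x" .
  qed
qed

subsection \<open>Block sequences\<close>

definition block :: "(nat \<Rightarrow> nat \<Rightarrow> real) \<Rightarrow> bool"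
  where "block x \<longleftrightarrow> (\<forall>i. x i \<in> c00 \<and> supp (x i) \<noteq> {} \<and> before (supp (x i)) (supp (x (Suc i))))"

abbreviation top_supp :: "(nat \<Rightarrow> nat \<Rightarrow> real) \<Rightarrow> nat \<Rightarrow> nat"
  where "top_supp x i \<equiv> Max (supp (x i))"

lemma block_c00: "block x \<Longrightarrow> x i \<in> c00"
  by (simp add: block_def)

lemma block_supp:
  assumes "block x"
  shows "finite (supp (x i))" "supp (x i) \<noteq> {}" "0 \<notin> supp (x i)"
proof -
  have "x i \<in> c00" "supp (x i) \<noteq> {}" using assms by (simp_all add: block_def)
  then show "finite (supp (x i))" "supp (x i) \<noteq> {}" "0 \<notin> supp (x i)"
    by (simp_all add: c00_def supp_def)
qed

lemma sets_before:
  assumes "\<And>j. H j \<noteq> {}" "\<And>j. before (H j) (H (Suc j))" "i < (j :: nat)"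
  shows "before (H i) (H j)"
  using assms(3)
proof (induction j)
  case (Suc j)
  show ?case
  proof (cases "i = j")
    case False
    then have IH: "before (H i) (H j)" using Suc by simp
    obtain v where v: "v \<in> H j" using assms(1) by blast
    show ?thesis unfolding before_def
    proof (intro ballI)
      fix u w assume "u \<in> H i" "w \<in> H (Suc j)"
      then show "u < w" using beforeD[OF IH _ v] beforeD[OF assms(2) v] by (meson less_trans)
    qed
  qed (simp add: assms(2))
qed simp

lemma block_before: "block x \<Longrightarrow> i < j \<Longrightarrow> before (supp (x i)) (supp (x j))"
  by (rule sets_before[of "\<lambda>i. supp (x i)"]) (simp_all add: block_def)

lemma block_less: "block x \<Longrightarrow> i < j \<Longrightarrow> u \<in> supp (x i) \<Longrightarrow> v \<in> supp (x j) \<Longrightarrow> u < v"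
  using block_before beforeD by blast

lemma block_index_less: "block x \<Longrightarrow> t \<in> supp (x i) \<Longrightarrow> i < t"
proof (induction i arbitrary: t)
  case 0
  then show ?case using block_supp(3)[of x 0] by (metis gr0I)
next
  case (Suc i)
  obtain v where v: "v \<in> supp (x i)" using block_supp(2)[OF Suc.prems(1)] by blast
  then have "v < t" using block_less[OF Suc.prems(1), of i "Suc i"] Suc.prems(2) by simp
  then show ?case using Suc.IH[OF Suc.prems(1) v] by simp
qed

lemma block_index_less_top: "block x \<Longrightarrow> i < top_supp x i"
  using block_index_less[of x "top_supp x i" i] block_supp[of x i] by simp

lemma block_top_mono:
  assumes "block x" "i \<le> j"
  shows "top_supp x i \<le> top_supp x j"
proof (cases "i = j")
  case False
  then have "top_supp x i < top_supp x j"
    using assms block_supp[OF assms(1)] False block_less[OF assms(1), of i j] by simp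
  then show ?thesis by simp
qed simp

lemma block_top_le:
  assumes "block x" "i \<le> j" "v \<in> supp (x j)"
  shows "Min (supp (x i)) \<le> v"
proof (cases "i = j")
  case True
  then show ?thesis using assms(3) block_supp[OF assms(1)] by simp
next
  case False
  then have "Min (supp (x i)) < v"
    using assms block_supp[OF assms(1)] False block_less[OF assms(1), of i j] by simp
  then show ?thesis by simp
qed

lemma block_subseq: "block x \<Longrightarrow> strict_mono r \<Longrightarrow> block (x \<circ> r)"
  using block_before[of x] by (auto simp: block_def strict_mono_def)

lemma block_comparable:
  assumes "block x" "i \<noteq> j"
  shows "comparable (supp (x i)) (supp (x j))"
  using block_before[OF assms(1), of i j] block_before[OF assms(1), of j i] assms(2)
  unfolding comparable_def by (metis linorder_neqE_nat)

lemma supp_lc_block: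
  assumes "block x" "finite I" "\<And>i. i \<in> I \<Longrightarrow> c i \<noteq> 0"
  shows "supp (lc c I x) = (\<Union>i\<in>I. supp (x i))"
proof -
  have s: "supp (\<lambda>t. c i * x i t) = supp (x i)" if "i \<in> I" for i
    using assms(3)[OF that] by (simp add: supp_def)
  have "supp (lc c I x) = (\<Union>i\<in>I. supp (\<lambda>t. c i * x i t))"
    unfolding lc_def
    by (rule supp_comparable_sum[OF assms(2)])
      (simp add: pairwise_def s block_comparable[OF assms(1)])
  then show ?thesis using s by simp
qed

lemma block_lc:
  assumes "block x" "\<And>j. finite (G j)" "\<And>j. G j \<noteq> {}" "\<And>j. before (G j) (G (Suc j))"
    "\<And>j i. i \<in> G j \<Longrightarrow> c j i \<noteq> 0"
  shows "block (\<lambda>j. lc (c j) (G j) x)"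
  unfolding block_def
proof (intro allI conjI)
  fix j
  have s: "supp (lc (c j) (G j) x) = (\<Union>i\<in>G j. supp (x i))" for j
    by (rule supp_lc_block[OF assms(1,2)]) (rule assms(5))
  show "lc (c j) (G j) x \<in> c00" by (rule lc_c00[OF assms(2) block_c00[OF assms(1)]])
  show "supp (lc (c j) (G j) x) \<noteq> {}" unfolding s using assms(3)[of j] block_supp(2)[OF assms(1)] by blast
  show "before (supp (lc (c j) (G j) x)) (supp (lc (c (Suc j)) (G (Suc j)) x))"
    unfolding s before_def
  proof (intro ballI)
    fix u v assume "u \<in> (\<Union>i\<in>G j. supp (x i))" "v \<in> (\<Union>i\<in>G (Suc j). supp (x i))"
    then obtain i i' where "i \<in> G j" "u \<in> supp (x i)" "i' \<in> G (Suc j)" "v \<in> supp (x i')" by blast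
    then show "u < v" using beforeD[OF assms(4)] block_less[OF assms(1)] by blast
  qed
qed

subsection \<open>The terms of a block sequence met by a functional\<close>

definition hit :: "(nat \<Rightarrow> nat \<Rightarrow> real) \<Rightarrow> nat set \<Rightarrow> (nat \<Rightarrow> real) \<Rightarrow> nat set"
  where "hit x I f = {i \<in> I. supp f \<inter> supp (x i) \<noteq> {}}"

definition hit1 :: "(nat \<Rightarrow> nat \<Rightarrow> real) \<Rightarrow> nat set \<Rightarrow> (nat \<Rightarrow> real) \<Rightarrow> nat set"
  where "hit1 x I f = {i \<in> hit x I f. \<exists>j\<in>hit x I f. i < j}"

lemma finite_hit: "finite I \<Longrightarrow> finite (hit x I f)" "finite I \<Longrightarrow> finite (hit1 x I f)"
  by (simp_all add: hit_def hit1_def)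

lemma hit1_mono: "supp f \<subseteq> supp g \<Longrightarrow> hit1 x I f \<subseteq> hit1 x I g"
  unfolding hit1_def hit_def by blast

lemma hit1_disjoint_before:
  assumes "block x" "before (supp f) (supp g)"
  shows "hit1 x I f \<inter> hit1 x I g = {}"
proof (rule ccontr)
  assume "hit1 x I f \<inter> hit1 x I g \<noteq> {}"
  then obtain i j u v where "i < j" "u \<in> supp f" "u \<in> supp (x j)" "v \<in> supp g" "v \<in> supp (x i)"
    unfolding hit1_def hit_def by blast
  then show False using block_less[OF assms(1), of i j v u] beforeD[OF assms(2), of u v] by simp
qed

lemma hit1_disjoint:
  "block x \<Longrightarrow> comparable (supp f) (supp g) \<Longrightarrow> hit1 x I f \<inter> hit1 x I g = {}"
  using hit1_disjoint_before[of x f g I] hit1_disjoint_before[of x g f I] unfolding comparable_def by blast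

lemma card_hit:
  assumes "finite I"
  shows "card (hit x I f) \<le> Suc (card (hit1 x I f))"
proof (cases "hit x I f = {}")
  case False
  note fin = finite_hit[OF assms, of x f]
  have "i \<in> insert (Max (hit x I f)) (hit1 x I f)" if i: "i \<in> hit x I f" for i
  proof (cases "i = Max (hit x I f)")
    case neq: False
    moreover have "i \<le> Max (hit x I f)" "Max (hit x I f) \<in> hit x I f" using i fin(1) False by auto
    ultimately have "i < Max (hit x I f)" by simp
    then show ?thesis using i \<open>Max (hit x I f) \<in> hit x I f\<close> unfolding hit1_def by blast
  qed simp
  then have "hit x I f \<subseteq> insert (Max (hit x I f)) (hit1 x I f)" by blast
  then have "card (hit x I f) \<le> card (insert (Max (hit x I f)) (hit1 x I f))"
    using fin by (intro card_mono) simp_all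
  also have "\<dots> \<le> Suc (card (hit1 x I f))" using fin(2) by (simp add: card_insert_if)
  finally show ?thesis .
qed simp

lemma pairing_lc_hit:
  assumes "block x" "finite I"
  shows "pairing f (lc c I x) = (\<Sum>i\<in>hit x I f. c i * pairing f (x i))"
proof -
  have "pairing f (lc c I x) = (\<Sum>i\<in>I. c i * pairing f (x i))"
    by (rule pairing_lc[OF assms(2) block_c00[OF assms(1)]])
  also have "\<dots> = (\<Sum>i\<in>hit x I f. c i * pairing f (x i))"
    by (rule sum.mono_neutral_right[OF assms(2)]) (auto simp: hit_def intro!: pairing_disjoint)
  finally show ?thesis .
qed

lemma abs_pairing_lc_hit_le:
  assumes "block x" "finite I" "\<And>i. i \<in> I \<Longrightarrow> \<bar>c i\<bar> \<le> 1"
  shows "\<bar>pairing f (lc c I x)\<bar> \<le> (\<Sum>i\<in>hit x I f. \<bar>pairing f (x i)\<bar>)"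
  unfolding pairing_lc_hit[OF assms(1,2)]
proof (rule order.trans[OF sum_abs], rule sum_mono)
  fix i assume "i \<in> hit x I f"
  then have "\<bar>c i\<bar> \<le> 1" using assms(3) by (simp add: hit_def)
  then show "\<bar>c i * pairing f (x i)\<bar> \<le> \<bar>pairing f (x i)\<bar>"
    using mult_right_mono[of "\<bar>c i\<bar>" 1 "\<bar>pairing f (x i)\<bar>"] by (simp add: abs_mult)
qed

lemma avg_bound:
  fixes e :: real
  assumes "block x" "finite I" "0 \<le> e"
    "avg_in {g \<in> W n. \<bar>pairing g (lc c I x)\<bar> \<le> 1 + e * card (hit1 x I g)} \<alpha> l"
  shows "\<bar>pairing \<alpha> (lc c I x)\<bar> \<le> 1 + e * card (hit1 x I \<alpha>) / l"
proof -
  obtain \<F> where *: "l \<ge> 2" "finite \<F>" "\<F> \<noteq> {}" "card \<F> \<le> l"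
      "\<And>g. g \<in> \<F> \<Longrightarrow> \<bar>pairing g (lc c I x)\<bar> \<le> 1 + e * card (hit1 x I g)"
      "pairwise (\<lambda>f g. comparable (supp f) (supp g)) \<F>" "\<alpha> = (\<lambda>i. (\<Sum>f\<in>\<F>. f i) / real l)"
    using assms(4) unfolding avg_in_def by blast
  have supp: "supp \<alpha> = (\<Union>f\<in>\<F>. supp f)" unfolding *(7) using *(2,6,1) by (rule supp_avg)
  have "(\<Sum>f\<in>\<F>. card (hit1 x I f)) = card (\<Union>f\<in>\<F>. hit1 x I f)"
    using *(2,6) hit1_disjoint[OF assms(1)] finite_hit(2)[OF assms(2)]
    by (intro card_UN_disjoint[symmetric]) (auto simp: pairwise_def)
  also have "\<dots> \<le> card (hit1 x I \<alpha>)"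
    using hit1_mono[of _ \<alpha> x I] supp finite_hit(2)[OF assms(2)] by (intro card_mono) blast+
  finally have c: "real (\<Sum>f\<in>\<F>. card (hit1 x I f)) \<le> real (card (hit1 x I \<alpha>))"
    by (rule of_nat_mono)
  have "\<bar>pairing \<alpha> (lc c I x)\<bar> = \<bar>\<Sum>f\<in>\<F>. pairing f (lc c I x)\<bar> / l"
    unfolding *(7) by (simp add: pairing_divide_left pairing_sum_left)
  also have "\<dots> \<le> (\<Sum>f\<in>\<F>. 1 + e * card (hit1 x I f)) / l"
    by (intro divide_right_mono order.trans[OF sum_abs] sum_mono *(5)) simp_all
  also have "(\<Sum>f\<in>\<F>. 1 + e * card (hit1 x I f)) = card \<F> + e * real (\<Sum>f\<in>\<F>. card (hit1 x I f))"
    by (simp add: sum.distrib sum_distrib_left)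
  also have "(card \<F> + e * real (\<Sum>f\<in>\<F>. card (hit1 x I f))) / l \<le> (l + e * card (hit1 x I \<alpha>)) / l"
    using *(4) c assms(3) by (intro divide_right_mono add_mono mult_left_mono) simp_all
  also have "\<dots> = 1 + e * card (hit1 x I \<alpha>) / l" using *(1) by (simp add: add_divide_distrib)
  finally show ?thesis .
qed

lemma avg_bound_norm:
  assumes "block x" "\<And>i. W_norm n (x i) \<le> 1" "finite I" "\<And>i. i \<in> I \<Longrightarrow> \<bar>c i\<bar> \<le> 1"
    "avg_in (W n) \<alpha> l"
  shows "\<bar>pairing \<alpha> (lc c I x)\<bar> \<le> 1 + card I / l"
proof -
  have "\<bar>pairing g (lc c I x)\<bar> \<le> 1 + (1::real) * card (hit1 x I g)" if "g \<in> W n" for g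
  proof -
    have "\<bar>pairing g (lc c I x)\<bar> \<le> (\<Sum>i\<in>hit x I g. \<bar>pairing g (x i)\<bar>)"
      by (rule abs_pairing_lc_hit_le[OF assms(1,3,4)])
    also have "\<dots> \<le> (\<Sum>i\<in>hit x I g. 1)"
      using abs_pairing_le_W_norm[OF that] assms(2) by (intro sum_mono) (rule order.trans)
    also have "\<dots> \<le> 1 + (1::real) * card (hit1 x I g)" using card_hit[OF assms(3), of x g] by simp
    finally show ?thesis .
  qed
  then have "{g \<in> W n. \<bar>pairing g (lc c I x)\<bar> \<le> 1 + (1::real) * card (hit1 x I g)} = W n" by blast
  then have "\<bar>pairing \<alpha> (lc c I x)\<bar> \<le> 1 + (1::real) * card (hit1 x I \<alpha>) / l"
    using assms(5) by (intro avg_bound[OF assms(1,3), of 1 n c \<alpha> l]) simp_all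
  also have "\<dots> \<le> 1 + card I / l"
    using assms(3) by (intro add_left_mono divide_right_mono) (auto simp: hit1_def hit_def intro: card_mono)
  finally show ?thesis .
qed

lemma abs_pairing_hit1_empty:
  assumes "block x" "\<And>i. W_norm n (x i) \<le> 1" "finite I" "\<And>i. i \<in> I \<Longrightarrow> \<bar>c i\<bar> \<le> 1"
    "f \<in> W n" "hit1 x I f = {}"
  shows "\<bar>pairing f (lc c I x)\<bar> \<le> 1"
proof -
  have "\<bar>pairing f (lc c I x)\<bar> \<le> (\<Sum>i\<in>hit x I f. \<bar>pairing f (x i)\<bar>)"
    by (rule abs_pairing_lc_hit_le[OF assms(1,3,4)])
  also have "\<dots> \<le> (\<Sum>i\<in>hit x I f. 1)"
    using abs_pairing_le_W_norm[OF assms(5)] assms(2) by (intro sum_mono) (rule order.trans)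
  also have "\<dots> \<le> 1" using card_hit[OF assms(3), of x f] assms(6) by simp
  finally show ?thesis .
qed

subsection \<open>Sequences that are small on admissible families\<close>

text \<open>
  \<open>small n (Suc k) x\<close> expresses that the \<open>\<alpha>\<close>-index of order \<open>k\<close> of \<open>x\<close> vanishes, and
  \<open>rapid n (Suc k) x\<close> is a quantitative form of this that is attained by a subsequence.
\<close>

primrec small :: "nat \<Rightarrow> nat \<Rightarrow> (nat \<Rightarrow> nat \<Rightarrow> real) \<Rightarrow> bool"
  where
    "small n 0 x = True"
  | "small n (Suc k) x = (\<forall>e>0. \<exists>s. \<forall>j\<ge>s. \<forall>\<A>. family n \<A> \<longrightarrow> mins \<A> \<in> schreier k \<longrightarrow>
      (\<forall>a\<in>\<A>. s \<le> snd a) \<longrightarrow> mass \<A> (x j) \<le> e)"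

primrec rapid :: "nat \<Rightarrow> nat \<Rightarrow> (nat \<Rightarrow> nat \<Rightarrow> real) \<Rightarrow> bool"
  where
    "rapid n 0 x = True"
  | "rapid n (Suc k) x = (\<forall>i. \<forall>j\<ge>Suc i. \<forall>\<A>. family n \<A> \<longrightarrow> mins \<A> \<in> schreier k \<longrightarrow>
      (\<forall>a\<in>\<A>. Min (supp (x (Suc i))) \<le> snd a) \<longrightarrow>
      mass \<A> (x j) \<le> (1/4) ^ Suc i / (real (top_supp x i))\<^sup>2)"

lemma small_imp_rapid:
  assumes "block x" "small n k x"
  obtains r where "strict_mono r" "rapid n k (x \<circ> r)"
proof (cases k)
  case 0
  then show ?thesis using that[of id] by (simp add: strict_mono_id)
next
  case (Suc k')
  define Q where "Q = (\<lambda>e s. \<forall>j\<ge>s. \<forall>\<A>. family n \<A> \<longrightarrow> mins \<A> \<in> schreier k' \<longrightarrow>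
      (\<forall>a\<in>\<A>. s \<le> snd a) \<longrightarrow> mass \<A> (x j) \<le> e)"
  have "\<forall>e. \<exists>s. 0 < e \<longrightarrow> Q e s" using assms(2) unfolding Suc small.simps Q_def by blast
  then obtain S where S: "\<And>e. 0 < e \<Longrightarrow> Q e (S e)" by metis
  define E where "E = (\<lambda>i t. (1/4) ^ Suc i / (real (top_supp x t))\<^sup>2)"
  define r where "r = rec_nat 0 (\<lambda>i t. max (Suc t) (S (E i t)))"
  have r: "r (Suc i) = max (Suc (r i)) (S (E i (r i)))" for i by (simp add: r_def)
  have mono: "strict_mono r" by (rule strict_mono_Suc_iff[THEN iffD2]) (simp add: r less_max_iff_disj)
  have "rapid n k (x \<circ> r)"
    unfolding Suc rapid.simps
  proof (intro allI impI)
    fix i j \<A> assume j: "Suc i \<le> j" and A: "family n \<A>" "mins \<A> \<in> schreier k'"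
      "\<forall>a\<in>\<A>. Min (supp ((x \<circ> r) (Suc i))) \<le> snd a"
    have "0 < top_supp x (r i)" using block_index_less_top[OF assms(1), of "r i"] by simp
    then have Q: "Q (E i (r i)) (S (E i (r i)))" by (intro S) (simp add: E_def)
    have S1: "S (E i (r i)) \<le> r (Suc i)" by (simp add: r)
    also have "r (Suc i) \<le> r j" using j strict_mono_mono[OF mono] by (simp add: mono_def)
    finally have S2: "S (E i (r i)) \<le> r j" .
    have "Min (supp (x (r (Suc i)))) \<in> supp (x (r (Suc i)))" using block_supp[OF assms(1)] by simp
    then have "r (Suc i) < Min (supp (x (r (Suc i))))" by (rule block_index_less[OF assms(1)])
    then have "\<forall>a\<in>\<A>. S (E i (r i)) \<le> snd a" using A(3) S1 by fastforce
    then have "mass \<A> (x (r j)) \<le> E i (r i)"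
      using Q A(1,2) S2 unfolding Q_def by blast
    then show "mass \<A> ((x \<circ> r) j)
        \<le> (1/4) ^ Suc i / (real (top_supp (x \<circ> r) i))\<^sup>2"
      by (simp add: E_def)
  qed
  then show ?thesis using that mono by blast
qed

lemma rapidD:
  "rapid n (Suc k) x \<Longrightarrow> Suc i \<le> j \<Longrightarrow> family n \<A> \<Longrightarrow> mins \<A> \<in> schreier k \<Longrightarrow>
    (\<And>a. a \<in> \<A> \<Longrightarrow> Min (supp (x (Suc i))) \<le> snd a) \<Longrightarrow>
    mass \<A> (x j) \<le> (1/4) ^ Suc i / (real (top_supp x i))\<^sup>2"
  by simp

lemma tail_bound_single:
  assumes "rapid n (Suc k) x"
    "family n \<A>" "mins \<A> \<in> schreier (Suc k)" "Min (mins \<A>) \<le> top_supp x a"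
    "\<B> \<subseteq> \<A>" "\<And>b. b \<in> \<B> \<Longrightarrow> Min (supp (x (Suc p))) \<le> snd b" "Suc p \<le> j"
  shows "mass \<B> (x j) \<le> top_supp x a * ((1/4) ^ Suc p / (real (top_supp x p))\<^sup>2)"
proof -
  define \<epsilon> where "\<epsilon> = (1/4) ^ Suc p / (real (top_supp x p))\<^sup>2"
  have \<epsilon>0: "0 \<le> \<epsilon>" by (simp add: \<epsilon>_def)
  let ?k = "\<lambda>a. Min (supp (fst a))"
  let ?g = "\<lambda>b. \<bar>pairing (fst b) (x j)\<bar>"
  obtain P where P: "finite P" "P \<subseteq> schreier k" "mins \<A> = \<Union>P" "card P \<le> Min (mins \<A>)"
    using assms(3) unfolding schreier_Suc by blast
  have finB: "finite \<B>" using assms(2,5) finite_subset by (auto simp: family_def)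
  have "(\<Sum>b\<in>\<B>. ?g b) \<le> (\<Sum>b\<in>\<B>. \<Sum>E\<in>P. if ?k b \<in> E then ?g b else 0)"
  proof (rule sum_mono)
    fix b assume "b \<in> \<B>"
    then have "?k b \<in> mins \<A>" using assms(5) unfolding mins_def by blast
    then obtain E where E: "E \<in> P" "?k b \<in> E" using P(3) by blast
    have "?g b = (if ?k b \<in> E then ?g b else 0)" using E by simp
    also have "\<dots> \<le> (\<Sum>E\<in>P. if ?k b \<in> E then ?g b else 0)"
      by (rule member_le_sum[OF E(1) _ P(1)]) simp
    finally show "?g b \<le> (\<Sum>E\<in>P. if ?k b \<in> E then ?g b else 0)" .
  qed
  also have "\<dots> = (\<Sum>E\<in>P. \<Sum>b\<in>\<B>. if ?k b \<in> E then ?g b else 0)" by (rule sum.swap)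
  also have "\<dots> \<le> (\<Sum>E\<in>P. \<epsilon>)"
  proof (rule sum_mono)
    fix E assume E: "E \<in> P"
    let ?C = "{b \<in> \<B>. ?k b \<in> E}"
    have "(\<Sum>b\<in>\<B>. if ?k b \<in> E then ?g b else 0) = (\<Sum>b\<in>?C. ?g b)"
      by (rule sum.inter_filter[OF finB, symmetric])
    also have "\<dots> \<le> \<epsilon>"
    proof (cases "?C = {}")
      case True
      show ?thesis unfolding True using \<epsilon>0 by simp
    next
      case False
      have "family n ?C" by (rule family_subset[OF assms(2)]) (use assms(5) in blast)
      moreover have "mins ?C \<in> schreier k"
        by (rule schreier_hereditary[of E]) (use E P(2) False in \<open>auto simp: mins_def\<close>)
      ultimately show ?thesis unfolding \<epsilon>_def
        by (intro rapidD[OF assms(1,7)]) (use assms(6) in auto)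
    qed
    finally show "(\<Sum>b\<in>\<B>. if ?k b \<in> E then ?g b else 0) \<le> \<epsilon>" .
  qed
  also have "\<dots> = real (card P) * \<epsilon>" by simp
  also have "\<dots> \<le> top_supp x a * \<epsilon>"
    using P(4) assms(4) \<epsilon>0 by (intro mult_right_mono) simp_all
  finally show ?thesis unfolding \<epsilon>_def .
qed

lemma quarter_power_bound:
  assumes "block x" "m \<le> p" "a \<le> p"
  shows "real m * (top_supp x a * ((1/4) ^ Suc p / (real (top_supp x p))\<^sup>2)) \<le> (1/4) ^ m"
proof -
  let ?M = "real (top_supp x p)"
  have M: "0 < ?M" using block_index_less_top[OF assms(1), of p] by simp
  have "real m \<le> ?M" using block_index_less_top[OF assms(1), of p] assms(2) by simp
  moreover have "real (top_supp x a) \<le> ?M" using block_top_mono[OF assms(1,3)] by simp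
  ultimately have "real m * top_supp x a \<le> ?M\<^sup>2"
    unfolding power2_eq_square by (intro mult_mono) simp_all
  then have "(real m * top_supp x a) * ((1/4) ^ Suc p / ?M\<^sup>2) \<le> ?M\<^sup>2 * ((1/4) ^ Suc p / ?M\<^sup>2)"
    by (intro mult_right_mono) simp_all
  also have "\<dots> = (1/4) ^ Suc p" using M by simp
  also have "\<dots> \<le> (1/4) ^ m" using assms(2) by (intro power_decreasing) simp_all
  finally show ?thesis by (simp add: mult.assoc)
qed

lemma tail_bound:
  assumes "block x" "rapid n (Suc k) x"
    "family n \<A>" "mins \<A> \<in> schreier (Suc k)" "Min (mins \<A>) \<le> top_supp x a"
    "\<B> \<subseteq> \<A>" "\<And>b. b \<in> \<B> \<Longrightarrow> Min (supp (x (Suc p))) \<le> snd b" "a \<le> p"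
    "finite I" "I \<subseteq> {Suc p..}" "card I \<le> m" "m \<le> p"
  shows "(\<Sum>b\<in>\<B>. \<Sum>i\<in>I. \<bar>pairing (fst b) (x i)\<bar>) \<le> (1/4) ^ m"
proof -
  have "(\<Sum>b\<in>\<B>. \<Sum>i\<in>I. \<bar>pairing (fst b) (x i)\<bar>) = (\<Sum>i\<in>I. \<Sum>b\<in>\<B>. \<bar>pairing (fst b) (x i)\<bar>)"
    by (rule sum.swap)
  also have "\<dots> \<le> (\<Sum>i\<in>I. top_supp x a * ((1/4) ^ Suc p / (real (top_supp x p))\<^sup>2))"
    using assms(10) by (intro sum_mono tail_bound_single[OF assms(2-7)]) auto
  also have "\<dots> = real (card I) * (top_supp x a * ((1/4) ^ Suc p / (real (top_supp x p))\<^sup>2))"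
    by simp
  also have "\<dots> \<le> real m * (top_supp x a * ((1/4) ^ Suc p / (real (top_supp x p))\<^sup>2))"
    using assms(11) by (intro mult_right_mono) simp_all
  also have "\<dots> \<le> (1/4) ^ m" by (rule quarter_power_bound[OF assms(1,12,8)])
  finally show ?thesis .
qed

text \<open>
  The first average meeting the terms of \<open>x\<close> is treated separately.  All later ones have sizes
  exceeding its support, so they are negligible on every term but the first one that is met.
\<close>

lemma admissible_sum_split:
  assumes x: "block x" "\<And>i. W_norm n (x i) \<le> 1" "rapid n (Suc k) x" and "Suc k \<le> n"
    and \<A>: "family n \<A>" "mins \<A> \<in> schreier (Suc k)"
    and I: "finite I" "I \<noteq> {}" "card I \<le> Min I" and c: "\<And>i. i \<in> I \<Longrightarrow> \<bar>c i\<bar> \<le> 1"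
  shows "mass \<A> (lc c I x) \<le> 1 + 2 * (1/4) ^ card I \<or>
    (\<exists>a\<in>\<A>. hit1 x I (fst a) \<noteq> {} \<and>
      mass \<A> (lc c I x) \<le> \<bar>pairing (fst a) (lc c I x)\<bar> + (1/4) ^ card I)"
proof -
  define p where "p = (\<lambda>a :: (nat \<Rightarrow> real) \<times> nat. \<bar>pairing (fst a) (lc c I x)\<bar>)"
  define q where "q = (\<lambda>(a :: (nat \<Rightarrow> real) \<times> nat) i. \<bar>pairing (fst a) (x i)\<bar>)"
  have q0: "0 \<le> q a i" for a i by (simp add: q_def)
  define h where "h = (\<lambda>a :: (nat \<Rightarrow> real) \<times> nat. hit x I (fst a))"
  define m where "m = card I"
  define \<delta> :: real where "\<delta> = (1/4) ^ m"
  have \<delta>0: "0 \<le> \<delta>" by (simp add: \<delta>_def)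
  have finh: "finite (h a)" for a unfolding h_def by (rule finite_hit(1)[OF I(1)])
  have pq: "p a \<le> (\<Sum>i\<in>h a. q a i)" for a
    unfolding p_def q_def h_def by (rule abs_pairing_lc_hit_le[OF x(1) I(1) c])
  define \<B> where "\<B> = {a \<in> \<A>. h a \<noteq> {}}"
  have finA: "finite \<A>" using \<A>(1) by (simp add: family_def)
  have sub: "\<B> \<subseteq> \<A>" by (auto simp: \<B>_def)
  have finB: "finite \<B>" using finA sub by (rule rev_finite_subset)
  have p0: "p a = 0" if "h a = {}" for a
    using pq[of a] that by (simp add: p_def)
  have sumB: "(\<Sum>a\<in>\<A>. p a) = (\<Sum>a\<in>\<B>. p a)"
    by (rule sum.mono_neutral_right[OF finA sub]) (auto simp: \<B>_def p0)
  have "(\<Sum>a\<in>\<A>. p a) \<le> 1 + 2 * \<delta> \<or>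
    (\<exists>a\<in>\<A>. hit1 x I (fst a) \<noteq> {} \<and> (\<Sum>a\<in>\<A>. p a) \<le> p a + \<delta>)"
  proof (cases "\<B> = {}")
    case True
    then show ?thesis using sumB \<delta>0 by simp
  next
    case False
    note F = family_subset[OF \<A>(1) sub]
    note S = mins_subset_schreier[OF \<A>(2) sub False]
    obtain a1 where a1: "a1 \<in> \<B>" "\<And>b. b \<in> \<B> \<Longrightarrow> b \<noteq> a1 \<Longrightarrow> prec a1 b"
      using family_first[OF F False] by metis
    define a where "a = Min (h a1)"
    have ha1: "h a1 \<noteq> {}" using a1(1) by (simp add: \<B>_def)
    have a: "a \<in> h a1" unfolding a_def using finh ha1 by simp
    have aI: "a \<in> I" using a by (simp add: h_def hit_def)
    have ma: "m \<le> a" using I aI Min_le[OF I(1) aI] by (simp add: m_def)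
    have m1: "1 \<le> m" using I(1,2) by (simp add: m_def Suc_le_eq card_gt_0_iff)
    obtain u where u: "u \<in> supp (fst a1)" "u \<in> supp (x a)" using a by (auto simp: h_def hit_def)
    have top: "Min (mins \<B>) \<le> top_supp x a"
    proof -
      have "Min (mins \<B>) \<le> Min (supp (fst a1))"
        using finB a1(1) by (intro Min_le) (auto simp: mins_def)
      also have "\<dots> \<le> u" using u(1) family_fin[OF F a1(1)] by simp
      also have "\<dots> \<le> top_supp x a" using u(2) block_supp[OF x(1)] by simp
      finally show ?thesis .
    qed
    have later: "i \<le> j" if A: "prec b b'" "i \<in> h b" "j \<in> h b'" for b b' i j
    proof (rule ccontr)
      assume "\<not> i \<le> j"
      obtain v w where v: "v \<in> supp (fst b)" "v \<in> supp (x i)" "w \<in> supp (fst b')" "w \<in> supp (x j)"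
        using A(2,3) by (auto simp: h_def hit_def)
      then have "v < w" using A(1) beforeD by (auto simp: prec_def)
      moreover have "w < v" using block_less[OF x(1), of j i w v] v \<open>\<not> i \<le> j\<close> by simp
      ultimately show False by simp
    qed
    have size: "Min (supp (x j)) \<le> snd b'" if A: "prec b b'" "i \<in> h b" "j \<le> i" for b b' i j
    proof -
      obtain v where v: "v \<in> supp (fst b)" "v \<in> supp (x i)" using A(2) by (auto simp: h_def hit_def)
      have "Min (supp (x j)) \<le> v" by (rule block_top_le[OF x(1) A(3) v(2)])
      also have "v < snd b'" using A(1) v(1) by (simp add: prec_def)
      finally show ?thesis by simp
    qed
    have ge_a: "a \<le> i" if "b \<in> \<B>" "i \<in> h b" for b i
    proof (cases "b = a1")
      case True
      then show ?thesis using that finh by (simp add: a_def)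
    next
      case False
      then show ?thesis using later[of a1 b a i] a1(2)[of b] a that by simp
    qed
    show ?thesis
    proof (cases "hit1 x I (fst a1) = {}")
      case False
      define b where "b = Max (h a1)"
      have b: "b \<in> h a1" unfolding b_def using finh ha1 by simp
      obtain i j where "i \<in> h a1" "j \<in> h a1" "i < j" using False by (auto simp: hit1_def h_def)
      then have "a < b" using ge_a[OF a1(1)] Max_ge[OF finh, of j a1] unfolding b_def by fastforce
      then obtain b' where b': "b = Suc b'" "a \<le> b'" by (metis Suc_leI Suc_le_mono old.nat.exhaust less_nat_zero_code)
      let ?C = "\<B> - {a1}" and ?I = "{i \<in> I. b \<le> i}"
      have "(\<Sum>d\<in>?C. p d) \<le> (\<Sum>d\<in>?C. \<Sum>i\<in>?I. q d i)"
      proof (rule sum_mono)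
        fix d assume d: "d \<in> ?C"
        have "h d \<subseteq> ?I" using later[OF a1(2) b, of d] d by (auto simp: h_def hit_def)
        then have "(\<Sum>i\<in>h d. q d i) \<le> (\<Sum>i\<in>?I. q d i)"
          using I(1) q0 by (intro sum_mono2) auto
        then show "p d \<le> (\<Sum>i\<in>?I. q d i)" using pq[of d] by simp
      qed
      also have "\<dots> \<le> \<delta>" unfolding q_def \<delta>_def
      proof (rule tail_bound[OF x(1,3) F S top])
        show "?C \<subseteq> \<B>" by blast
        show "Min (supp (x (Suc b'))) \<le> snd d" if "d \<in> ?C" for d
          using size[OF a1(2) b, of d "Suc b'"] that b'(1) by simp
        show "a \<le> b'" by (rule b'(2))
        show "finite ?I" "?I \<subseteq> {Suc b'..}" using I(1) b'(1) by auto
        show "card ?I \<le> m" unfolding m_def using I(1) by (intro card_mono) auto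
        show "m \<le> b'" using ma b'(2) by simp
      qed
      finally have "(\<Sum>d\<in>\<B>. p d) \<le> p a1 + \<delta>"
        using sum.remove[OF finB a1(1), of p] by simp
      then show ?thesis using sumB False a1(1) sub by auto
    next
      case True
      have h1: "h a1 = {a}"
      proof -
        have "i = a" if "i \<in> h a1" for i
          using True ge_a[OF a1(1) that] that a unfolding hit1_def h_def by fastforce
        then show ?thesis using a by blast
      qed
      let ?I = "{i \<in> I. Suc a \<le> i}"
      have finI: "finite ?I" and cardI: "card ?I \<le> m"
        using I(1) by (auto simp: m_def intro: card_mono)
      define \<C> where "\<C> = {d \<in> \<B>. \<exists>i\<in>h d. a < i}"
      have CB: "\<C> \<subseteq> \<B>" by (auto simp: \<C>_def)
      have finC: "finite \<C>" using finB CB by (rule rev_finite_subset)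
      have "(\<Sum>d\<in>\<B>. p d) \<le> (\<Sum>d\<in>\<B>. q d a + (if d \<in> \<C> then \<Sum>i\<in>?I. q d i else 0))"
      proof (rule sum_mono)
        fix d assume d: "d \<in> \<B>"
        have "p d \<le> (\<Sum>i\<in>h d. q d i)" by (rule pq)
        also have "\<dots> \<le> q d a + (\<Sum>i\<in>h d - {a}. q d i)"
        proof (cases "a \<in> h d")
          case True
          then show ?thesis using sum.remove[OF finh True, of "q d"] by simp
        qed (simp add: q0)
        also have "(\<Sum>i\<in>h d - {a}. q d i) \<le> (if d \<in> \<C> then \<Sum>i\<in>?I. q d i else 0)"
        proof (cases "d \<in> \<C>")
          case True
          have "h d - {a} \<subseteq> ?I" using ge_a[OF d] by (fastforce simp: h_def hit_def)
          then have "(\<Sum>i\<in>h d - {a}. q d i) \<le> (\<Sum>i\<in>?I. q d i)"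
            using finI q0 by (intro sum_mono2) auto
          then show ?thesis using True by simp
        next
          case False
          then have "h d - {a} = {}" using ge_a[OF d] d by (fastforce simp: \<C>_def)
          then have "(\<Sum>i\<in>h d - {a}. q d i) = 0" by (simp only: sum.empty)
          then show ?thesis using False by simp
        qed
        finally show "p d \<le> q d a + (if d \<in> \<C> then \<Sum>i\<in>?I. q d i else 0)" by simp
      qed
      also have "\<dots> = (\<Sum>d\<in>\<B>. q d a) + (\<Sum>d\<in>\<C>. \<Sum>i\<in>?I. q d i)"
      proof -
        have "(\<Sum>d\<in>\<B>. if d \<in> \<C> then \<Sum>i\<in>?I. q d i else 0) = (\<Sum>d\<in>{d \<in> \<B>. d \<in> \<C>}. \<Sum>i\<in>?I. q d i)"
          by (rule sum.inter_filter[OF finB, symmetric])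
        moreover have "{d \<in> \<B>. d \<in> \<C>} = \<C>" using CB by blast
        ultimately show ?thesis by (simp add: sum.distrib)
      qed
      also have "(\<Sum>d\<in>\<B>. q d a) \<le> 1"
      proof -
        have "mins \<B> \<in> schreier n" using S schreier_mono[OF \<open>Suc k \<le> n\<close>] by blast
        then have "(\<Sum>d\<in>\<B>. q d a) \<le> W_norm n (x a)" unfolding q_def by (rule family_abs_sum[OF F])
        then show ?thesis using x(2)[of a] by simp
      qed
      also have "(\<Sum>d\<in>\<C>. \<Sum>i\<in>?I. q d i) \<le> \<delta> + \<delta>"
      proof (cases "\<C> = {}")
        case True
        then show ?thesis using \<delta>0 by simp
      next
        case False
        note FC = family_subset[OF F CB]
        obtain b1 where b1: "b1 \<in> \<C>" "\<And>d. d \<in> \<C> \<Longrightarrow> d \<noteq> b1 \<Longrightarrow> prec b1 d"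
          using family_first[OF FC False] by metis
        obtain i1 where i1: "i1 \<in> h b1" "a < i1" using b1(1) by (auto simp: \<C>_def)
        have "b1 \<noteq> a1" using i1 h1 by auto
        then have prec1: "prec a1 b1" using a1(2) b1(1) CB by blast
        obtain a' where a': "a = Suc a'" using ma m1 by (cases a) auto
        have "(\<Sum>i\<in>?I. q b1 i) \<le> (\<Sum>i\<in>?I. (1/4) ^ Suc a' / (real (top_supp x a'))\<^sup>2)"
        proof (rule sum_mono)
          fix i assume i: "i \<in> ?I"
          have fam1: "family n {b1}" by (rule family_subset[OF FC]) (use b1(1) in blast)
          have "0 < Min (supp (fst b1))" using family_fin[OF FC b1(1)] by (metis Min_in gr0I)
          then have "mins {b1} \<in> schreier k" unfolding mins_def by (simp add: schreier_singleton)
          then have "mass {b1} (x i) \<le> (1/4) ^ Suc a' / (real (top_supp x a'))\<^sup>2"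
            using size[OF prec1 a, of a] a' i by (intro rapidD[OF x(3) _ fam1]) auto
          then show "q b1 i \<le> (1/4) ^ Suc a' / (real (top_supp x a'))\<^sup>2" by (simp add: q_def)
        qed
        also have "\<dots> = real (card ?I) * (1 * ((1/4) ^ Suc a' / (real (top_supp x a'))\<^sup>2))" by simp
        also have "\<dots> \<le> \<delta>"
        proof -
          have M: "real m \<le> top_supp x a'" "0 < real (top_supp x a')"
            using block_index_less_top[OF x(1), of a'] ma a' by auto
          have "real (card ?I) * (1 * ((1/4) ^ Suc a' / (real (top_supp x a'))\<^sup>2))
              \<le> (real (top_supp x a'))\<^sup>2 * (1 * ((1/4) ^ Suc a' / (real (top_supp x a'))\<^sup>2))"
          proof (rule mult_right_mono)
            have "real (card ?I) \<le> real (top_supp x a') * 1" using cardI M(1) by simp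
            also have "\<dots> \<le> real (top_supp x a') * real (top_supp x a')"
              using M(2) by (intro mult_left_mono) simp_all
            finally show "real (card ?I) \<le> (real (top_supp x a'))\<^sup>2" by (simp add: power2_eq_square)
          qed simp
          also have "\<dots> = (1/4) ^ a" using M(2) a' by simp
          also have "\<dots> \<le> \<delta>" unfolding \<delta>_def using ma by (intro power_decreasing) simp_all
          finally show ?thesis .
        qed
        finally have 1: "(\<Sum>i\<in>?I. q b1 i) \<le> \<delta>" .
        have 2: "(\<Sum>d\<in>\<C> - {b1}. \<Sum>i\<in>?I. q d i) \<le> \<delta>" unfolding q_def \<delta>_def
        proof (rule tail_bound[OF x(1,3) F S top])
          show "\<C> - {b1} \<subseteq> \<B>" using CB by blast
          show "Min (supp (x (Suc a))) \<le> snd d" if "d \<in> \<C> - {b1}" for d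
            using size[OF b1(2) i1(1), of d "Suc a"] that i1(2) by simp
        qed (use finI cardI ma in auto)
        have "(\<Sum>d\<in>\<C>. \<Sum>i\<in>?I. q d i) = (\<Sum>i\<in>?I. q b1 i) + (\<Sum>d\<in>\<C> - {b1}. \<Sum>i\<in>?I. q d i)"
          by (rule sum.remove[OF finC b1(1)])
        then show ?thesis using 1 2 by linarith
      qed
      finally have "(\<Sum>d\<in>\<B>. p d) \<le> 1 + 2 * \<delta>" by simp
      then show ?thesis using sumB by simp
    qed
  qed
  then show ?thesis unfolding p_def \<delta>_def m_def .
qed

lemma c0_estimate_aux:
  assumes x: "block x" "\<And>i. W_norm n (x i) \<le> 1" "rapid n n x" and n: "1 \<le> n"
    and I: "finite I" "I \<noteq> {}" "card I \<le> Min I" and c: "\<And>i. i \<in> I \<Longrightarrow> \<bar>c i\<bar> \<le> 1"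
    and f: "f \<in> W n"
  shows "\<bar>pairing f (lc c I x)\<bar> \<le> 1 + (2 * (1/4) ^ card I) * card (hit1 x I f)"
  using f
proof (induction rule: W_induct)
  case (unit i s)
  have s: "supp (\<lambda>j. s * unit_vec i j) = {i}" using unit(2) by (auto simp: supp_def unit_vec_def)
  have "hit1 x I (\<lambda>j. s * unit_vec i j) = {}"
    using block_less[OF x(1), of _ _ i i] unfolding hit1_def hit_def s by fastforce
  then show ?case
    using abs_pairing_hit1_empty[OF x(1,2) I(1) c signed_unit_vec_W[OF unit]] by simp
next
  case (avg l \<alpha>)
  have "\<bar>pairing \<alpha> (lc c I x)\<bar> \<le> 1 + (2 * (1/4) ^ card I) * card (hit1 x I \<alpha>) / l"
    by (rule avg_bound[OF x(1) I(1) _ avg]) simp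
  also have "\<dots> \<le> 1 + (2 * (1/4) ^ card I) * card (hit1 x I \<alpha>) / 1"
    using avg by (intro add_left_mono divide_left_mono) (auto simp: avg_in_def)
  finally show ?case by simp
next
  case (family \<A>)
  define \<delta> :: real where "\<delta> = (1/4) ^ card I"
  have \<delta>0: "0 \<le> \<delta>" by (simp add: \<delta>_def)
  define N where "N = card (hit1 x I (famsum \<A>))"
  show ?case
  proof (cases "hit1 x I (famsum \<A>) = {}")
    case True
    then show ?thesis
      using abs_pairing_hit1_empty[OF x(1,2) I(1) c W_family[OF family(1,2)]] by simp
  next
    case False
    then have N: "1 \<le> N" using finite_hit(2)[OF I(1)] by (simp add: N_def Suc_le_eq card_gt_0_iff)
    obtain k where k: "n = Suc k" using n by (cases n) auto
    have r: "rapid n (Suc k) x" using x(3) by (simp only: k)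
    have S: "mins \<A> \<in> schreier (Suc k)" using family(2) by (simp only: k)
    have "\<bar>pairing (famsum \<A>) (lc c I x)\<bar> \<le> mass \<A> (lc c I x)"
      unfolding famsum_def pairing_sum_left by (rule sum_abs)
    also have "\<dots> \<le> 1 + 2 * \<delta> * N"
    proof -
      consider "mass \<A> (lc c I x) \<le> 1 + 2 * \<delta>"
        | a where "a \<in> \<A>" "hit1 x I (fst a) \<noteq> {}"
          "mass \<A> (lc c I x) \<le> \<bar>pairing (fst a) (lc c I x)\<bar> + \<delta>"
        using admissible_sum_split[where c = c, OF x(1,2) r _ family(1) S I c] k
        unfolding \<delta>_def by auto
      then show ?thesis
      proof cases
        case 1
        have "2 * \<delta> * 1 \<le> 2 * \<delta> * N" using N \<delta>0 by (intro mult_left_mono) simp_all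
        then show ?thesis using 1 by simp
      next
        case (2 a)
        have l: "2 \<le> snd a" using family(3)[OF 2(1)] by (simp add: avg_in_def)
        have "\<bar>pairing (fst a) (lc c I x)\<bar> \<le> 1 + (2 * \<delta>) * card (hit1 x I (fst a)) / snd a"
          using \<delta>0 by (intro avg_bound[OF x(1) I(1) _ family(3)[OF 2(1), folded \<delta>_def]]) simp
        also have "(2 * \<delta>) * card (hit1 x I (fst a)) / snd a \<le> (2 * \<delta>) * card (hit1 x I (fst a)) / 2"
          using l \<delta>0 by (intro divide_left_mono) simp_all
        also have "\<dots> \<le> (2 * \<delta>) * N / 2"
        proof -
          have "supp (fst a) \<subseteq> supp (famsum \<A>)" using supp_famsum[OF family(1)] 2(1) by blast
          then have "card (hit1 x I (fst a)) \<le> N" unfolding N_def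
            by (intro card_mono finite_hit(2)[OF I(1)] hit1_mono)
          then show ?thesis using \<delta>0 by (intro divide_right_mono mult_left_mono) simp_all
        qed
        finally have "\<bar>pairing (fst a) (lc c I x)\<bar> \<le> 1 + \<delta> * N" by simp
        moreover have "\<delta> * 1 \<le> \<delta> * N" using N \<delta>0 by (intro mult_left_mono) simp_all
        ultimately show ?thesis using 2(3) by simp
      qed
    qed
    finally show ?thesis unfolding N_def \<delta>_def .
  qed
qed

lemma c0_estimate:
  assumes x: "block x" "\<And>i. W_norm n (x i) \<le> 1" "rapid n n x" and n: "1 \<le> n"
    and I: "finite I" "I \<noteq> {}" "card I \<le> Min I" and c: "\<And>i. i \<in> I \<Longrightarrow> \<bar>c i\<bar> \<le> 1"
  shows "W_norm n (lc c I x) \<le> 1 + 2 * (1/2) ^ card I"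
proof (rule W_norm_le)
  fix f assume f: "f \<in> W n"
  have m: "real (card (hit1 x I f)) \<le> 2 ^ card I"
  proof -
    have "card (hit1 x I f) \<le> card I" using I(1) by (intro card_mono) (auto simp: hit1_def hit_def)
    also have "\<dots> \<le> 2 ^ card I" by (simp add: less_imp_le)
    finally show ?thesis by (metis of_nat_le_iff of_nat_numeral of_nat_power)
  qed
  have "pairing f (lc c I x) \<le> 1 + (2 * (1/4) ^ card I) * card (hit1 x I f)"
    using c0_estimate_aux[where c = c, OF x n I c f] by simp
  also have "\<dots> \<le> 1 + (2 * (1/4) ^ card I) * 2 ^ card I"
    using m by (intro add_left_mono mult_left_mono) simp_all
  also have "(2 * (1/4) ^ card I) * 2 ^ card I = 2 * (1/2 :: real) ^ card I"
    by (simp add: mult.assoc power_mult_distrib[symmetric])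
  finally show "pairing f (lc c I x) \<le> 1 + 2 * (1/2) ^ card I" .
qed

lemma family_sum_average:
  fixes s :: nat
  assumes x: "block x" "\<And>i. W_norm n (x i) \<le> 1" "rapid n k x" and "k < n"
    and \<A>: "family n \<A>" "mins \<A> \<in> schreier k" and s: "\<And>a. a \<in> \<A> \<Longrightarrow> s \<le> snd a" "1 \<le> s"
    and I: "finite I" "I \<noteq> {}" "card I \<le> Min I" and c: "\<And>i. i \<in> I \<Longrightarrow> \<bar>c i\<bar> \<le> 1"
  shows "mass \<A> (lc c I x) \<le> 4 + card I / s"
proof -
  have single: "\<bar>pairing (fst a) (lc c I x)\<bar> \<le> 1 + card I / s" if "a \<in> \<A>" for a
  proof -
    have "\<bar>pairing (fst a) (lc c I x)\<bar> \<le> 1 + card I / snd a"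
      using \<A>(1) that by (intro avg_bound_norm[OF x(1,2) I(1) c]) (simp_all add: family_def)
    also have "\<dots> \<le> 1 + card I / s"
      using s(1)[OF that] s(2) by (intro add_left_mono divide_left_mono) simp_all
    finally show ?thesis .
  qed
  show ?thesis
  proof (cases k)
    case 0
    then obtain t where "mins \<A> = {t}" using \<A>(2) by auto
    moreover have "card (mins \<A>) = card \<A>"
      unfolding mins_def by (rule card_image[OF family_Min_inj[OF \<A>(1)]])
    ultimately have "card \<A> = 1" by simp
    then obtain a where "\<A> = {a}" by (rule card_1_singletonE)
    then show ?thesis using single[of a] by simp
  next
    case (Suc k')
    have p: "(1/4 :: real) ^ card I \<le> 1" by (rule power_le_one) simp_all
    consider "mass \<A> (lc c I x) \<le> 1 + 2 * (1/4) ^ card I"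
        | a where "a \<in> \<A>"
          "mass \<A> (lc c I x) \<le> \<bar>pairing (fst a) (lc c I x)\<bar> + (1/4) ^ card I"
      using admissible_sum_split[where c = c, OF x(1,2) x(3)[unfolded Suc] _ \<A>(1) \<A>(2)[unfolded Suc] I c]
        \<open>k < n\<close> Suc by auto
    then show ?thesis
    proof cases
      case 1
      have "0 \<le> real (card I) / s" by simp
      then show ?thesis using 1 p by linarith
    next
      case (2 a)
      then show ?thesis using single[of a] p by linarith
    qed
  qed
qed

definition dyadic :: "nat \<Rightarrow> nat set"
  where "dyadic j = {2 ^ Suc j..<2 ^ Suc (Suc j)}"

lemma dyadic_props:
  "finite (dyadic j)" "dyadic j \<noteq> {}" "card (dyadic j) = 2 ^ Suc j" "Min (dyadic j) = 2 ^ Suc j"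
  "before (dyadic j) (dyadic (Suc j))"
proof -
  have l: "(2 :: nat) ^ Suc j < 2 ^ Suc (Suc j)" by simp
  show "finite (dyadic j)" "card (dyadic j) = 2 ^ Suc j" by (simp_all add: dyadic_def)
  show ne: "dyadic j \<noteq> {}" using l unfolding dyadic_def by (simp only: atLeastLessThan_empty_iff) simp
  show "Min (dyadic j) = 2 ^ Suc j"
    by (rule Min_eqI) (use l in \<open>auto simp: dyadic_def\<close>)
  show "before (dyadic j) (dyadic (Suc j))" by (auto simp: dyadic_def before_def)
qed

definition dyadic_avg :: "(nat \<Rightarrow> nat \<Rightarrow> real) \<Rightarrow> nat \<Rightarrow> nat \<Rightarrow> real"
  where "dyadic_avg x j = lc (\<lambda>_. 1 / 2 ^ Suc j) (dyadic j) x"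

lemma pairing_dyadic_avg:
  assumes "block x"
  shows "pairing f (dyadic_avg x j) = pairing f (lc (\<lambda>_. 1) (dyadic j) x) / 2 ^ Suc j"
  unfolding dyadic_avg_def using pairing_lc[OF dyadic_props(1) block_c00[OF assms]]
  by (simp add: sum_divide_distrib)

lemma block_dyadic_avg: "block x \<Longrightarrow> block (dyadic_avg x)"
  unfolding dyadic_avg_def by (rule block_lc) (simp_all add: dyadic_props)

lemma W_norm_dyadic_avg:
  assumes "block x" "\<And>i. W_norm n (x i) \<le> 1"
  shows "W_norm n (dyadic_avg x j) \<le> 1"
proof (rule W_norm_le)
  fix f assume f: "f \<in> W n"
  have "pairing f (lc (\<lambda>_. 1) (dyadic j) x) = (\<Sum>i\<in>dyadic j. 1 * pairing f (x i))"
    by (rule pairing_lc[OF dyadic_props(1) block_c00[OF assms(1)]])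
  also have "\<dots> \<le> (\<Sum>i\<in>dyadic j. 1)"
    using abs_pairing_le_W_norm[OF f] assms(2) by (intro sum_mono) (simp, meson abs_le_D1 order.trans)
  also have "\<dots> = 2 ^ Suc j" by (simp add: dyadic_props(3))
  finally show "pairing f (dyadic_avg x j) \<le> 1"
    unfolding pairing_dyadic_avg[OF assms(1)] by simp
qed

lemma small_dyadic_avg:
  assumes x: "block x" "\<And>i. W_norm n (x i) \<le> 1" "rapid n k x" and "k < n"
  shows "small n (Suc k) (dyadic_avg x)"
  unfolding small.simps
proof (intro allI impI)
  fix e :: real assume e: "0 < e"
  obtain s :: nat where s: "5 / e < s" using reals_Archimedean2 by blast
  have s0: "0 < s" using s e by (metis divide_pos_pos less_trans of_nat_0_less_iff zero_less_numeral)
  show "\<exists>s. \<forall>j\<ge>s. \<forall>\<A>. family n \<A> \<longrightarrow> mins \<A> \<in> schreier k \<longrightarrow>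
      (\<forall>a\<in>\<A>. s \<le> snd a) \<longrightarrow> mass \<A> (dyadic_avg x j) \<le> e"
  proof (intro exI[of _ s] allI impI)
    fix j \<A> assume j: "s \<le> j" and A: "family n \<A>" "mins \<A> \<in> schreier k" "\<forall>a\<in>\<A>. s \<le> snd a"
    let ?N = "2 ^ Suc j :: real"
    have "j < 2 ^ Suc j" by (rule less_trans[OF lessI less_exp])
    then have "s \<le> 2 ^ Suc j" using j by linarith
    then have sN: "real s \<le> ?N" by (metis of_nat_le_iff of_nat_numeral of_nat_power)
    have "mass \<A> (lc (\<lambda>_. 1) (dyadic j) x) \<le> 4 + card (dyadic j) / s"
      using A(3) s0 dyadic_props(2,3,4)[of j]
      by (intro family_sum_average[OF x \<open>k < n\<close> A(1,2)]) (simp_all add: dyadic_props(1))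
    also have "\<dots> = 4 + ?N / s" by (simp add: dyadic_props(3))
    finally have "mass \<A> (dyadic_avg x j) \<le> (4 + ?N / s) / ?N"
      unfolding pairing_dyadic_avg[OF x(1)] abs_divide
      by (simp add: sum_divide_distrib[symmetric] divide_right_mono del: power_Suc)
    also have "\<dots> = 4 / ?N + 1 / s" by (simp add: add_divide_distrib)
    also have "\<dots> \<le> 4 / s + 1 / s" using sN s0 by (intro add_right_mono divide_left_mono) simp_all
    also have "\<dots> = 5 / s" by simp
    also have "\<dots> \<le> e" using s s0 e by (simp add: field_simps)
    finally show "mass \<A> (dyadic_avg x j) \<le> e" .
  qed
qed

subsection \<open>Lower estimates\<close>

lemma strict_mono_le: "strict_mono r \<Longrightarrow> i \<le> (r i :: nat)"
  by (rule strict_mono_imp_increasing)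

lemma smallD:
  assumes "small n (Suc k) x" "0 < e"
  obtains s where "\<And>j \<A>. s \<le> j \<Longrightarrow> family n \<A> \<Longrightarrow> mins \<A> \<in> schreier k \<Longrightarrow>
      (\<And>a. a \<in> \<A> \<Longrightarrow> s \<le> snd a) \<Longrightarrow> mass \<A> (x j) \<le> e"
proof -
  obtain s where s: "\<forall>j\<ge>s. \<forall>\<A>. family n \<A> \<longrightarrow> mins \<A> \<in> schreier k \<longrightarrow>
      (\<forall>a\<in>\<A>. s \<le> snd a) \<longrightarrow> mass \<A> (x j) \<le> e"
    using assms(1)[unfolded small.simps, rule_format, OF assms(2)] by (rule exE)
  show ?thesis
  proof (rule that[of s])
    fix j \<A> assume "s \<le> j" "family n \<A>" "mins \<A> \<in> schreier k" "\<And>a. a \<in> \<A> \<Longrightarrow> s \<le> snd a"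
    then show "mass \<A> (x j) \<le> e" using s by simp
  qed
qed

lemma small_mono:
  assumes "small n l x" "k \<le> l"
  shows "small n k x"
proof (cases k)
  case (Suc k')
  obtain l' where l': "l = Suc l'" "k' \<le> l'" using assms(2) Suc by (cases l) auto
  show ?thesis unfolding Suc small.simps
  proof (intro allI impI)
    fix e :: real assume "0 < e"
    then obtain s where s: "\<And>j \<A>. s \<le> j \<Longrightarrow> family n \<A> \<Longrightarrow> mins \<A> \<in> schreier l' \<Longrightarrow>
      (\<And>a. a \<in> \<A> \<Longrightarrow> s \<le> snd a) \<Longrightarrow> mass \<A> (x j) \<le> e"
      using smallD[OF assms(1)[unfolded l'(1)]] by metis
    show "\<exists>s. \<forall>j\<ge>s. \<forall>\<A>. family n \<A> \<longrightarrow> mins \<A> \<in> schreier k' \<longrightarrow>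
      (\<forall>a\<in>\<A>. s \<le> snd a) \<longrightarrow> mass \<A> (x j) \<le> e"
      using s schreier_mono[OF l'(2)] by (intro exI[of _ s] allI impI) (simp add: subset_iff)
  qed
qed simp

lemma small_subseq:
  assumes "small n k x" "strict_mono r"
  shows "small n k (x \<circ> r)"
proof (cases k)
  case (Suc k')
  show ?thesis unfolding Suc small.simps
  proof (intro allI impI)
    fix e :: real assume "0 < e"
    then obtain s where s: "\<And>j \<A>. s \<le> j \<Longrightarrow> family n \<A> \<Longrightarrow> mins \<A> \<in> schreier k' \<Longrightarrow>
      (\<And>a. a \<in> \<A> \<Longrightarrow> s \<le> snd a) \<Longrightarrow> mass \<A> (x j) \<le> e"
      using smallD[OF assms(1)[unfolded Suc]] by metis
    show "\<exists>s. \<forall>j\<ge>s. \<forall>\<A>. family n \<A> \<longrightarrow> mins \<A> \<in> schreier k' \<longrightarrow>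
      (\<forall>a\<in>\<A>. s \<le> snd a) \<longrightarrow> mass \<A> ((x \<circ> r) j) \<le> e"
    proof (intro exI[of _ s] allI impI)
      fix j \<A> assume "s \<le> j" "family n \<A>" "mins \<A> \<in> schreier k'" "\<forall>a\<in>\<A>. s \<le> snd a"
      then show "mass \<A> ((x \<circ> r) j) \<le> e"
        using strict_mono_le[OF assms(2), of j] by (simp add: s)
    qed
  qed
qed simp

lemma pairing_lc_single: "x j \<in> c00 \<Longrightarrow> pairing f (lc c {j} x) = c j * pairing f (x j)"
  using pairing_lc[of "{j}" x f c] by simp

lemma small_scale:
  assumes "block x" "small n k x" "\<And>j. \<bar>c j\<bar> \<le> K"
  shows "small n k (\<lambda>j. lc c {j} x)"
proof (cases k)
  case (Suc k')
  have K: "0 \<le> K" using assms(3)[of 0] by simp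
  show ?thesis unfolding Suc small.simps
  proof (intro allI impI)
    fix e :: real assume e: "0 < e"
    then have "0 < e / (K + 1)" using K by simp
    then obtain s where s: "\<And>j \<A>. s \<le> j \<Longrightarrow> family n \<A> \<Longrightarrow> mins \<A> \<in> schreier k' \<Longrightarrow>
      (\<And>a. a \<in> \<A> \<Longrightarrow> s \<le> snd a) \<Longrightarrow> mass \<A> (x j) \<le> e / (K + 1)"
      using smallD[OF assms(2)[unfolded Suc]] by metis
    show "\<exists>s. \<forall>j\<ge>s. \<forall>\<A>. family n \<A> \<longrightarrow> mins \<A> \<in> schreier k' \<longrightarrow>
      (\<forall>a\<in>\<A>. s \<le> snd a) \<longrightarrow> mass \<A> (lc c {j} x) \<le> e"
    proof (intro exI[of _ s] allI impI)
      fix j \<A> assume A: "s \<le> j" "family n \<A>" "mins \<A> \<in> schreier k'" "\<forall>a\<in>\<A>. s \<le> snd a"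
      have "mass \<A> (lc c {j} x) = \<bar>c j\<bar> * mass \<A> (x j)"
        by (simp add: pairing_lc_single[OF block_c00[OF assms(1)]] abs_mult sum_distrib_left)
      also have "\<dots> \<le> (K + 1) * (e / (K + 1))"
        using assms(3)[of j] K s[of j \<A>] A by (intro mult_mono) (auto simp: sum_nonneg)
      also have "\<dots> = e" using K by simp
      finally show "mass \<A> (lc c {j} x) \<le> e" .
    qed
  qed
qed simp

definition ladder :: "nat \<Rightarrow> (nat \<Rightarrow> nat \<Rightarrow> real) \<Rightarrow> (nat \<Rightarrow> ((nat \<Rightarrow> real) \<times> nat) set) \<Rightarrow> bool"
  where "ladder n x \<A> \<longleftrightarrow> block x \<and>
    (\<forall>i. family n (\<A> i) \<and> (\<forall>a\<in>\<A> i. supp (fst a) \<subseteq> supp (x i))) \<and>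
    (\<forall>i j. i < j \<longrightarrow> (\<forall>a\<in>\<A> i. \<forall>b\<in>\<A> j. prec a b))"

lemma mins_UN: "mins (\<Union>i\<in>D. \<A> i) = (\<Union>i\<in>D. mins (\<A> i))"
  by (auto simp: mins_def)

lemma ladder_family:
  assumes "ladder n x \<A>" "finite D"
  shows "family n (\<Union>i\<in>D. \<A> i)"
  unfolding family_def
proof (intro conjI)
  have F: "family n (\<A> i)" for i using assms(1) by (simp add: ladder_def)
  show "finite (\<Union>i\<in>D. \<A> i)" using assms(2) F by (simp add: family_def)
  show "\<forall>a\<in>\<Union>i\<in>D. \<A> i. avg_in (W n) (fst a) (snd a)" using F by (simp add: family_def)
  show "pairwise (\<lambda>a b. prec a b \<or> prec b a) (\<Union>i\<in>D. \<A> i)"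
    unfolding pairwise_def
  proof (intro ballI impI)
    fix a b assume "a \<in> (\<Union>i\<in>D. \<A> i)" "b \<in> (\<Union>i\<in>D. \<A> i)" "a \<noteq> b"
    then obtain i j where ij: "a \<in> \<A> i" "b \<in> \<A> j" by blast
    consider "i < j" | "j < i" | "i = j" by linarith
    then show "prec a b \<or> prec b a"
    proof cases
      case 3
      then show ?thesis using F[of i] ij \<open>a \<noteq> b\<close> by (simp add: family_def pairwise_def)
    qed (use assms(1) ij in \<open>simp_all add: ladder_def\<close>)
  qed
qed

lemma ladder_lower:
  assumes L: "ladder n x \<A>" "finite D" "mins (\<Union>i\<in>D. \<A> i) \<in> schreier n"
  shows "(\<Sum>i\<in>D. \<bar>c i\<bar> * mass (\<A> i) (x i)) \<le> W_norm n (lc c D x)"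
proof -
  have x: "block x" using L(1) by (simp add: ladder_def)
  have fin: "finite (\<A> i)" for i using L(1) by (simp add: ladder_def family_def)
  have disj: "\<A> i \<inter> \<A> j = {}" if "i \<noteq> j" for i j
  proof (rule ccontr)
    assume "\<A> i \<inter> \<A> j \<noteq> {}"
    then obtain a where a: "a \<in> \<A> i" "a \<in> \<A> j" by blast
    have "prec a a" using L(1) a that unfolding ladder_def by (metis linorder_neqE_nat)
    then show False by (simp add: prec_def)
  qed
  have P: "pairing (fst a) (lc c D x) = c i * pairing (fst a) (x i)" if "i \<in> D" "a \<in> \<A> i" for i a
  proof -
    have "pairing (fst a) (lc c D x) = (\<Sum>j\<in>D. c j * pairing (fst a) (x j))"
      by (rule pairing_lc[OF L(2) block_c00[OF x]])
    also have "\<dots> = (\<Sum>j\<in>{i}. c j * pairing (fst a) (x j))"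
    proof (rule sum.mono_neutral_right[OF L(2)])
      show "\<forall>j\<in>D - {i}. c j * pairing (fst a) (x j) = 0"
      proof
        fix j assume j: "j \<in> D - {i}"
        have "supp (fst a) \<subseteq> supp (x i)" using L(1) that by (simp add: ladder_def)
        then have "supp (fst a) \<inter> supp (x j) = {}"
          using comparable_disjoint[OF block_comparable[OF x, of i j]] j by blast
        then show "c j * pairing (fst a) (x j) = 0" by (simp add: pairing_disjoint)
      qed
    qed (use that in auto)
    finally show ?thesis by simp
  qed
  have "(\<Sum>i\<in>D. \<bar>c i\<bar> * mass (\<A> i) (x i)) =
      (\<Sum>i\<in>D. \<Sum>a\<in>\<A> i. \<bar>pairing (fst a) (lc c D x)\<bar>)"
    by (simp add: P abs_mult sum_distrib_left)
  also have "\<dots> = (\<Sum>a\<in>(\<Union>i\<in>D. \<A> i). \<bar>pairing (fst a) (lc c D x)\<bar>)"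
    using L(2) fin disj by (intro sum.UNION_disjoint[symmetric]) auto
  also have "\<dots> \<le> W_norm n (lc c D x)" by (rule family_abs_sum[OF ladder_family[OF L(1,2)] L(3)])
  finally show ?thesis .
qed

lemma schreier_1I: "finite I \<Longrightarrow> I \<noteq> {} \<Longrightarrow> card I \<le> Min I \<Longrightarrow> I \<in> schreier (Suc 0)"
  by (auto simp: card_gt_0_iff Suc_le_eq dest: Min_le)

lemma not_small_ladder:
  assumes x: "block x" and "\<not> small n (Suc k) x"
  obtains r :: "nat \<Rightarrow> nat" and \<A> e where "strict_mono r" "0 < e" "ladder n (x \<circ> r) \<A>" "\<And>i. mins (\<A> i) \<in> schreier k"
    "\<And>i. e \<le> mass (\<A> i) ((x \<circ> r) i)"
proof -
  define P where "P = (\<lambda>e s. \<forall>j\<ge>s. \<forall>\<A>. family n \<A> \<longrightarrow> mins \<A> \<in> schreier k \<longrightarrow>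
      (\<forall>a\<in>\<A>. s \<le> snd a) \<longrightarrow> mass \<A> (x j) \<le> e)"
  have "\<not> (\<forall>e>0. \<exists>s. P e s)" using assms(2) unfolding small.simps P_def .
  then obtain e where e: "0 < e" and nP: "\<And>s. \<not> P e s" by blast
  have N: "\<exists>j\<ge>s. \<exists>\<A>. family n \<A> \<and> mins \<A> \<in> schreier k \<and>
      (\<forall>a\<in>\<A>. s \<le> snd a) \<and> e < mass \<A> (x j)" for s
    using nP[of s] unfolding P_def by (simp only: not_all not_imp not_le)
  define G where "G = (\<lambda>(s, j, \<A>). s \<le> j \<and> family n \<A> \<and> mins \<A> \<in> schreier k \<and>
      (\<forall>a\<in>\<A>. s \<le> snd a) \<and> e \<le> mass \<A> (x j) \<and> (\<forall>a\<in>\<A>. supp (fst a) \<subseteq> supp (x j)))"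
  have ex: "\<exists>j \<A>. G (s, j, \<A>)" for s
  proof -
    obtain j \<A> where A: "s \<le> j" "family n \<A>" "mins \<A> \<in> schreier k" "\<forall>a\<in>\<A>. s \<le> snd a"
      "e < mass \<A> (x j)" using N[of s] by blast
    have "mass \<A> (x j) \<noteq> 0" using A(5) e by simp
    then obtain a0 where a0: "a0 \<in> \<A>" "\<bar>pairing (fst a0) (x j)\<bar> \<noteq> 0"
      by (rule sum.not_neutral_contains_not_neutral)
    then have "supp (fst a0) \<inter> supp (x j) \<noteq> {}" using pairing_disjoint by auto
    then obtain \<B> where B: "family n \<B>" "mins \<B> \<in> schreier k"
      "\<And>b. b \<in> \<B> \<Longrightarrow> supp (fst b) \<subseteq> supp (x j) \<and> snd b \<in> snd ` \<A>"
      "\<And>y. supp y \<subseteq> supp (x j) \<Longrightarrow> mass \<B> y = mass \<A> y"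
      using family_restrict[OF A(2,3) a0(1), of "supp (x j)"] by metis
    have "s \<le> snd b" if "b \<in> \<B>" for b using B(3)[OF that] A(4) by auto
    then have "G (s, j, \<B>)" using A(1,5) B(1,2,3) B(4)[of "x j"] by (simp add: G_def)
    then show ?thesis by blast
  qed
  define Q where "Q = (\<lambda>(s :: nat, j, \<A> :: ((nat \<Rightarrow> real) \<times> nat) set) (s', j' :: nat, \<A>' :: ((nat \<Rightarrow> real) \<times> nat) set).
      j < s' \<and> (\<forall>a\<in>\<A>. snd a < s') \<and> (\<forall>t\<in>supp (x j). t < (s' :: nat)))"
  have "\<exists>f. \<forall>i. G (f i) \<and> Q (f i) (f (Suc i))"
  proof (rule dependent_nat_choice)
    show "\<exists>v. G v" using ex[of 0] by blast
    fix v i assume "G v"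
    obtain s j \<A> where v: "v = (s, j, \<A>)" by (cases v)
    have fin: "finite \<A>" using \<open>G v\<close> by (simp add: G_def v family_def)
    define s' where "s' = Suc (j + Max (insert 0 (snd ` \<A>)) + top_supp x j)"
    have "snd a < s'" if "a \<in> \<A>" for a
    proof -
      have "snd a \<le> Max (insert 0 (snd ` \<A>))" using fin that by (intro Max_ge) simp_all
      then show ?thesis by (simp add: s'_def)
    qed
    moreover have "t < s'" if "t \<in> supp (x j)" for t
      using Max_ge[OF block_supp(1)[OF x] that] by (simp add: s'_def)
    ultimately have "\<forall>j' \<A>'. Q v (s', j', \<A>')" by (simp add: Q_def v s'_def)
    then show "\<exists>w. G w \<and> Q v w" using ex[of s'] by blast
  qed
  then obtain f where f: "\<And>i. G (f i)" "\<And>i. Q (f i) (f (Suc i))" by blast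
  define S where "S = (\<lambda>i. fst (f i))"
  define r where "r = (\<lambda>i. fst (snd (f i)))"
  define \<A> where "\<A> = (\<lambda>i. snd (snd (f i)))"
  have g: "S i \<le> r i" "family n (\<A> i)" "mins (\<A> i) \<in> schreier k" "\<And>a. a \<in> \<A> i \<Longrightarrow> S i \<le> snd a"
    "e \<le> mass (\<A> i) (x (r i))" "\<And>a. a \<in> \<A> i \<Longrightarrow> supp (fst a) \<subseteq> supp (x (r i))" for i
    using f(1)[of i] by (auto simp: G_def S_def r_def \<A>_def case_prod_unfold)
  have q: "r i < S (Suc i)" "\<And>a. a \<in> \<A> i \<Longrightarrow> snd a < S (Suc i)"
    "\<And>t. t \<in> supp (x (r i)) \<Longrightarrow> t < S (Suc i)" for i
    using f(2)[of i] by (auto simp: Q_def S_def r_def \<A>_def case_prod_unfold)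
  have r: "strict_mono r"
    unfolding strict_mono_Suc_iff using q(1) g(1) by (meson less_le_trans)
  have S: "mono S" unfolding mono_iff_le_Suc using g(1) q(1) by (meson less_imp_le order.trans)
  have "ladder n (x \<circ> r) \<A>"
    unfolding ladder_def
  proof (intro conjI allI impI ballI)
    show "block (x \<circ> r)" by (rule block_subseq[OF x r])
    show "family n (\<A> i)" for i by (rule g)
    show "supp (fst a) \<subseteq> supp ((x \<circ> r) i)" if "a \<in> \<A> i" for i a using g(6)[OF that] by simp
    fix i j :: nat and a b assume ij: "i < j" "a \<in> \<A> i" "b \<in> \<A> j"
    have Sj: "S (Suc i) \<le> S j" using S ij(1) by (simp add: mono_def)
    have sb: "S j \<le> snd b" using g(4)[OF ij(3)] .
    have "before (supp (fst a)) (supp (fst b))"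
    proof (rule before_mono)
      show "before (supp (x (r i))) (supp (x (r j)))"
        using ij(1) r by (intro block_before[OF x]) (simp add: strict_mono_def)
    qed (use g(6) ij in blast)+
    moreover have "snd a < snd b" using q(2)[OF ij(2)] Sj sb by simp
    moreover have "t < snd b" if "t \<in> supp (fst a)" for t
    proof -
      have "t \<in> supp (x (r i))" using g(6)[OF ij(2)] that by blast
      then show ?thesis using q(3)[of t i] Sj sb by simp
    qed
    ultimately show "prec a b" by (simp add: prec_def)
  qed
  then show ?thesis using that[OF r e] g(3,5) by simp
qed

lemma ladder_schreier_Suc:
  assumes "ladder n x \<A>" "\<And>i. mins (\<A> i) \<in> schreier k" "I \<in> schreier (Suc 0)"
  shows "mins (\<Union>i\<in>I. \<A> i) \<in> schreier (Suc k)"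
proof -
  have x: "block x" using assms(1) by (simp add: ladder_def)
  have sub: "mins (\<A> i) \<subseteq> supp (x i)" for i
  proof
    fix t assume "t \<in> mins (\<A> i)"
    then obtain a where a: "a \<in> \<A> i" "t = Min (supp (fst a))" unfolding mins_def by blast
    have "family n (\<A> i)" "supp (fst a) \<subseteq> supp (x i)" using assms(1) a(1) by (simp_all add: ladder_def)
    then show "t \<in> supp (x i)" using family_fin[of n "\<A> i" a] a Min_in[of "supp (fst a)"] by blast
  qed
  have "(\<Union>i\<in>I. mins (\<A> i)) \<in> schreier (Suc 0 + k)"
  proof (rule schreier_convolution[OF assms(3)])
    show "mins (\<A> j) \<in> schreier k" for j by (rule assms(2))
    show "j \<le> i" if "i \<in> mins (\<A> j)" for i j
      using block_index_less[OF x, of i j] sub[of j] that by auto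
    show "before (mins (\<A> j)) (mins (\<A> j'))" if "j < j'" for j j'
      by (rule before_mono[OF block_before[OF x that] sub sub])
  qed
  then show ?thesis by (simp add: mins_UN)
qed

lemma lc_const_subseq: "strict_mono r \<Longrightarrow> lc (\<lambda>_. a) I (x \<circ> r) = lc (\<lambda>_. a) (r ` I) x"
  by (simp add: lc_def sum.reindex strict_mono_imp_inj_on)

lemma not_small_dyadic_lower:
  assumes x: "block x" and "n = Suc k" "\<not> small n n x"
  obtains r :: "nat \<Rightarrow> nat" and e where "strict_mono r" "0 < e"
    "\<And>r' j. strict_mono r' \<Longrightarrow> e \<le> W_norm n (dyadic_avg (x \<circ> r \<circ> r') j)"
proof -
  obtain r \<A> e where r: "strict_mono r" "0 < e" "ladder n (x \<circ> r) \<A>" "\<And>i. mins (\<A> i) \<in> schreier k"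
    "\<And>i. e \<le> mass (\<A> i) ((x \<circ> r) i)"
    using not_small_ladder[OF x assms(3)[unfolded assms(2)]] assms(2) by metis
  have "e \<le> W_norm n (dyadic_avg (x \<circ> r \<circ> r') j)" if r': "strict_mono r'" for r' j
  proof -
    let ?c = "1 / 2 ^ Suc j :: real" and ?I = "r' ` dyadic j"
    have inj: "inj_on r' (dyadic j)" using r' by (rule strict_mono_imp_inj_on)
    have cI: "card ?I = 2 ^ Suc j" by (simp only: card_image[OF inj] dyadic_props(3))
    have "2 ^ Suc j \<le> i" if i: "i \<in> ?I" for i
    proof -
      obtain l where l: "l \<in> dyadic j" "i = r' l" using i by blast
      then have "2 ^ Suc j \<le> l" by (simp add: dyadic_def)
      then show ?thesis using strict_mono_le[OF r', of l] l(2) by simp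
    qed
    then have "card ?I \<le> Min ?I" unfolding cI using dyadic_props(1,2)[of j] by simp
    then have I: "?I \<in> schreier (Suc 0)" using dyadic_props(1,2)[of j] by (intro schreier_1I) simp_all
    have "mins (\<Union>i\<in>?I. \<A> i) \<in> schreier n"
      using ladder_schreier_Suc[OF r(3,4) I] assms(2) by simp
    then have "(\<Sum>i\<in>?I. \<bar>?c\<bar> * mass (\<A> i) ((x \<circ> r) i)) \<le> W_norm n (lc (\<lambda>_. ?c) ?I (x \<circ> r))"
      using dyadic_props(1) by (intro ladder_lower[OF r(3)]) simp_all
    moreover have "(\<Sum>i\<in>?I. \<bar>?c\<bar> * e) \<le> (\<Sum>i\<in>?I. \<bar>?c\<bar> * mass (\<A> i) ((x \<circ> r) i))"
      using r(5) by (intro sum_mono mult_left_mono) simp_all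
    moreover have "(\<Sum>i\<in>?I. \<bar>?c\<bar> * e) = e" unfolding sum_constant cI by simp
    ultimately show ?thesis unfolding dyadic_avg_def lc_const_subseq[OF r'] by simp
  qed
  then show ?thesis by (rule that[OF r(1,2)])
qed

subsection \<open>Iterated averages\<close>

definition convex_blocks :: "nat \<Rightarrow> (nat \<Rightarrow> nat set) \<Rightarrow> (nat \<Rightarrow> nat \<Rightarrow> real) \<Rightarrow> bool"
  where "convex_blocks b H c \<longleftrightarrow> (\<forall>j. H j \<in> schreier b \<and> before (H j) (H (Suc j)) \<and>
    (\<forall>i\<in>H j. 0 < c j i) \<and> (\<Sum>i\<in>H j. c j i) = 1)"

lemma convex_blocks_props:
  assumes "convex_blocks b H c"
  shows "finite (H j)" "H j \<noteq> {}" "i < j \<Longrightarrow> before (H i) (H j)" "i \<noteq> j \<Longrightarrow> H i \<inter> H j = {}"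
    "i \<in> H j \<Longrightarrow> j < i"
proof -
  have H: "H j \<in> schreier b" "before (H j) (H (Suc j))" for j using assms by (simp_all add: convex_blocks_def)
  show "finite (H j)" using schreier_basic[OF H(1)] by simp
  have ne: "H j \<noteq> {}" for j using schreier_basic[OF H(1)] by simp
  then show "H j \<noteq> {}" .
  have bef: "before (H i) (H j)" if "i < j" for i j by (rule sets_before[of H, OF ne H(2) that])
  then show "i < j \<Longrightarrow> before (H i) (H j)" .
  show "i \<noteq> j \<Longrightarrow> H i \<inter> H j = {}"
    using bef[of i j] bef[of j i] unfolding before_def by (meson disjoint_iff less_irrefl linorder_neqE_nat)
  show "j < i" if "i \<in> H j" for i
    using that
  proof (induction j arbitrary: i)
    case 0
    then show ?case using schreier_basic[OF H(1), of 0] by (metis gr0I)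
  next
    case (Suc j)
    obtain v where v: "v \<in> H j" using ne by blast
    then have "v < i" using beforeD[OF H(2) v Suc.prems] by simp
    then show ?case using Suc.IH[OF v] by simp
  qed
qed

lemma block_convex: 
  assumes "block x" "convex_blocks b H c"
  shows "block (\<lambda>j. lc (c j) (H j) x)"
proof (rule block_lc[OF assms(1)])
  show "finite (H j)" "H j \<noteq> {}" for j by (rule convex_blocks_props[OF assms(2)])+
  show "before (H j) (H (Suc j))" for j using assms(2) by (simp add: convex_blocks_def)
  show "c j i \<noteq> 0" if "i \<in> H j" for i j
  proof -
    have "0 < c j i" using assms(2) that by (simp add: convex_blocks_def)
    then show ?thesis by simp
  qed
qed

lemma W_norm_convex:
  assumes "block x" "\<And>i. W_norm n (x i) \<le> 1" "convex_blocks b H c"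
  shows "W_norm n (lc (c j) (H j) x) \<le> 1"
proof (rule W_norm_le)
  fix f assume f: "f \<in> W n"
  have "pairing f (lc (c j) (H j) x) = (\<Sum>i\<in>H j. c j i * pairing f (x i))"
    by (rule pairing_lc[OF convex_blocks_props(1)[OF assms(3)] block_c00[OF assms(1)]])
  also have "\<dots> \<le> (\<Sum>i\<in>H j. c j i * 1)"
  proof (intro sum_mono mult_left_mono)
    fix i assume i: "i \<in> H j"
    show "pairing f (x i) \<le> 1" using abs_pairing_le_W_norm[OF f, of "x i"] assms(2)[of i] by linarith
    show "0 \<le> c j i" using assms(3) i by (simp add: convex_blocks_def less_imp_le)
  qed
  also have "\<dots> = 1" using assms(3) by (simp add: convex_blocks_def)
  finally show "pairing f (lc (c j) (H j) x) \<le> 1" .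
qed

text \<open>As the blocks \<open>H i\<close> are disjoint, at most one of the summands is nonzero.\<close>

definition combined :: "(nat \<Rightarrow> nat set) \<Rightarrow> (nat \<Rightarrow> nat \<Rightarrow> real) \<Rightarrow> (nat \<Rightarrow> real) \<Rightarrow> nat set \<Rightarrow> nat \<Rightarrow> real"
  where "combined H c a F l = (\<Sum>i\<in>F. if l \<in> H i then a i * c i l else 0)"

lemma combined_eq:
  assumes "convex_blocks b H c" "finite F" "i \<in> F" "l \<in> H i"
  shows "combined H c a F l = a i * c i l"
proof -
  have "l \<notin> H i'" if "i' \<noteq> i" for i' using convex_blocks_props(4)[OF assms(1) that] assms(4) by blast
  then have "combined H c a F l = (\<Sum>i'\<in>{i}. if l \<in> H i' then a i' * c i' l else 0)"
    unfolding combined_def using assms(2,3) by (intro sum.mono_neutral_right) auto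
  then show ?thesis using assms(4) by simp
qed

lemma sum_combined:
  fixes g :: "nat \<Rightarrow> real \<Rightarrow> 'b :: comm_monoid_add"
  assumes "convex_blocks b H c" "finite F"
  shows "(\<Sum>l\<in>(\<Union>i\<in>F. H i). g l (combined H c a F l)) = (\<Sum>i\<in>F. \<Sum>l\<in>H i. g l (a i * c i l))"
proof -
  have "(\<Sum>l\<in>(\<Union>i\<in>F. H i). g l (combined H c a F l)) = (\<Sum>i\<in>F. \<Sum>l\<in>H i. g l (combined H c a F l))"
    using assms(2) convex_blocks_props(1,4)[OF assms(1)] by (intro sum.UNION_disjoint) auto
  also have "\<dots> = (\<Sum>i\<in>F. \<Sum>l\<in>H i. g l (a i * c i l))"
    by (intro sum.cong refl) (simp add: combined_eq[OF assms])
  finally show ?thesis .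
qed

lemma lc_combined:
  assumes "convex_blocks b H c" "finite F"
  shows "lc (combined H c a F) (\<Union>i\<in>F. H i) x = lc a F (\<lambda>i. lc (c i) (H i) x)"
proof
  fix t
  show "lc (combined H c a F) (\<Union>i\<in>F. H i) x t = lc a F (\<lambda>i. lc (c i) (H i) x) t"
    unfolding lc_def using sum_combined[OF assms, of "\<lambda>l r. r * x l t" a]
    by (simp add: sum_distrib_left mult.assoc)
qed

lemma schreier_convex_UN:
  assumes "convex_blocks b H c" "F \<in> schreier a"
  shows "(\<Union>i\<in>F. H i) \<in> schreier (a + b)"
proof (rule schreier_convolution[OF assms(2)])
  show "H j \<in> schreier b" for j using assms(1) by (simp add: convex_blocks_def)
  show "j \<le> i" if "i \<in> H j" for i j using convex_blocks_props(5)[OF assms(1) that] by simp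
  show "before (H j) (H j')" if "j < j'" for j j' by (rule convex_blocks_props(3)[OF assms(1) that])
qed

lemma convex_blocks_subseq:
  assumes "convex_blocks b H c" "strict_mono r"
  shows "convex_blocks b (H \<circ> r) (c \<circ> r)"
proof -
  have "before (H (r j)) (H (r (Suc j)))" for j
    using assms(2) by (intro convex_blocks_props(3)[OF assms(1)]) (simp add: strict_mono_def)
  then show ?thesis using assms(1) by (simp add: convex_blocks_def)
qed

lemma dyadic_schreier: "dyadic j \<in> schreier (Suc 0)"
  by (rule schreier_1I[OF dyadic_props(1,2)]) (simp only: dyadic_props)

lemma convex_blocks_dyadic:
  assumes "convex_blocks b H c"
  shows "convex_blocks (Suc b) (\<lambda>j. \<Union>i\<in>dyadic j. H i) (\<lambda>j. combined H c (\<lambda>_. 1 / 2 ^ Suc j) (dyadic j))"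
  unfolding convex_blocks_def
proof (intro allI conjI ballI)
  fix j
  note fin = dyadic_props(1)
  show "(\<Union>i\<in>dyadic j. H i) \<in> schreier (Suc b)"
    using schreier_convex_UN[OF assms dyadic_schreier] by simp
  show "before (\<Union>i\<in>dyadic j. H i) (\<Union>i\<in>dyadic (Suc j). H i)"
    unfolding before_def
  proof (intro ballI)
    fix u v assume "u \<in> (\<Union>i\<in>dyadic j. H i)" "v \<in> (\<Union>i\<in>dyadic (Suc j). H i)"
    then obtain i i' where "i \<in> dyadic j" "u \<in> H i" "i' \<in> dyadic (Suc j)" "v \<in> H i'" by blast
    then show "u < v"
      using beforeD[OF dyadic_props(5)] beforeD[OF convex_blocks_props(3)[OF assms]] by blast
  qed
  show "0 < combined H c (\<lambda>_. 1 / 2 ^ Suc j) (dyadic j) l" if l: "l \<in> (\<Union>i\<in>dyadic j. H i)" for l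
  proof -
    obtain i where i: "i \<in> dyadic j" "l \<in> H i" using l by blast
    have "0 < c i l" using assms i by (simp add: convex_blocks_def)
    then show ?thesis by (simp add: combined_eq[OF assms fin i])
  qed
  have "(\<Sum>l\<in>(\<Union>i\<in>dyadic j. H i). combined H c (\<lambda>_. 1 / 2 ^ Suc j) (dyadic j) l) =
      (\<Sum>i\<in>dyadic j. \<Sum>l\<in>H i. 1 / 2 ^ Suc j * c i l)"
    by (rule sum_combined[OF assms fin])
  also have "\<dots> = (\<Sum>i\<in>dyadic j. 1 / 2 ^ Suc j * 1)"
    unfolding sum_distrib_left[symmetric] using assms by (simp only: convex_blocks_def)
  also have "\<dots> = 1" by (simp add: dyadic_props(3))
  finally show "(\<Sum>l\<in>(\<Union>i\<in>dyadic j. H i). combined H c (\<lambda>_. 1 / 2 ^ Suc j) (dyadic j) l) = 1" .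
qed

lemma small_iterated_averages:
  assumes x: "block x" "\<And>i. W_norm n (x i) \<le> 1" "small n a x" and "a + b \<le> n"
  obtains H c where "convex_blocks b H c" "small n (a + b) (\<lambda>j. lc (c j) (H j) x)"
  using assms(4)
proof (induction b arbitrary: thesis)
  case 0
  have "convex_blocks 0 (\<lambda>j. {Suc j}) (\<lambda>_ _. 1)"
    by (simp add: convex_blocks_def before_def)
  moreover have "(\<lambda>j. lc (\<lambda>_. 1) {Suc j} x) = x \<circ> Suc" by (simp add: lc_def comp_def)
  moreover have "small n (a + 0) (x \<circ> Suc)"
    using small_subseq[OF x(3), of Suc] by (simp add: strict_mono_Suc_iff)
  ultimately show ?case using 0(1)[of "\<lambda>j. {Suc j}" "\<lambda>_ _. 1"] by simp
next
  case (Suc b)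
  obtain H c where H: "convex_blocks b H c" "small n (a + b) (\<lambda>j. lc (c j) (H j) x)"
    using Suc.IH Suc.prems(2) by auto
  note blk = block_convex[OF x(1) H(1)]
  obtain r where r: "strict_mono r" "rapid n (a + b) ((\<lambda>j. lc (c j) (H j) x) \<circ> r)"
    by (rule small_imp_rapid[OF blk H(2)])
  note H' = convex_blocks_subseq[OF H(1) r(1)]
  have eq: "(\<lambda>j. lc (c j) (H j) x) \<circ> r = (\<lambda>j. lc ((c \<circ> r) j) ((H \<circ> r) j) x)" by (simp add: comp_def)
  have "small n (Suc (a + b)) (dyadic_avg (\<lambda>j. lc ((c \<circ> r) j) ((H \<circ> r) j) x))"
    using Suc.prems(2) r(2) unfolding eq
    by (intro small_dyadic_avg block_convex[OF x(1) H'] W_norm_convex[OF x(1,2) H']) simp_all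
  moreover have "dyadic_avg (\<lambda>j. lc ((c \<circ> r) j) ((H \<circ> r) j) x) =
      (\<lambda>j. lc (combined (H \<circ> r) (c \<circ> r) (\<lambda>_. 1 / 2 ^ Suc j) (dyadic j)) (\<Union>i\<in>dyadic j. (H \<circ> r) i) x)"
    unfolding dyadic_avg_def lc_combined[OF H' dyadic_props(1)] ..
  ultimately show ?case
    using Suc.prems(1)[OF convex_blocks_dyadic[OF H']] by simp
qed

lemma c0_estimate_scaled:
  assumes x: "block x" "\<And>i. W_norm n (x i) \<le> 1" "rapid n n x" and n: "1 \<le> n"
    and I: "finite I" "I \<noteq> {}" "card I \<le> Min I" and c: "\<And>i. i \<in> I \<Longrightarrow> \<bar>c i\<bar> \<le> M"
  shows "W_norm n (lc c I x) \<le> M * (1 + 2 * (1/2) ^ card I)"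
proof (rule W_norm_le)
  fix f assume f: "f \<in> W n"
  obtain i where "i \<in> I" using I(2) by blast
  then have M: "0 \<le> M" using c[of i] by simp
  have P: "pairing f (lc a I x) = (\<Sum>i\<in>I. a i * pairing f (x i))" for a
    by (rule pairing_lc[OF I(1) block_c00[OF x(1)]])
  show "pairing f (lc c I x) \<le> M * (1 + 2 * (1/2) ^ card I)"
  proof (cases "M = 0")
    case True
    then show ?thesis using c by (simp add: P)
  next
    case False
    then have M: "0 < M" using M by simp
    have "pairing f (lc c I x) = M * pairing f (lc (\<lambda>i. c i / M) I x)"
      using M by (simp add: P sum_distrib_left)
    also have "\<dots> \<le> M * W_norm n (lc (\<lambda>i. c i / M) I x)"
      using abs_pairing_le_W_norm[OF f] M by (intro mult_left_mono) (auto simp: abs_le_iff)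
    also have "\<dots> \<le> M * (1 + 2 * (1/2) ^ card I)"
      using c M by (intro mult_left_mono c0_estimate[OF x n I]) (simp_all add: abs_divide)
    finally show ?thesis .
  qed
qed

lemma W_norm_lc_ge:
  assumes x: "block x" and I: "finite I" "i \<in> I"
  shows "\<bar>c i\<bar> * W_norm n (x i) \<le> W_norm n (lc c I x)"
proof (cases "c i = 0")
  case True
  then show ?thesis by (simp add: W_norm_nonneg)
next
  case False
  have "W_norm n (x i) \<le> W_norm n (lc c I x) / \<bar>c i\<bar>"
  proof (rule W_norm_le)
    fix f assume f: "f \<in> W n"
    show "pairing f (x i) \<le> W_norm n (lc c I x) / \<bar>c i\<bar>"
    proof (cases "supp f \<inter> supp (x i) = {}")
      case True
      then show ?thesis by (simp add: pairing_disjoint W_norm_nonneg)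
    next
      case meets: False
      let ?g = "rst (supp (x i)) f"
      have g: "?g \<in> W n" by (rule W_rst[OF f meets])
      have "pairing ?g (lc c I x) = (\<Sum>j\<in>I. c j * pairing ?g (x j))"
        by (rule pairing_lc[OF I(1) block_c00[OF x]])
      also have "\<dots> = (\<Sum>j\<in>{i}. c j * pairing ?g (x j))"
      proof (rule sum.mono_neutral_right[OF I(1)])
        show "\<forall>j\<in>I - {i}. c j * pairing ?g (x j) = 0"
        proof
          fix j assume "j \<in> I - {i}"
          then have "supp ?g \<inter> supp (x j) = {}"
            using comparable_disjoint[OF block_comparable[OF x, of i j]] by (auto simp: supp_rst)
          then show "c j * pairing ?g (x j) = 0" by (simp add: pairing_disjoint)
        qed
      qed (use I in auto)
      also have "\<dots> = c i * pairing f (x i)" by (simp add: pairing_rst)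
      finally have "\<bar>c i\<bar> * \<bar>pairing f (x i)\<bar> \<le> W_norm n (lc c I x)"
        using abs_pairing_le_W_norm[OF g, of "lc c I x"] by (simp add: abs_mult)
      then have "\<bar>pairing f (x i)\<bar> \<le> W_norm n (lc c I x) / \<bar>c i\<bar>"
        using False by (simp add: field_simps)
      then show ?thesis by linarith
    qed
  qed
  then show ?thesis using False by (simp add: field_simps)
qed

lemma averaged_ladder:
  assumes z: "block z" "\<And>i. W_norm n (z i) = 1" "rapid n n z" and n: "1 \<le> n"
  shows "\<exists>(G :: nat \<Rightarrow> nat set) \<beta> t. (\<forall>j. finite (G j) \<and> G j \<noteq> {} \<and> before (G j) (G (Suc j))) \<and>
    ladder n (\<lambda>j. lc (\<lambda>_. 1/2) (G j) z) (\<lambda>j. {(\<beta> j, t j)}) \<and>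
    (\<forall>j. 1/4 \<le> \<bar>pairing (\<beta> j) (lc (\<lambda>_. 1/2) (G j) z)\<bar>) \<and>
    (\<forall>j. W_norm n (lc (\<lambda>_. 1/2) (G j) z) \<le> 1)"
proof -
  have "\<exists>g. g \<in> W n \<and> 1/2 < pairing g (z i)" for i
    using W_norm_approx[of "1/2" n "z i"] z(2)[of i] by auto
  then obtain g where g: "\<And>i. g i \<in> W n" "\<And>i. 1/2 < pairing (g i) (z i)" by metis
  define f where "f = (\<lambda>i. rst (supp (z i)) (g i))"
  have meets: "supp (g i) \<inter> supp (z i) \<noteq> {}" for i
    using pairing_disjoint[of "g i" "z i"] g(2)[of i] by auto
  have f: "f i \<in> W n" "supp (f i) \<subseteq> supp (z i)" "1/2 < pairing (f i) (z i)" "supp (f i) \<noteq> {}" for i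
    using W_rst[OF g(1) meets] g(2)[of i] meets[of i] by (simp_all add: f_def supp_rst pairing_rst)
  have comp: "comparable (supp (f i)) (supp (f j))" if "i \<noteq> j" for i j
    by (rule comparable_mono[OF block_comparable[OF z(1) that] f(2) f(2)])
  have inj: "inj f"
  proof (rule injI, rule ccontr)
    fix i j assume ij: "f i = f j" "i \<noteq> j"
    obtain u where "u \<in> supp (f i)" using f(4) by blast
    then show False using comparable_disjoint[OF comp[OF ij(2)], of u] ij(1) by simp
  qed
  define t where "t = rec_nat 2 (\<lambda>_ s. Suc (top_supp z (2 * s)))"
  have t0: "t 0 = 2" and tS: "t (Suc j) = Suc (top_supp z (2 * t j))" for j by (simp_all add: t_def)
  have t_step: "2 * t j < t (Suc j)" for j
    using block_index_less_top[OF z(1), of "2 * t j"] by (simp add: tS)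
  have t2: "2 \<le> t j" for j
  proof (induction j)
    case (Suc j)
    then show ?case using t_step[of j] by simp
  qed (simp add: t0)
  have t_mono: "strict_mono t" unfolding strict_mono_Suc_iff
  proof
    fix j show "t j < t (Suc j)" using t_step[of j] by simp
  qed
  define G where "G = (\<lambda>j. {t j..<2 * t j})"
  have G: "finite (G j)" "card (G j) = t j" "G j \<noteq> {}" "Min (G j) = t j" for j
  proof -
    show "finite (G j)" "card (G j) = t j" by (simp_all add: G_def)
    show ne: "G j \<noteq> {}" using t2[of j] by (simp add: G_def)
    show "Min (G j) = t j" using t2[of j] by (intro Min_eqI) (auto simp: G_def)
  qed
  have Gbef: "before (G j) (G (Suc j))" for j
    using t_step[of j] by (auto simp: G_def before_def)
  define x where "x = (\<lambda>j. lc (\<lambda>_. 1/2) (G j) z)"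
  have x: "block x" unfolding x_def by (rule block_lc[where G = G, OF z(1) G(1,3) Gbef]) simp
  define \<beta> where "\<beta> = (\<lambda>j u. (\<Sum>\<phi>\<in>f ` G j. \<phi> u) / real (t j))"
  have \<beta>: "avg_in (W n) (\<beta> j) (t j)" for j
    unfolding avg_in_def
  proof (intro conjI exI[of _ "f ` G j"])
    show "pairwise (\<lambda>f g. comparable (supp f) (supp g)) (f ` G j)"
      unfolding pairwise_def
    proof (intro ballI impI)
      fix a b assume "a \<in> f ` G j" "b \<in> f ` G j" "a \<noteq> b"
      then obtain i i' where "a = f i" "b = f i'" "i \<noteq> i'" by blast
      then show "comparable (supp a) (supp b)" using comp by simp
    qed
    show "card (f ` G j) \<le> t j" using card_image_le[OF G(1), of f j] G(2) by simp
  qed (use G t2 f(1) in \<open>auto simp: \<beta>_def\<close>)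
  have \<beta>_eq: "\<beta> j = (\<lambda>u. (\<Sum>i\<in>G j. f i u) / t j)" for j
    unfolding \<beta>_def using inj_on_subset[OF inj, of "G j"] by (simp add: sum.reindex)
  have supp_\<beta>: "\<exists>i\<in>G j. u \<in> supp (z i)" if "u \<in> supp (\<beta> j)" for u j
  proof -
    have "(\<Sum>i\<in>G j. f i u) \<noteq> 0" using that by (auto simp: supp_def \<beta>_eq)
    then obtain i where "i \<in> G j" "f i u \<noteq> 0" by (rule sum.not_neutral_contains_not_neutral)
    then show ?thesis using f(2)[of i] by (auto simp: supp_def)
  qed
  have supp_x: "supp (x j) = (\<Union>i\<in>G j. supp (z i))" for j
    unfolding x_def by (rule supp_lc_block[OF z(1) G(1)]) simp
  have sub: "supp (\<beta> j) \<subseteq> supp (x j)" for j unfolding supp_x using supp_\<beta> by blast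
  have ladder: "ladder n x (\<lambda>j. {(\<beta> j, t j)})"
    unfolding ladder_def
  proof (intro conjI allI impI x)
    show "family n {(\<beta> i, t i)}" for i using \<beta> by (simp add: family_def)
    show "\<forall>a\<in>{(\<beta> i, t i)}. supp (fst a) \<subseteq> supp (x i)" for i using sub by simp
    fix i j :: nat assume ij: "i < j"
    have "t (Suc i) \<le> t j" using ij t_mono by (simp add: strict_mono_less_eq)
    moreover have "u < t (Suc i)" if u: "u \<in> supp (\<beta> i)" for u
    proof -
      obtain l where l: "l \<in> G i" "u \<in> supp (z l)" using supp_\<beta>[OF u] by blast
      have "u \<le> top_supp z l" using l(2) block_supp[OF z(1)] by simp
      also have "\<dots> \<le> top_supp z (2 * t i)" using l(1) by (intro block_top_mono[OF z(1)]) (simp add: G_def)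
      finally show ?thesis by (simp add: tS)
    qed
    moreover have "before (supp (\<beta> i)) (supp (\<beta> j))" by (rule before_mono[OF block_before[OF x ij] sub sub])
    moreover have "t i < t j" using ij t_mono by (simp add: strict_mono_less)
    ultimately have "prec (\<beta> i, t i) (\<beta> j, t j)" unfolding prec_def by fastforce
    then show "\<forall>a\<in>{(\<beta> i, t i)}. \<forall>b\<in>{(\<beta> j, t j)}. prec a b" by simp
  qed
  have lower: "1/4 \<le> \<bar>pairing (\<beta> j) (x j)\<bar>" for j
  proof -
    have P: "pairing (f i) (x j) = 1/2 * pairing (f i) (z i)" if "i \<in> G j" for i
    proof -
      have "pairing (f i) (x j) = (\<Sum>l\<in>G j. 1/2 * pairing (f i) (z l))"
        unfolding x_def by (rule pairing_lc[OF G(1) block_c00[OF z(1)]])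
      also have "\<dots> = (\<Sum>l\<in>{i}. 1/2 * pairing (f i) (z l))"
      proof (rule sum.mono_neutral_right[OF G(1)])
        show "\<forall>l\<in>G j - {i}. 1/2 * pairing (f i) (z l) = 0"
        proof
          fix l assume "l \<in> G j - {i}"
          then have "supp (f i) \<inter> supp (z l) = {}"
            using comparable_disjoint[OF block_comparable[OF z(1), of i l]] f(2)[of i] by blast
          then show "1/2 * pairing (f i) (z l) = 0" by (simp add: pairing_disjoint)
        qed
      qed (use that in auto)
      finally show ?thesis by simp
    qed
    have "pairing (\<beta> j) (x j) = (\<Sum>i\<in>G j. 1/2 * pairing (f i) (z i)) / t j"
      unfolding \<beta>_eq pairing_divide_left pairing_sum_left by (simp add: P)
    also have "\<dots> \<ge> (\<Sum>i\<in>G j. 1/4) / t j"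
      using f(3) by (intro divide_right_mono sum_mono) (simp_all add: less_imp_le)
    also have "(\<Sum>i\<in>G j. 1/4) / t j = (1/4 :: real)" using t2[of j] by (simp add: G(2))
    finally show ?thesis by simp
  qed
  have norm: "W_norm n (x j) \<le> 1" for j
  proof -
    have "W_norm n (x j) \<le> 1/2 * (1 + 2 * (1/2) ^ card (G j))"
      unfolding x_def using G n z(2) by (intro c0_estimate_scaled[OF z(1) _ z(3)]) simp_all
    also have "(1/2 :: real) ^ card (G j) \<le> (1/2) ^ 2"
      using t2 unfolding G(2) by (intro power_decreasing) simp_all
    finally show ?thesis by (simp add: power2_eq_square)
  qed
  show ?thesis
    by (intro exI[of _ G] exI[of _ \<beta>] exI[of _ t] conjI allI G(1,3) Gbef
        ladder[unfolded x_def] lower[unfolded x_def] norm[unfolded x_def])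
qed

lemma ladder_l1_lower:
  assumes L: "ladder n x (\<lambda>j. {(\<beta> j, s j)})" "\<And>j. 1/4 \<le> \<bar>pairing (\<beta> j) (x j)\<bar>" and D: "D \<in> schreier n"
  shows "1/4 * (\<Sum>i\<in>D. \<bar>c i\<bar>) \<le> W_norm n (lc c D x)"
proof -
  have x: "block x" using L(1) by (simp add: ladder_def)
  have fin: "finite D" using schreier_basic[OF D] by simp
  have b: "finite (supp (\<beta> i))" "supp (\<beta> i) \<noteq> {}" "supp (\<beta> i) \<subseteq> supp (x i)" for i
    using L(1) family_fin[of n "{(\<beta> i, s i)}" "(\<beta> i, s i)"] by (auto simp: ladder_def)
  have "mins (\<Union>i\<in>D. {(\<beta> i, s i)}) = (\<lambda>i. Min (supp (\<beta> i))) ` D"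
    by (simp add: mins_def UNION_singleton_eq_range image_image)
  also have "\<dots> \<in> schreier n"
  proof (rule schreier_spreading[OF D])
    show "i \<le> Min (supp (\<beta> i))" for i
    proof -
      have "Min (supp (\<beta> i)) \<in> supp (x i)" using b(3)[of i] Min_in[OF b(1,2), of i] by blast
      then show ?thesis using block_index_less[OF x] by (simp add: less_imp_le)
    qed
    show "Min (supp (\<beta> i)) < Min (supp (\<beta> j))" if "i < j" for i j
      using b by (intro before_Min_less before_mono[OF block_before[OF x that]]) simp_all
  qed
  finally have "(\<Sum>i\<in>D. \<bar>c i\<bar> * mass {(\<beta> i, s i)} (x i)) \<le> W_norm n (lc c D x)"
    by (rule ladder_lower[OF L(1) fin])
  moreover have "(\<Sum>i\<in>D. \<bar>c i\<bar> * (1/4)) \<le> (\<Sum>i\<in>D. \<bar>c i\<bar> * mass {(\<beta> i, s i)} (x i))"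
    using L(2) by (intro sum_mono mult_left_mono) simp_all
  ultimately show ?thesis by (simp add: sum_distrib_left)
qed

subsection \<open>Block sequences near a subspace of the completion\<close>

lemma infinite_dimensional_kernel:
  fixes Z :: "'a::real_vector set"
  assumes "subspace Z" "infinite_dimensional Z"
    "\<And>u v. u \<in> Z \<Longrightarrow> v \<in> Z \<Longrightarrow> \<phi> (u + v) = \<phi> u + (\<phi> v :: real)"
    "\<And>c u. u \<in> Z \<Longrightarrow> \<phi> (c *\<^sub>R u) = c * \<phi> u"
  shows "subspace {z \<in> Z. \<phi> z = 0} \<and> infinite_dimensional {z \<in> Z. \<phi> z = 0}"
proof
  let ?K = "{z \<in> Z. \<phi> z = 0}"
  have "\<phi> 0 = 0" using assms(4)[of 0 0] subspace_0[OF assms(1)] by simp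
  then show K: "subspace ?K"
    using assms(1,3,4) unfolding subspace_def by auto
  show "infinite_dimensional ?K"
    unfolding infinite_dimensional_def
  proof
    assume "\<exists>B. finite B \<and> span B = span ?K"
    then obtain B where B: "finite B" "span B = ?K" using K by (auto simp: span_eq_iff[THEN iffD2])
    show False
    proof (cases "?K = Z")
      case True
      then show False using B assms(1,2) unfolding infinite_dimensional_def
        by (metis span_eq_iff)
    next
      case False
      then obtain y where y: "y \<in> Z" "\<phi> y \<noteq> 0" by blast
      have "span (insert y B) = Z"
      proof
        have "B \<subseteq> Z" using B(2) span_superset[of B] by blast
        then show "span (insert y B) \<subseteq> Z" using y(1) assms(1) by (intro span_minimal) auto
        show "Z \<subseteq> span (insert y B)"
        proof
          fix v assume v: "v \<in> Z"
          define w where "w = v + (- \<phi> v / \<phi> y) *\<^sub>R y"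
          have yZ: "(- \<phi> v / \<phi> y) *\<^sub>R y \<in> Z" by (rule subspace_scale[OF assms(1) y(1)])
          have "w \<in> Z" unfolding w_def by (rule subspace_add[OF assms(1) v yZ])
          moreover have "\<phi> w = 0" unfolding w_def assms(3)[OF v yZ] assms(4)[OF y(1)] using y(2) by simp
          ultimately have "w \<in> span (insert y B)" using B(2) span_mono[of B "insert y B"] by blast
          moreover have "(\<phi> v / \<phi> y) *\<^sub>R y \<in> span (insert y B)"
            by (intro span_scale span_base) simp
          ultimately have "w + (\<phi> v / \<phi> y) *\<^sub>R y \<in> span (insert y B)" by (rule span_add)
          then show "v \<in> span (insert y B)" by (simp add: w_def)
        qed
      qed
      then have "finite (insert y B) \<and> span (insert y B) = span Z"
        using B(1) assms(1) by (simp add: span_eq_iff[THEN iffD2])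
      then show False using assms(2) unfolding infinite_dimensional_def by blast
    qed
  qed
qed

lemma infinite_dimensional_nonzero:
  assumes "infinite_dimensional Z"
  obtains z where "z \<in> Z" "z \<noteq> 0"
proof (rule ccontr)
  assume "\<not> thesis"
  then have "Z \<subseteq> {0}" using that by blast
  then have "span Z = span {}" by (metis span_0 span_empty span_insert_0 subset_singletonD)
  then show False using assms unfolding infinite_dimensional_def by (metis finite.emptyI)
qed

lemma c00_combine: "u \<in> c00 \<Longrightarrow> v \<in> c00 \<Longrightarrow> (\<lambda>i. a * u i + b * v i) \<in> c00"
proof -
  assume uv: "u \<in> c00" "v \<in> c00"
  have "supp (\<lambda>i. a * u i + b * v i) \<subseteq> supp u \<union> supp v" by (auto simp: supp_def)
  then show ?thesis using uv by (auto simp: c00_def intro: finite_subset)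
qed

lemma abs_coordinate_le:
  assumes "u \<in> c00"
  shows "\<bar>u i\<bar> \<le> W_norm n u"
proof (cases "i = 0")
  case True
  then show ?thesis using assms W_norm_nonneg by (simp add: c00_def)
next
  case False
  have "pairing (unit_vec i) u = u i"
  proof -
    have "pairing (unit_vec i) u = (\<Sum>j\<in>insert i (supp u). unit_vec i j * u j)"
      using assms by (intro pairing_eq) (auto simp: c00_def)
    also have "\<dots> = (\<Sum>j\<in>{i}. unit_vec i j * u j)"
      using assms by (intro sum.mono_neutral_right) (auto simp: c00_def unit_vec_def)
    finally show ?thesis by (simp add: unit_vec_def)
  qed
  moreover have "\<bar>pairing (unit_vec i) u\<bar> \<le> W_norm n u"
    by (rule abs_pairing_le_W_norm[OF unit_vec_W]) (use False in simp)
  ultimately show ?thesis by simp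
qed

locale W_completion =
  fixes n :: nat and J :: "(nat \<Rightarrow> real) \<Rightarrow> 'a::banach" and X :: "'a set"
  assumes completion: "is_completion c00 (W_norm n) J X"
begin

lemma J_add: "u \<in> c00 \<Longrightarrow> v \<in> c00 \<Longrightarrow> J (\<lambda>i. u i + v i) = J u + J v"
  and J_scale: "u \<in> c00 \<Longrightarrow> J (\<lambda>i. c * u i) = c *\<^sub>R J u"
  and norm_J: "u \<in> c00 \<Longrightarrow> norm (J u) = W_norm n u"
  and X_eq: "X = closure (J ` c00)"
  using completion unfolding is_completion_def by blast+

lemma J_combine:
  assumes "u \<in> c00" "v \<in> c00"
  shows "J (\<lambda>i. a * u i + b * v i) = a *\<^sub>R J u + b *\<^sub>R J v"
proof -
  have "(\<lambda>i. a * u i) \<in> c00" "(\<lambda>i. b * v i) \<in> c00"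
    using c00_combine[OF assms(1,1), of a 0] c00_combine[OF assms(2,2), of b 0] by simp_all
  then show ?thesis using J_add[of "\<lambda>i. a * u i" "\<lambda>i. b * v i"] J_scale assms by simp
qed

lemma J_diff: "u \<in> c00 \<Longrightarrow> v \<in> c00 \<Longrightarrow> J u - J v = J (\<lambda>i. u i - v i)"
  using J_combine[of u v 1 "-1"] by simp

lemma J_lc:
  assumes "finite I" "\<And>i. i \<in> I \<Longrightarrow> x i \<in> c00"
  shows "J (lc c I x) = (\<Sum>i\<in>I. c i *\<^sub>R J (x i))"
  using assms
proof (induction I rule: finite_induct)
  case empty
  have z: "(\<lambda>_. 0) \<in> c00" by (simp add: c00_def supp_def)
  have "J (\<lambda>_. 0) = 0" using J_scale[OF z, of 0] by simp
  then show ?case by (simp add: lc_def)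
next
  case (insert i I)
  have c: "lc c I x \<in> c00" using insert by (intro lc_c00) simp_all
  have "lc c (insert i I) x = (\<lambda>t. c i * x i t + 1 * lc c I x t)" using insert(1,2) by (simp add: lc_def)
  then show ?case using J_combine[of "x i" "lc c I x" "c i" 1] c insert by simp
qed

lemma coordinate_dist: "u \<in> c00 \<Longrightarrow> v \<in> c00 \<Longrightarrow> \<bar>u i - v i\<bar> \<le> norm (J u - J v)"
  using abs_coordinate_le[of "\<lambda>i. u i - v i" i n] c00_combine[of u v 1 "-1"] J_diff[of u v]
    norm_J[of "\<lambda>i. u i - v i"] by simp

text \<open>The \<open>1\<close>-Lipschitz extension of the coordinate functional.\<close>

definition coordinate :: "nat \<Rightarrow> 'a \<Rightarrow> real"
  where "coordinate i y = (SUP v\<in>c00. v i - norm (y - J v))"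

lemma coordinate_approx:
  assumes "v \<in> c00"
  shows "\<bar>coordinate i y - v i\<bar> \<le> norm (y - J v)"
proof -
  have le: "u i - norm (y - J u) \<le> w i + norm (y - J w)" if "u \<in> c00" "w \<in> c00" for u w
  proof -
    have "norm (J u - J w) \<le> norm (y - J u) + norm (y - J w)"
      using norm_triangle_ineq4[of "y - J w" "y - J u"] by (simp add: algebra_simps)
    then show ?thesis using coordinate_dist[OF that, of i] by linarith
  qed
  have "v i - norm (y - J v) \<le> coordinate i y"
    unfolding coordinate_def
    by (rule cSUP_upper[OF assms bdd_aboveI2]) (rule le[OF _ assms])
  moreover have "coordinate i y \<le> v i + norm (y - J v)"
    unfolding coordinate_def by (rule cSUP_least) (use assms le in auto)
  ultimately show ?thesis by linarith
qed

lemma X_approx: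
  assumes "y \<in> X" "0 < e"
  obtains v where "v \<in> c00" "norm (y - J v) < e"
  using assms unfolding X_eq closure_approachable by (auto simp: dist_norm norm_minus_commute)

lemma coordinate_add:
  assumes "y \<in> X" "y' \<in> X"
  shows "coordinate i (y + y') = coordinate i y + coordinate i y'"
proof -
  have "\<bar>coordinate i (y + y') - (coordinate i y + coordinate i y')\<bar> \<le> e" if e: "0 < e" for e
  proof -
    have e4: "0 < e / 4" using e by simp
    obtain v where v: "v \<in> c00" "norm (y - J v) < e / 4" by (rule X_approx[OF assms(1) e4])
    obtain v' where v': "v' \<in> c00" "norm (y' - J v') < e / 4" by (rule X_approx[OF assms(2) e4])
    have s: "(\<lambda>i. v i + v' i) \<in> c00" using c00_combine[OF v(1) v'(1), of 1 1] by simp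
    have "norm (y + y' - J (\<lambda>i. v i + v' i)) \<le> norm (y - J v) + norm (y' - J v')"
      unfolding J_add[OF v(1) v'(1)]
      using norm_triangle_ineq[of "y - J v" "y' - J v'"] by (simp add: algebra_simps)
    then show ?thesis
      using coordinate_approx[OF s, of i "y + y'"] coordinate_approx[OF v(1), of i y]
        coordinate_approx[OF v'(1), of i y'] v(2) v'(2) by linarith
  qed
  then have "\<bar>coordinate i (y + y') - (coordinate i y + coordinate i y')\<bar> \<le> 0"
    by (rule field_le_epsilon[of _ 0, simplified])
  then show ?thesis by simp
qed

lemma coordinate_scale:
  assumes "y \<in> X"
  shows "coordinate i (c *\<^sub>R y) = c * coordinate i y"
proof -
  have "\<bar>coordinate i (c *\<^sub>R y) - c * coordinate i y\<bar> \<le> e" if e: "0 < e" for e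
  proof -
    have e4: "0 < e / (2 * (\<bar>c\<bar> + 1))" using e by simp
    obtain v where v: "v \<in> c00" "norm (y - J v) < e / (2 * (\<bar>c\<bar> + 1))" by (rule X_approx[OF assms e4])
    have s: "(\<lambda>i. c * v i) \<in> c00" using c00_combine[OF v(1,1), of c 0] by simp
    have "norm (c *\<^sub>R y - J (\<lambda>i. c * v i)) = \<bar>c\<bar> * norm (y - J v)"
      unfolding J_scale[OF v(1)] by (metis norm_scaleR scaleR_diff_right)
    then have 1: "\<bar>coordinate i (c *\<^sub>R y) - c * v i\<bar> \<le> \<bar>c\<bar> * norm (y - J v)"
      using coordinate_approx[OF s, of i "c *\<^sub>R y"] by simp
    have "\<bar>c * (coordinate i y - v i)\<bar> \<le> \<bar>c\<bar> * norm (y - J v)"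
      unfolding abs_mult using coordinate_approx[OF v(1), of i y] by (intro mult_left_mono) simp_all
    then have 2: "\<bar>c * coordinate i y - c * v i\<bar> \<le> \<bar>c\<bar> * norm (y - J v)" by (simp add: right_diff_distrib)
    have "\<bar>c\<bar> * norm (y - J v) \<le> (\<bar>c\<bar> + 1) * (e / (2 * (\<bar>c\<bar> + 1)))"
      using v(2) by (intro mult_mono) simp_all
    also have "\<dots> = e / 2"
    proof -
      have "d * (e / (2 * d)) = e / 2" if "d \<noteq> 0" for d :: real using that by simp
      moreover have "\<bar>c\<bar> + 1 \<noteq> 0" using abs_ge_zero[of c] by linarith
      ultimately show ?thesis .
    qed
    finally show ?thesis using 1 2 by linarith
  qed
  then have "\<bar>coordinate i (c *\<^sub>R y) - c * coordinate i y\<bar> \<le> 0"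
    by (rule field_le_epsilon[of _ 0, simplified])
  then show ?thesis by simp
qed

lemma subspace_tail:
  assumes "subspace Y" "Y \<subseteq> X" "infinite_dimensional Y"
  shows "\<exists>K\<subseteq>Y. subspace K \<and> infinite_dimensional K \<and> (\<forall>y\<in>K. \<forall>i<N. coordinate i y = 0)"
proof (induction N)
  case 0
  show ?case using assms by (intro exI[of _ Y]) simp
next
  case (Suc N)
  then obtain K where K: "K \<subseteq> Y" "subspace K" "infinite_dimensional K" "\<forall>y\<in>K. \<forall>i<N. coordinate i y = 0"
    by blast
  have KX: "u \<in> X" if "u \<in> K" for u using that K(1) assms(2) by blast
  have "subspace {z \<in> K. coordinate N z = 0} \<and> infinite_dimensional {z \<in> K. coordinate N z = 0}"
    by (rule infinite_dimensional_kernel[OF K(2,3)]) (simp_all add: KX coordinate_add coordinate_scale)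
  then show ?case using K(1,4)
    by (intro exI[of _ "{z \<in> K. coordinate N z = 0}"]) (auto simp: less_Suc_eq)
qed

lemma W_norm_le_sum:
  "W_norm n x \<le> (\<Sum>i\<in>supp x. \<bar>x i\<bar>)"
  using abs_pairing_le[of _ n x] by (intro W_norm_le) (simp add: abs_le_iff)

lemma hump:
  assumes Y: "subspace Y" "Y \<subseteq> X" "infinite_dimensional Y" and e: "0 < e"
  obtains y u where "y \<in> Y" "norm y = 1/2" "u \<in> c00" "\<And>i. i < N \<Longrightarrow> u i = 0" "norm (y - J u) \<le> e"
proof -
  obtain K where K: "K \<subseteq> Y" "subspace K" "infinite_dimensional K" "\<forall>y\<in>K. \<forall>i<N. coordinate i y = 0"
    using subspace_tail[OF Y, of N] by blast
  obtain z where z: "z \<in> K" "z \<noteq> 0" by (rule infinite_dimensional_nonzero[OF K(3)])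
  define y where "y = (1 / (2 * norm z)) *\<^sub>R z"
  have yK: "y \<in> K" unfolding y_def by (rule subspace_scale[OF K(2) z(1)])
  have ny: "norm y = 1/2" using z(2) by (simp add: y_def)
  define \<eta> where "\<eta> = e / real (Suc N)"
  have \<eta>: "0 < \<eta>" using e by (simp add: \<eta>_def)
  have "y \<in> X" using yK K(1) Y(2) by blast
  then obtain v where v: "v \<in> c00" "norm (y - J v) < \<eta>" by (rule X_approx[OF _ \<eta>])
  define w where "w = (\<lambda>i. if i < N then v i else 0)"
  define u where "u = (\<lambda>i. if i < N then 0 else v i)"
  have "supp w \<subseteq> supp v" "supp u \<subseteq> supp v" by (auto simp: w_def u_def supp_def)
  moreover have "finite (supp v)" "w 0 = 0" "u 0 = 0" using v(1) by (simp_all add: c00_def w_def u_def)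
  ultimately have c: "w \<in> c00" "u \<in> c00" using finite_subset by (simp_all add: c00_def) blast+
  have small: "\<bar>v i\<bar> \<le> \<eta>" if "i < N" for i
    using coordinate_approx[OF v(1), of i y] K(4) yK that v(2) by simp
  have "norm (J w) \<le> N * \<eta>"
  proof -
    have "norm (J w) \<le> (\<Sum>i\<in>supp w. \<bar>w i\<bar>)" unfolding norm_J[OF c(1)] by (rule W_norm_le_sum)
    also have "\<dots> \<le> (\<Sum>i\<in>{..<N}. \<bar>w i\<bar>)" by (intro sum_mono2) (auto simp: supp_def w_def)
    also have "\<dots> \<le> (\<Sum>i\<in>{..<N}. \<eta>)" using small by (intro sum_mono) (simp add: w_def)
    finally show ?thesis by simp
  qed
  moreover have "norm (y - J u) \<le> norm (y - J v) + norm (J w)"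
  proof -
    have "(\<lambda>i. v i - u i) = w" by (auto simp: u_def w_def)
    then have eq: "y - J u = (y - J v) + J w" using J_diff[OF v(1) c(2)] by (simp add: algebra_simps)
    show ?thesis unfolding eq by (rule norm_triangle_ineq)
  qed
  ultimately have "norm (y - J u) \<le> \<eta> + N * \<eta>" using v(2) by linarith
  also have "\<dots> = real (Suc N) * \<eta>" by (simp add: distrib_right)
  also have "\<dots> = e" unfolding \<eta>_def by (simp del: of_nat_Suc)
  finally show ?thesis using that[of y u] yK K(1) ny c(2) by (auto simp: u_def)
qed

definition near :: "'a set \<Rightarrow> (nat \<Rightarrow> nat \<Rightarrow> real) \<Rightarrow> bool"
  where "near Y z \<longleftrightarrow> (\<exists>w. range w \<subseteq> Y \<and> summable (\<lambda>j. norm (w j - J (z j))))"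

lemma near_lc:
  assumes Y: "subspace Y" and z: "block z" "near Y z"
    and H: "\<And>j. finite (H j)" "\<And>i j. i \<noteq> j \<Longrightarrow> H i \<inter> H j = {}"
    and c: "\<And>j i. i \<in> H j \<Longrightarrow> \<bar>c j i\<bar> \<le> K" "0 \<le> K"
  shows "near Y (\<lambda>j. lc (c j) (H j) z)"
proof -
  obtain w where w: "range w \<subseteq> Y" "summable (\<lambda>j. norm (w j - J (z j)))"
    using z(2) by (auto simp: near_def)
  define e where "e = (\<lambda>j. norm (w j - J (z j)))"
  define w' where "w' = (\<lambda>j. \<Sum>i\<in>H j. c j i *\<^sub>R w i)"
  have err: "norm (w' j - J (lc (c j) (H j) z)) \<le> K * (\<Sum>i\<in>H j. e i)" for j
  proof -
    have "w' j - J (lc (c j) (H j) z) = (\<Sum>i\<in>H j. c j i *\<^sub>R (w i - J (z i)))"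
      unfolding w'_def J_lc[OF H(1) block_c00[OF z(1)]]
      by (simp add: scaleR_diff_right sum_subtractf)
    also have "norm \<dots> \<le> (\<Sum>i\<in>H j. K * e i)"
      using c by (intro order.trans[OF norm_sum] sum_mono) (simp add: e_def mult_right_mono)
    finally show ?thesis by (simp add: sum_distrib_left)
  qed
  have "range w' \<subseteq> Y"
    using w(1) unfolding w'_def by (auto intro!: subspace_sum[OF Y] subspace_scale[OF Y])
  moreover have "summable (\<lambda>j. norm (w' j - J (lc (c j) (H j) z)))"
  proof (rule summableI_nonneg_bounded)
    fix m :: nat
    have "(\<Sum>j<m. norm (w' j - J (lc (c j) (H j) z))) \<le> (\<Sum>j<m. K * (\<Sum>i\<in>H j. e i))"
      by (intro sum_mono err)
    also have "\<dots> = K * (\<Sum>i\<in>(\<Union>j<m. H j). e i)"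
      using H by (subst sum.UNION_disjoint) (auto simp: sum_distrib_left)
    also have "\<dots> \<le> K * suminf e"
      using w(2) H(1) c(2) by (intro mult_left_mono sum_le_suminf) (simp_all add: e_def)
    finally show "(\<Sum>j<m. norm (w' j - J (lc (c j) (H j) z))) \<le> K * suminf e" .
  qed simp
  ultimately show ?thesis unfolding near_def by blast
qed

lemma near_subseq:
  assumes "near Y z" "strict_mono r"
  shows "near Y (z \<circ> r)"
proof -
  obtain w where w: "range w \<subseteq> Y" "summable (\<lambda>j. norm (w j - J (z j)))"
    using assms(1) by (auto simp: near_def)
  have "summable ((\<lambda>j. norm (w j - J (z j))) \<circ> r)"
    by (rule summable_reindex[OF w(2)]) (use strict_mono_imp_inj_on[OF assms(2)] in auto)
  then show ?thesis unfolding near_def using w(1) by (intro exI[of _ "w \<circ> r"]) (auto simp: comp_def)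
qed

end

lemma sum_le_tail:
  fixes f :: "nat \<Rightarrow> real"
  assumes "summable f" "\<And>i. 0 \<le> f i" "finite A" "A \<subseteq> {m..}"
  shows "sum f A \<le> (\<Sum>i. f (i + m))"
proof -
  have "sum f A + sum f {..<m} = sum f (A \<union> {..<m})"
    using assms(3,4) by (intro sum.union_disjoint[symmetric]) auto
  also have "\<dots> \<le> suminf f" using assms by (intro sum_le_suminf) simp_all
  finally show ?thesis using suminf_minus_initial_segment[OF assms(1), of m] by simp
qed

lemma c0_spreading_model_weakly_null:
  assumes "subspace Y" "range x \<subseteq> Y" "isometric_c0_spreading_model x"
  shows "weakly_null_in Y x"
  unfolding weakly_null_in_def
proof (intro conjI allI impI)
  show "range x \<subseteq> Y" by (rule assms(2))
  fix \<phi> :: "'a \<Rightarrow> real"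
  assume "(\<forall>u\<in>Y. \<forall>v\<in>Y. \<phi> (u + v) = \<phi> u + \<phi> v) \<and> (\<forall>c. \<forall>u\<in>Y. \<phi> (c *\<^sub>R u) = c * \<phi> u) \<and>
    (\<exists>K. \<forall>u\<in>Y. \<bar>\<phi> u\<bar> \<le> K * norm u)"
  then obtain K where add: "\<And>u v. u \<in> Y \<Longrightarrow> v \<in> Y \<Longrightarrow> \<phi> (u + v) = \<phi> u + \<phi> v"
    and scale: "\<And>c u. u \<in> Y \<Longrightarrow> \<phi> (c *\<^sub>R u) = c * \<phi> u" and K: "\<And>u. u \<in> Y \<Longrightarrow> \<bar>\<phi> u\<bar> \<le> K * norm u"
    by blast
  have xY: "x i \<in> Y" for i using assms(2) by blast
  have sum: "(\<Sum>j\<in>A. a j *\<^sub>R x (i j)) \<in> Y \<and> \<phi> (\<Sum>j\<in>A. a j *\<^sub>R x (i j)) = (\<Sum>j\<in>A. a j * \<phi> (x (i j)))"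
    if "finite A" for A :: "nat set" and a i
    using that
  proof (induction A rule: finite_induct)
    case empty
    show ?case using subspace_0[OF assms(1)] scale[of 0 0] by simp
  next
    case (insert j A)
    then show ?case
      using subspace_add[OF assms(1) subspace_scale[OF assms(1) xY[of "i j"]]] add scale[OF xY]
        subspace_scale[OF assms(1) xY[of "i j"]] by simp
  qed
  obtain \<delta> :: "nat \<Rightarrow> real" where \<delta>: "decseq \<delta>"
    and est: "\<forall>m\<ge>1. \<forall>(i :: nat \<Rightarrow> nat) (a :: nat \<Rightarrow> real).
      m \<le> i 1 \<and> strict_mono_on {1..m} i \<and> (\<forall>j\<in>{1..m}. a j \<in> {-1..1}) \<longrightarrow>
      \<bar>norm (\<Sum>j=1..m. a j *\<^sub>R x (i j)) - Max ((\<lambda>j. \<bar>a j\<bar>) ` {1..m})\<bar> < \<delta> m"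
    using assms(3) unfolding isometric_c0_spreading_model_def by (elim exE conjE) (rule that)
  show "(\<lambda>i. \<phi> (x i)) \<longlonglongrightarrow> 0"
  proof (rule ccontr)
    assume "\<not> ?thesis"
    then obtain e where e: "0 < e" "\<And>N. \<exists>i\<ge>N. e \<le> \<bar>\<phi> (x i)\<bar>"
      unfolding LIMSEQ_def dist_real_def not_all not_ex not_imp not_less by (metis diff_zero)
    define B where "B = max K 0 * (1 + \<delta> 1)"
    obtain m0 :: nat where m0: "B / e < m0" using reals_Archimedean2 by blast
    define m where "m = Suc m0"
    have Bm: "B < e * m"
    proof -
      have "B < e * m0" using m0 e(1) by (simp add: field_simps)
      also have "\<dots> \<le> e * m" using e(1) by (simp add: m_def)
      finally show ?thesis .
    qed
    define S where "S = {i. m \<le> i \<and> e \<le> \<bar>\<phi> (x i)\<bar>}"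
    have inf: "infinite S" unfolding infinite_nat_iff_unbounded_le
    proof
      fix N
      obtain i where "max m N \<le> i" "e \<le> \<bar>\<phi> (x i)\<bar>" using e(2) by blast
      then show "\<exists>i\<ge>N. i \<in> S" by (intro exI[of _ i]) (simp add: S_def)
    qed
    define i where "i = (\<lambda>j. enumerate S (j - 1))"
    have iS: "i j \<in> S" for j unfolding i_def using inf by (rule enumerate_in_set)
    define a where "a = (\<lambda>j. sgn (\<phi> (x (i j))))"
    have a1: "a j \<in> {-1..1}" for j by (simp add: a_def sgn_if)
    have mono: "strict_mono_on {1..m} i"
      unfolding strict_mono_on_def i_def using enumerate_mono[OF _ inf] by auto
    let ?v = "\<Sum>j=1..m. a j *\<^sub>R x (i j)"
    have "m \<le> i 1" using iS[of 1] by (simp add: S_def)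
    then have "\<bar>norm ?v - Max ((\<lambda>j. \<bar>a j\<bar>) ` {1..m})\<bar> < \<delta> m"
      using est[rule_format, of m i a] mono a1 by (simp add: m_def)
    moreover have "Max ((\<lambda>j. \<bar>a j\<bar>) ` {1..m}) \<le> 1"
      using a1 by (subst Max_le_iff) (auto simp: m_def abs_le_iff)
    moreover have "\<delta> m \<le> \<delta> 1" using \<delta> by (rule decseqD) (simp add: m_def)
    ultimately have v: "norm ?v \<le> 1 + \<delta> 1" by linarith
    have "e * m = (\<Sum>j=1..m. e)" by simp
    also have "\<dots> \<le> (\<Sum>j=1..m. a j * \<phi> (x (i j)))"
    proof (rule sum_mono)
      fix j
      have "a j * \<phi> (x (i j)) = \<bar>\<phi> (x (i j))\<bar>" by (simp add: a_def sgn_mult_self_eq abs_sgn mult.commute)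
      then show "e \<le> a j * \<phi> (x (i j))" using iS[of j] by (simp add: S_def)
    qed
    also have "\<dots> = \<phi> ?v" using sum[of "{1..m}" a i] by simp
    also have "\<dots> \<le> K * norm ?v" using K[of ?v] sum[of "{1..m}" a i] by simp
    also have "\<dots> \<le> max K 0 * (1 + \<delta> 1)"
      using v by (intro mult_mono) simp_all
    finally show False using Bm by (simp add: B_def)
  qed
qed

lemma dyadic_disjoint: "i \<noteq> j \<Longrightarrow> dyadic i \<inter> dyadic j = {}"
  using sets_before[of dyadic i j, OF dyadic_props(2,5)] sets_before[of dyadic j i, OF dyadic_props(2,5)]
  unfolding before_def by (metis disjoint_iff less_irrefl linorder_neqE_nat)

context W_completion
begin

lemma near_dyadic_avg:
  assumes "subspace Y" "block z" "near Y z"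
  shows "near Y (dyadic_avg z)"
  unfolding dyadic_avg_def
proof (rule near_lc[OF assms dyadic_props(1) dyadic_disjoint, where K = 1])
  show "\<bar>1 / 2 ^ Suc j :: real\<bar> \<le> 1" for j
    using one_le_power[of "2 :: real" "Suc j"] by (simp del: power_Suc)
qed simp_all

lemma near_convex:
  assumes "subspace Y" "block z" "near Y z" "convex_blocks b H c"
  shows "near Y (\<lambda>j. lc (c j) (H j) z)"
proof (rule near_lc[OF assms(1-3), where K = 1])
  note H = convex_blocks_props[OF assms(4)]
  show "finite (H j)" for j by (rule H)
  show "H i \<inter> H j = {}" if "i \<noteq> j" for i j by (rule H(4)[OF that])
  show "\<bar>c j i\<bar> \<le> 1" if "i \<in> H j" for j i
  proof -
    have c: "0 < c j l" if "l \<in> H j" for l using assms(4) that by (simp add: convex_blocks_def)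
    have "c j i \<le> (\<Sum>l\<in>H j. c j l)"
      by (rule member_le_sum[OF that _ H(1)]) (use c in \<open>simp add: less_imp_le\<close>)
    also have "\<dots> = 1" using assms(4) by (simp add: convex_blocks_def)
    finally show ?thesis using c[OF that] by simp
  qed
qed simp

lemma block_near_exists:
  assumes Y: "subspace Y" "Y \<subseteq> X" "infinite_dimensional Y"
  obtains z where "block z" "\<And>i. W_norm n (z i) \<le> 1" "\<And>i. 1/4 \<le> W_norm n (z i)" "near Y z"
proof -
  define P where "P = (\<lambda>(i :: nat) (y, u). y \<in> Y \<and> norm y = 1/2 \<and> u \<in> c00 \<and> norm (y - J u) \<le> 1/4 * (1/2) ^ i)"
  define Q where "Q = (\<lambda>(_ :: nat) (y :: 'a, u :: nat \<Rightarrow> real) (y' :: 'a, u' :: nat \<Rightarrow> real). before (supp u) (supp u'))"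
  have step: "\<exists>yu. P i yu \<and> (\<forall>j<N. snd yu j = 0)" for i N
  proof -
    have "(0 :: real) < 1/4 * (1/2) ^ i" by simp
    then obtain y u where "y \<in> Y" "norm y = 1/2" "u \<in> c00" "\<And>j. j < N \<Longrightarrow> u j = 0" "norm (y - J u) \<le> 1/4 * (1/2) ^ i"
      by (rule hump[OF Y, where N = N]) blast
    then show ?thesis by (intro exI[of _ "(y, u)"]) (simp add: P_def)
  qed
  have "\<exists>f. \<forall>i. P i (f i) \<and> Q i (f i) (f (Suc i))"
  proof (rule dependent_nat_choice)
    show "\<exists>v. P 0 v" using step by blast
    fix v i assume v: "P i v"
    have fin: "finite (supp (snd v))" using v by (auto simp: P_def c00_def)
    obtain w where w: "P (Suc i) w" "\<forall>j<Suc (Max (supp (snd v))). snd w j = 0" using step by blast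
    have "before (supp (snd v)) (supp (snd w))"
      unfolding before_def
    proof (intro ballI, rule ccontr)
      fix s t assume st: "s \<in> supp (snd v)" "t \<in> supp (snd w)" "\<not> s < t"
      then have "t < Suc (Max (supp (snd v)))" using Max_ge[OF fin st(1)] by simp
      then show False using w(2) st(2) by (simp add: supp_def)
    qed
    then show "\<exists>w. P (Suc i) w \<and> Q i v w" using w(1) by (intro exI[of _ w]) (simp add: Q_def case_prod_unfold)
  qed
  then obtain f where f: "\<And>i. P i (f i)" "\<And>i. Q i (f i) (f (Suc i))" by blast
  define w where "w = (\<lambda>i. fst (f i))"
  define z where "z = (\<lambda>i. snd (f i))"
  have wz: "w i \<in> Y" "norm (w i) = 1/2" "z i \<in> c00" "norm (w i - J (z i)) \<le> 1/4 * (1/2) ^ i"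
    "before (supp (z i)) (supp (z (Suc i)))" for i
    using f(1)[of i] f(2)[of i] by (auto simp: P_def Q_def w_def z_def case_prod_unfold)
  have err: "norm (w i - J (z i)) \<le> 1/4" for i
  proof -
    have "1/4 * (1/2 :: real) ^ i \<le> 1/4 * 1" by (intro mult_left_mono power_le_one) simp_all
    then show ?thesis using wz(4)[of i] by simp
  qed
  have norms: "1/4 \<le> W_norm n (z i)" "W_norm n (z i) \<le> 1" for i
    using err[of i] wz(2)[of i] norm_triangle_ineq3[of "w i" "J (z i)"] norm_J[OF wz(3), of i]
    by (simp_all add: abs_le_iff)
  have "supp (z i) \<noteq> {}" for i
    using W_norm_le_sum[of "z i"] norms(1)[of i] by auto
  then have "block z" using wz(3,5) by (simp add: block_def)
  moreover have "summable (\<lambda>i. norm (w i - J (z i)))"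
  proof (rule summable_comparison_test'[where N = 0])
    show "summable (\<lambda>i. 1/4 * (1/2 :: real) ^ i)" by (intro summable_mult summable_geometric) simp
    show "norm (norm (w i - J (z i))) \<le> 1/4 * (1/2) ^ i" for i
      unfolding real_norm_def abs_norm_cancel by (rule wz(4))
  qed
  then have "near Y z" unfolding near_def using wz(1) by (intro exI[of _ w]) auto
  ultimately show ?thesis using that norms by blast
qed

lemma seminormalized_small:
  assumes Y: "subspace Y" "Y \<subseteq> X" "infinite_dimensional Y" and "k \<le> n"
  shows "\<exists>z e. 0 < e \<and> block z \<and> (\<forall>i. W_norm n (z i) \<le> 1) \<and> (\<forall>i. e \<le> W_norm n (z i)) \<and> near Y z \<and> small n k z"
  using \<open>k \<le> n\<close>
proof (induction k)
  case 0
  obtain z where "block z" "\<And>i. W_norm n (z i) \<le> 1" "\<And>i. 1/4 \<le> W_norm n (z i)" "near Y z"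
    using block_near_exists[OF Y] by blast
  then show ?case by (intro exI[of _ z] exI[of _ "1/4"]) simp
next
  case (Suc k)
  obtain z e where z: "0 < e" "block z" "\<And>i. W_norm n (z i) \<le> 1" "\<And>i. e \<le> W_norm n (z i)" "near Y z" "small n k z"
    using Suc.IH Suc.prems by auto
  show ?case
  proof (cases "small n n z")
    case True
    then have "small n (Suc k) z" using Suc.prems by (rule small_mono)
    then show ?thesis using z by blast
  next
    case False
    obtain n' where n': "n = Suc n'" using Suc.prems by (cases n) auto
    obtain r :: "nat \<Rightarrow> nat" and d where r: "strict_mono r" "0 < d"
      "\<And>r' j. strict_mono r' \<Longrightarrow> d \<le> W_norm n (dyadic_avg (z \<circ> r \<circ> r') j)"
      using not_small_dyadic_lower[OF z(2) n' False] by metis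
    obtain r' where r': "strict_mono r'" "rapid n k (z \<circ> r \<circ> r')"
      by (rule small_imp_rapid[OF block_subseq[OF z(2) r(1)] small_subseq[OF z(6) r(1)]])
    define y where "y = z \<circ> r \<circ> r'"
    have y: "block y" "\<And>i. W_norm n (y i) \<le> 1" "near Y y" "rapid n k y"
      unfolding y_def using r' z(3)
      by (simp_all add: block_subseq[OF block_subseq[OF z(2) r(1)] r'(1)]
          near_subseq[OF near_subseq[OF z(5) r(1)] r'(1)])
    have "small n (Suc k) (dyadic_avg y)"
      using Suc.prems by (intro small_dyadic_avg[OF y(1,2,4)]) simp
    moreover have "d \<le> W_norm n (dyadic_avg y i)" for i unfolding y_def by (rule r(3)[OF r'(1)])
    ultimately show ?thesis
      using r(2) block_dyadic_avg[OF y(1)] W_norm_dyadic_avg[OF y(1,2)] near_dyadic_avg[OF Y(1) y(1,3)]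
      by blast
  qed
qed

lemma c0_block_exists:
  assumes Y: "subspace Y" "Y \<subseteq> X" "infinite_dimensional Y"
  obtains z where "block z" "\<And>i. W_norm n (z i) = 1" "rapid n n z" "near Y z"
proof -
  obtain y e where y: "0 < e" "block y" "\<And>i. e \<le> W_norm n (y i)" "near Y y" "small n n y"
    using seminormalized_small[OF Y order.refl] by blast
  define c where "c = (\<lambda>i. 1 / W_norm n (y i))"
  have pos: "0 < W_norm n (y i)" for i using y(1) y(3)[of i] by simp
  have c: "\<bar>c i\<bar> \<le> 1 / e" "c i \<noteq> 0" "0 < c i" for i
    using pos[of i] y(1) y(3)[of i] by (simp_all add: c_def frac_le)
  define z where "z = (\<lambda>i. lc c {i} y)"
  have z: "block z" unfolding z_def
    by (rule block_lc[where G = "\<lambda>j. {j}" and c = "\<lambda>_. c", OF y(2)]) (simp_all add: before_def c)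
  have P: "pairing f (z i) = c i * pairing f (y i)" for f i
    unfolding z_def by (rule pairing_lc_single[OF block_c00[OF y(2)]])
  have "W_norm n (z i) = 1" for i
  proof -
    have "J (z i) = c i *\<^sub>R J (y i)" unfolding z_def using J_lc[of "{i}" y c] block_c00[OF y(2)] by simp
    then have "norm (J (z i)) = 1" using c(3)[of i] pos[of i] norm_J[OF block_c00[OF y(2)], of i] by (simp add: c_def)
    then show ?thesis using norm_J[OF block_c00[OF z], of i] by simp
  qed
  moreover have "small n n z" unfolding z_def by (rule small_scale[OF y(2,5) c(1)])
  moreover have "near Y z" unfolding z_def
    by (rule near_lc[OF Y(1) y(2,4), where H = "\<lambda>j. {j}" and c = "\<lambda>_. c" and K = "1 / e"]) (use c(1) y(1) in auto)
  moreover obtain r where r: "strict_mono r" "rapid n n (z \<circ> r)"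
    by (rule small_imp_rapid[OF z calculation(2)])
  ultimately show ?thesis
    using that[of "z \<circ> r"] block_subseq[OF z r(1)] near_subseq[OF _ r(1)] by simp
qed

lemma c0_spreading_model_exists:
  assumes n: "1 \<le> n" and Y: "subspace Y" "Y \<subseteq> X" "infinite_dimensional Y"
  shows "\<exists>x. range x \<subseteq> Y \<and> (\<forall>i. norm (x i) = 1) \<and> isometric_c0_spreading_model x"
proof -
  obtain z where z: "block z" "\<And>i. W_norm n (z i) = 1" "rapid n n z" "near Y z"
    using c0_block_exists[OF Y] by metis
  obtain w where w: "range w \<subseteq> Y" "summable (\<lambda>j. norm (w j - J (z j)))"
    using z(4) by (auto simp: near_def)
  define e where "e = (\<lambda>j. norm (w j - J (z j)))"
  have Jz: "norm (J (z j)) = 1" for j using norm_J[OF block_c00[OF z(1)]] z(2) by simp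
  have "e \<longlonglongrightarrow> 0" unfolding e_def by (rule summable_LIMSEQ_zero[OF w(2)])
  then obtain N where N: "\<And>j. N \<le> j \<Longrightarrow> e j < 1/2"
    using LIMSEQ_D[of e 0 "1/2"] by (auto simp: e_def)
  define y where "y = (\<lambda>j. (1 / norm (w (j + N))) *\<^sub>R w (j + N))"
  define f where "f = (\<lambda>j. 2 * e (j + N))"
  have wn: "\<bar>norm (w (j + N)) - 1\<bar> \<le> e (j + N)" for j
    using norm_triangle_ineq3[of "w (j + N)" "J (z (j + N))"] Jz by (simp add: e_def)
  have wpos: "0 < norm (w (j + N))" for j using wn[of j] N[of "j + N"] by linarith
  have y1: "norm (y j) = 1" for j using wpos[of j] by (simp add: y_def)
  have yY: "range y \<subseteq> Y" using w(1) by (auto simp: y_def intro!: subspace_scale[OF Y(1)])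
  have err: "norm (y j - J (z (j + N))) \<le> f j" for j
  proof -
    have "y j - w (j + N) = (1 / norm (w (j + N)) - 1) *\<^sub>R w (j + N)"
      by (simp add: y_def scaleR_diff_left)
    then have "norm (y j - w (j + N)) = \<bar>1 / norm (w (j + N)) - 1\<bar> * norm (w (j + N))" by simp
    also have "\<dots> = \<bar>(1 / norm (w (j + N)) - 1) * norm (w (j + N))\<bar>" by (simp add: abs_mult)
    also have "(1 / norm (w (j + N)) - 1) * norm (w (j + N)) = 1 - norm (w (j + N))"
      using wpos[of j] by (simp add: left_diff_distrib)
    finally have "norm (y j - w (j + N)) \<le> e (j + N)" using wn[of j] by linarith
    then show ?thesis
      using norm_triangle_ineq[of "y j - w (j + N)" "w (j + N) - J (z (j + N))"] by (simp add: f_def e_def)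
  qed
  have f: "summable f" "\<And>j. 0 \<le> f j"
    unfolding f_def e_def using summable_ignore_initial_segment[OF w(2), of N]
    by (simp_all add: summable_mult)
  define T where "T = (\<lambda>m. \<Sum>j. f (j + m))"
  have T: "T m = suminf f - (\<Sum>i<m. f i)" for m
    unfolding T_def by (rule suminf_minus_initial_segment[OF f(1)])
  define \<delta> where "\<delta> = (\<lambda>m. 3 * (1/2) ^ m + T m)"
  have "decseq \<delta>" by (rule decseq_SucI) (simp add: \<delta>_def T f(2) add_mono)
  moreover have "\<delta> \<longlonglongrightarrow> 0"
  proof -
    have "T \<longlonglongrightarrow> suminf f - suminf f" unfolding T
      by (intro tendsto_diff tendsto_const summable_LIMSEQ f(1))
    moreover have "(\<lambda>m. 3 * (1/2 :: real) ^ m) \<longlonglongrightarrow> 3 * 0"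
      by (intro tendsto_mult tendsto_const LIMSEQ_power_zero) simp
    ultimately show ?thesis unfolding \<delta>_def using tendsto_add by fastforce
  qed
  moreover have "\<bar>norm (\<Sum>j=1..m. a j *\<^sub>R y (i j)) - Max ((\<lambda>j. \<bar>a j\<bar>) ` {1..m})\<bar> < \<delta> m"
    if m: "1 \<le> m" "m \<le> i 1" and i: "strict_mono_on {1..m} i" and a: "\<forall>j\<in>{1..m}. a j \<in> {-1..1}"
    for m and i :: "nat \<Rightarrow> nat" and a :: "nat \<Rightarrow> real"
  proof -
    define p where "p = (\<lambda>j. i j + N)"
    have inji: "inj_on i {1..m}" using i by (rule strict_mono_on_imp_inj_on)
    have inj: "inj_on p {1..m}"
    proof (rule inj_onI)
      fix j j' assume "j \<in> {1..m}" "j' \<in> {1..m}" "p j = p j'"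
      then show "j = j'" using inj_onD[OF inji, of j j'] by (simp add: p_def)
    qed
    define I where "I = p ` {1..m}"
    have cI: "card I = m" unfolding I_def using card_image[OF inj] by simp
    have I: "finite I" "I \<noteq> {}" using m(1) by (auto simp: I_def)
    have ge: "m \<le> i j" if "j \<in> {1..m}" for j
    proof (cases "j = 1")
      case False
      then have "i 1 < i j" using i m(1) that by (auto simp: strict_mono_on_def)
      then show ?thesis using m(2) by simp
    qed (use m in simp)
    have "card I \<le> Min I" unfolding cI using I ge by (auto simp: I_def p_def intro: trans_le_add1)
    define c where "c = (\<lambda>l. a (inv_into {1..m} p l))"
    have c: "c (p j) = a j" if "j \<in> {1..m}" for j using that inj by (simp add: c_def)
    define M where "M = Max ((\<lambda>j. \<bar>a j\<bar>) ` {1..m})"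
    have M: "\<bar>a j\<bar> \<le> M" if "j \<in> {1..m}" for j unfolding M_def using that by (intro Max_ge) auto
    have "M \<in> (\<lambda>j. \<bar>a j\<bar>) ` {1..m}" unfolding M_def using m(1) by (intro Max_in) auto
    then obtain j0 where j0: "j0 \<in> {1..m}" "M = \<bar>a j0\<bar>" by blast
    have M1: "0 \<le> M" "M \<le> 1" using j0 a by (auto simp: abs_le_iff)
    have upper: "W_norm n (lc c I z) \<le> M + 2 * (1/2) ^ m"
    proof -
      have "W_norm n (lc c I z) \<le> M * (1 + 2 * (1/2) ^ card I)"
        using z(2) M c \<open>card I \<le> Min I\<close>
        by (intro c0_estimate_scaled[OF z(1) _ z(3) n I]) (auto simp: I_def)
      also have "\<dots> = M + M * (2 * (1/2) ^ m)" by (simp add: cI distrib_left)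
      also have "\<dots> \<le> M + 1 * (2 * (1/2) ^ m)" using M1 by (intro add_left_mono mult_right_mono) simp_all
      finally show ?thesis by simp
    qed
    have "p j0 \<in> I" using j0 by (simp add: I_def)
    then have lower: "M \<le> W_norm n (lc c I z)"
      using W_norm_lc_ge[OF z(1) I(1), of "p j0" c n] c[OF j0(1)] j0(2) z(2) by simp
    have "norm (J (lc c I z)) = W_norm n (lc c I z)"
      by (rule norm_J[OF lc_c00[OF I(1) block_c00[OF z(1)]]])
    moreover have "J (lc c I z) = (\<Sum>j=1..m. a j *\<^sub>R J (z (p j)))"
    proof -
      have "J (lc c I z) = (\<Sum>l\<in>I. c l *\<^sub>R J (z l))" by (rule J_lc[OF I(1) block_c00[OF z(1)]])
      also have "\<dots> = (\<Sum>j=1..m. c (p j) *\<^sub>R J (z (p j)))" unfolding I_def by (simp only: sum.reindex[OF inj] comp_def)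
      also have "\<dots> = (\<Sum>j=1..m. a j *\<^sub>R J (z (p j)))" by (rule sum.cong) (simp_all add: c)
      finally show ?thesis .
    qed
    ultimately have nrm: "norm (\<Sum>j=1..m. a j *\<^sub>R J (z (p j))) = W_norm n (lc c I z)" by simp
    have "norm ((\<Sum>j=1..m. a j *\<^sub>R y (i j)) - (\<Sum>j=1..m. a j *\<^sub>R J (z (p j))))
        = norm (\<Sum>j=1..m. a j *\<^sub>R (y (i j) - J (z (p j))))"
      by (simp add: scaleR_diff_right sum_subtractf)
    also have "\<dots> \<le> (\<Sum>j=1..m. f (i j))"
    proof (rule order.trans[OF norm_sum], rule sum_mono)
      fix j assume j: "j \<in> {1..m}"
      have "\<bar>a j\<bar> * norm (y (i j) - J (z (p j))) \<le> 1 * f (i j)"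
        using err[of "i j"] a j unfolding p_def by (intro mult_mono) (auto simp: abs_le_iff)
      then show "norm (a j *\<^sub>R (y (i j) - J (z (p j)))) \<le> f (i j)" by simp
    qed
    also have "\<dots> = sum f (i ` {1..m})" by (simp only: sum.reindex[OF inji] comp_def)
    also have "\<dots> \<le> T m" unfolding T_def using ge by (intro sum_le_tail f) auto
    finally have "\<bar>norm (\<Sum>j=1..m. a j *\<^sub>R y (i j)) - W_norm n (lc c I z)\<bar> \<le> T m"
      using norm_triangle_ineq3[of "\<Sum>j=1..m. a j *\<^sub>R y (i j)" "\<Sum>j=1..m. a j *\<^sub>R J (z (p j))"]
      unfolding nrm by linarith
    moreover have "0 < (1/2 :: real) ^ m" by simp
    ultimately have "\<bar>norm (\<Sum>j=1..m. a j *\<^sub>R y (i j)) - M\<bar> < 3 * (1/2) ^ m + T m"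
      using upper lower unfolding abs_less_iff abs_le_iff by linarith
    then show ?thesis unfolding M_def \<delta>_def .
  qed
  ultimately have "isometric_c0_spreading_model y"
    unfolding isometric_c0_spreading_model_def by (intro exI[of _ \<delta>]) blast
  then show ?thesis using yY y1 by blast
qed

lemma l1_spreading_model_exists:
  assumes n: "1 \<le> n" and Y: "subspace Y" "Y \<subseteq> X" "infinite_dimensional Y" and k: "k < n"
  shows "\<exists>x. range x \<subseteq> Y \<and> l1_spreading_model (n - k) x \<and>
    \<not> (\<exists>r :: nat \<Rightarrow> nat. strict_mono r \<and> l1_spreading_model (n - k + 1) (x \<circ> r))"
proof -
  obtain y where y: "block y" "\<And>i. W_norm n (y i) = 1" "rapid n n y" "near Y y"
    using c0_block_exists[OF Y] by metis
  obtain G :: "nat \<Rightarrow> nat set" and \<beta> t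
    where "\<forall>j. finite (G j) \<and> G j \<noteq> {} \<and> before (G j) (G (Suc j))"
    and "ladder n (\<lambda>j. lc (\<lambda>_. 1/2) (G j) y) (\<lambda>j. {(\<beta> j, t j)})"
    "\<forall>j. 1/4 \<le> \<bar>pairing (\<beta> j) (lc (\<lambda>_. 1/2) (G j) y)\<bar>"
    "\<forall>j. W_norm n (lc (\<lambda>_. 1/2) (G j) y) \<le> 1"
    using averaged_ladder[OF y(1-3) n] by (elim exE conjE) (rule that)
  then have G: "\<And>j. finite (G j)" "\<And>j. before (G j) (G (Suc j))" "\<And>j. G j \<noteq> {}"
    and L: "ladder n (\<lambda>j. lc (\<lambda>_. 1/2) (G j) y) (\<lambda>j. {(\<beta> j, t j)})"
    "\<And>j. 1/4 \<le> \<bar>pairing (\<beta> j) (lc (\<lambda>_. 1/2) (G j) y)\<bar>"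
    "\<And>j. W_norm n (lc (\<lambda>_. 1/2) (G j) y) \<le> 1"
    by simp_all
  define x where "x = (\<lambda>j. lc (\<lambda>_. 1/2) (G j) y)"
  have ladder: "ladder n x (\<lambda>j. {(\<beta> j, t j)})" "\<And>j. 1/4 \<le> \<bar>pairing (\<beta> j) (x j)\<bar>"
    unfolding x_def by (rule L(1), rule L(2))
  have Gdisj: "G i \<inter> G j = {}" if "i \<noteq> j" for i j
    using that sets_before[of G i j, OF G(3,2)] sets_before[of G j i, OF G(3,2)]
    unfolding before_def by (metis disjoint_iff less_irrefl linorder_neqE_nat)
  have x: "block x" "\<And>j. W_norm n (x j) \<le> 1" "near Y x"
  proof -
    show "block x" using ladder(1) by (simp add: ladder_def)
    show "W_norm n (x j) \<le> 1" for j unfolding x_def by (rule L(3))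
    show "near Y x" unfolding x_def
      by (rule near_lc[where H = G and c = "\<lambda>_ _. 1/2", OF Y(1) y(1,4) G(1) Gdisj, where K = 1]) simp_all
  qed
  obtain H c where H: "convex_blocks k H c" "small n (0 + k) (\<lambda>j. lc (c j) (H j) x)"
    by (rule small_iterated_averages[where a = 0 and b = k, OF x(1,2)]) (use k in simp_all)
  define z where "z = (\<lambda>j. lc (c j) (H j) x)"
  have z: "block z" "\<And>j. W_norm n (z j) \<le> 1" "near Y z" "small n k z"
    unfolding z_def using H(2)
    by (simp_all add: block_convex[OF x(1) H(1)] W_norm_convex[OF x(1,2) H(1)] near_convex[OF Y(1) x(1,3) H(1)])
  have lower: "1/4 * (\<Sum>j\<in>F. \<bar>a j\<bar>) \<le> W_norm n (lc a F z)" if F: "F \<in> schreier (n - k)" for F a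
  proof -
    have fin: "finite F" using schreier_basic[OF F] by simp
    have "(\<Union>i\<in>F. H i) \<in> schreier n" using schreier_convex_UN[OF H(1) F] k by simp
    then have "1/4 * (\<Sum>l\<in>(\<Union>i\<in>F. H i). \<bar>combined H c a F l\<bar>) \<le> W_norm n (lc (combined H c a F) (\<Union>i\<in>F. H i) x)"
      by (rule ladder_l1_lower[OF ladder])
    moreover have "(\<Sum>l\<in>(\<Union>i\<in>F. H i). \<bar>combined H c a F l\<bar>) = (\<Sum>i\<in>F. \<Sum>l\<in>H i. \<bar>a i * c i l\<bar>)"
      by (rule sum_combined[OF H(1) fin])
    moreover have "(\<Sum>l\<in>H i. \<bar>a i * c i l\<bar>) = \<bar>a i\<bar>" for i
    proof -
      have "(\<Sum>l\<in>H i. \<bar>a i * c i l\<bar>) = (\<Sum>l\<in>H i. \<bar>a i\<bar> * c i l)"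
      proof (rule sum.cong[OF refl])
        fix l assume "l \<in> H i"
        then have "0 < c i l" using H(1) by (simp add: convex_blocks_def)
        then show "\<bar>a i * c i l\<bar> = \<bar>a i\<bar> * c i l" by (simp add: abs_mult)
      qed
      also have "\<dots> = \<bar>a i\<bar>" using H(1) by (simp add: sum_distrib_left[symmetric] convex_blocks_def)
      finally show ?thesis .
    qed
    ultimately show ?thesis unfolding lc_combined[OF H(1) fin] z_def by simp
  qed
  obtain w where w: "range w \<subseteq> Y" "summable (\<lambda>j. norm (w j - J (z j)))"
    using z(3) by (auto simp: near_def)
  define e where "e = (\<lambda>j. norm (w j - J (z j)))"
  have e0: "0 \<le> e j" for j by (simp add: e_def)
  have "e \<longlonglongrightarrow> 0" unfolding e_def by (rule summable_LIMSEQ_zero[OF w(2)])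
  then have e_small: "\<exists>N. \<forall>j\<ge>N. e j < d" if "0 < d" for d
    using LIMSEQ_D[of e 0 d] that by (auto simp: e_def)
  have close: "norm ((\<Sum>j\<in>F. a j *\<^sub>R w (r j)) - (\<Sum>j\<in>F. a j *\<^sub>R J (z (r j)))) \<le> (\<Sum>j\<in>F. \<bar>a j\<bar>) * d"
    if "\<And>j. j \<in> F \<Longrightarrow> e (r j) \<le> d" for F :: "nat set" and a r d
  proof -
    have "norm ((\<Sum>j\<in>F. a j *\<^sub>R w (r j)) - (\<Sum>j\<in>F. a j *\<^sub>R J (z (r j)))) = norm (\<Sum>j\<in>F. a j *\<^sub>R (w (r j) - J (z (r j))))"
      by (simp add: scaleR_diff_right sum_subtractf)
    also have "\<dots> \<le> (\<Sum>j\<in>F. \<bar>a j\<bar> * d)"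
      using that by (intro order.trans[OF norm_sum] sum_mono) (simp add: e_def mult_left_mono)
    finally show ?thesis by (simp add: sum_distrib_right)
  qed
  obtain N where N: "\<And>j. N \<le> j \<Longrightarrow> e j < 1/8" using e_small[of "1/8"] by auto
  define v where "v = (\<lambda>j. w (j + N))"
  have Jz: "norm (J (z j)) \<le> 1" for j using norm_J[OF block_c00[OF z(1)], of j] z(2)[of j] by simp
  have "l1_spreading_model (n - k) v"
    unfolding l1_spreading_model_def equivalent_to_l1_basis_def
  proof (intro exI[of _ 8] conjI ballI allI)
    fix F and a :: "nat \<Rightarrow> real" assume F: "F \<in> schreier (n - k)"
    have fin: "finite F" using schreier_basic[OF F] by simp
    have inj: "inj_on (\<lambda>j. j + N) F" by simp
    have FN: "(\<lambda>j. j + N) ` F \<in> schreier (n - k)" by (rule schreier_spreading[OF F]) simp_all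
    define S where "S = (\<Sum>j\<in>F. \<bar>a j\<bar>)"
    have S: "0 \<le> S" by (simp add: S_def sum_nonneg)
    let ?a = "\<lambda>l. a (l - N)"
    have "1/4 * (\<Sum>l\<in>(\<lambda>j. j + N) ` F. \<bar>?a l\<bar>) \<le> W_norm n (lc ?a ((\<lambda>j. j + N) ` F) z)"
      by (rule lower[OF FN])
    also have "\<dots> = norm (J (lc ?a ((\<lambda>j. j + N) ` F) z))"
      using fin by (intro norm_J[symmetric] lc_c00 block_c00[OF z(1)]) simp
    also have "J (lc ?a ((\<lambda>j. j + N) ` F) z) = (\<Sum>l\<in>(\<lambda>j. j + N) ` F. ?a l *\<^sub>R J (z l))"
      using fin by (intro J_lc block_c00[OF z(1)]) simp
    also have "\<dots> = (\<Sum>j\<in>F. a j *\<^sub>R J (z (j + N)))" by (simp add: sum.reindex[OF inj])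
    also have "(\<Sum>l\<in>(\<lambda>j. j + N) ` F. \<bar>?a l\<bar>) = S" by (simp add: sum.reindex[OF inj] S_def)
    finally have 1: "1/4 * S \<le> norm (\<Sum>j\<in>F. a j *\<^sub>R J (z (j + N)))" .
    have 2: "norm (\<Sum>j\<in>F. a j *\<^sub>R J (z (j + N))) \<le> S"
      unfolding S_def using Jz by (intro order.trans[OF norm_sum] sum_mono) (simp add: mult_left_le)
    have 3: "norm ((\<Sum>j\<in>F. a j *\<^sub>R v j) - (\<Sum>j\<in>F. a j *\<^sub>R J (z (j + N)))) \<le> S * (1/8)"
      unfolding v_def S_def by (rule close, rule less_imp_le, rule N) simp
    show "1/8 * (\<Sum>j\<in>F. \<bar>a j\<bar>) \<le> norm (\<Sum>j\<in>F. a j *\<^sub>R v j)"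
      using 1 3 norm_triangle_ineq3[of "\<Sum>j\<in>F. a j *\<^sub>R v j" "\<Sum>j\<in>F. a j *\<^sub>R J (z (j + N))"] S
      unfolding S_def[symmetric] by (simp add: abs_le_iff)
    show "norm (\<Sum>j\<in>F. a j *\<^sub>R v j) \<le> 8 * (\<Sum>j\<in>F. \<bar>a j\<bar>)"
      using 2 3 norm_triangle_ineq3[of "\<Sum>j\<in>F. a j *\<^sub>R v j" "\<Sum>j\<in>F. a j *\<^sub>R J (z (j + N))"] S
      unfolding S_def[symmetric] by (simp add: abs_le_iff)
  qed simp
  moreover have "\<not> l1_spreading_model (n - k + 1) (v \<circ> r)" if r: "strict_mono r" for r :: "nat \<Rightarrow> nat"
  proof
    assume "l1_spreading_model (n - k + 1) (v \<circ> r)"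
    then obtain C where C: "1 \<le> C" "\<And>F a. F \<in> schreier (n - k + 1) \<Longrightarrow>
        1 / C * (\<Sum>i\<in>F. \<bar>a i\<bar>) \<le> norm (\<Sum>i\<in>F. a i *\<^sub>R (v \<circ> r) i)"
      unfolding l1_spreading_model_def equivalent_to_l1_basis_def by blast
    define q where "q = (\<lambda>i. r i + N)"
    have q: "strict_mono q" using r by (simp add: q_def strict_mono_def)
    define u where "u = z \<circ> q"
    have u: "block u" "\<And>i. W_norm n (u i) \<le> 1" "small n k u"
      unfolding u_def using z(2) by (simp_all add: block_subseq[OF z(1) q] small_subseq[OF z(4) q])
    obtain H' c' where H': "convex_blocks (n - k) H' c'" "small n (k + (n - k)) (\<lambda>j. lc (c' j) (H' j) u)"
      by (rule small_iterated_averages[OF u, of "n - k"]) (use k in simp_all)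
    note blk = block_convex[OF u(1) H'(1)]
    have "small n n (\<lambda>j. lc (c' j) (H' j) u)" using H'(2) k by simp
    then obtain r' where r': "strict_mono r'" "rapid n n ((\<lambda>j. lc (c' j) (H' j) u) \<circ> r')"
      by (rule small_imp_rapid[OF blk])
    define H2 where "H2 = H' \<circ> r'"
    define c2 where "c2 = c' \<circ> r'"
    have cb: "convex_blocks (n - k) H2 c2" unfolding H2_def c2_def by (rule convex_blocks_subseq[OF H'(1) r'(1)])
    define s where "s = (\<lambda>j. lc (c2 j) (H2 j) u)"
    have s: "block s" "\<And>i. W_norm n (s i) \<le> 1" "rapid n n s"
      unfolding s_def using r'(2) block_convex[OF u(1) cb] W_norm_convex[OF u(1,2) cb]
      by (simp_all add: comp_def H2_def c2_def)
    have C0: "0 < 1 / (2 * C)" using C(1) by simp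
    obtain N1 where N1: "\<And>j. N1 \<le> j \<Longrightarrow> e j < 1 / (2 * C)" using e_small[OF C0] by blast
    obtain m1 :: nat where m1: "4 * C < m1" using reals_Archimedean2 by blast
    define j where "j = max N1 m1"
    let ?D = "\<Union>i\<in>dyadic j. H2 i" and ?b = "combined H2 c2 (\<lambda>_. 1 / 2 ^ Suc j) (dyadic j)"
    note cbd = convex_blocks_dyadic[OF cb]
    have D: "?D \<in> schreier (n - k + 1)" "\<And>l. l \<in> ?D \<Longrightarrow> 0 < ?b l" "(\<Sum>l\<in>?D. ?b l) = 1"
      using cbd by (auto simp: convex_blocks_def)
    have finD: "finite ?D" using schreier_basic[OF D(1)] by simp
    have "(\<Sum>l\<in>?D. \<bar>?b l\<bar>) = (\<Sum>l\<in>?D. ?b l)" using D(2) by (intro sum.cong) (simp_all add: less_imp_le)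
    then have abs1: "(\<Sum>l\<in>?D. \<bar>?b l\<bar>) = 1" using D(3) by simp
    have "1 / C \<le> norm (\<Sum>l\<in>?D. ?b l *\<^sub>R (v \<circ> r) l)" using C(2)[OF D(1), of ?b] unfolding abs1 by simp
    also have "(\<Sum>l\<in>?D. ?b l *\<^sub>R (v \<circ> r) l) = (\<Sum>l\<in>?D. ?b l *\<^sub>R w (q l))" by (simp add: v_def q_def)
    finally have 1: "1 / C \<le> norm (\<Sum>l\<in>?D. ?b l *\<^sub>R w (q l))" .
    have "norm ((\<Sum>l\<in>?D. ?b l *\<^sub>R w (q l)) - (\<Sum>l\<in>?D. ?b l *\<^sub>R J (z (q l)))) \<le> (\<Sum>l\<in>?D. \<bar>?b l\<bar>) * (1 / (2 * C))"
    proof (rule close)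
      fix l assume "l \<in> ?D"
      then have "j < l" by (rule convex_blocks_props(5)[OF cbd])
      then have "N1 \<le> q l" using strict_mono_le[OF q, of l] by (simp add: j_def)
      then show "e (q l) \<le> 1 / (2 * C)" by (rule less_imp_le[OF N1])
    qed
    then have 2: "norm ((\<Sum>l\<in>?D. ?b l *\<^sub>R w (q l)) - (\<Sum>l\<in>?D. ?b l *\<^sub>R J (z (q l)))) \<le> 1 / (2 * C)"
      unfolding abs1 by simp
    have c00: "lc ?b ?D u \<in> c00" by (rule lc_c00[OF finD]) (rule block_c00[OF u(1)])
    have J_lc_u: "J (lc ?b ?D u) = (\<Sum>l\<in>?D. ?b l *\<^sub>R J (u l))"
      by (rule J_lc[OF finD]) (rule block_c00[OF u(1)])
    have "norm (\<Sum>l\<in>?D. ?b l *\<^sub>R J (z (q l))) = norm (J (lc ?b ?D u))"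
      unfolding J_lc_u by (simp only: u_def comp_def)
    also have "\<dots> = W_norm n (lc ?b ?D u)" by (rule norm_J[OF c00])
    also have "lc ?b ?D u = lc (\<lambda>_. 1 / 2 ^ Suc j) (dyadic j) s"
      unfolding s_def by (rule lc_combined[OF cb dyadic_props(1)])
    also have "W_norm n (lc (\<lambda>_. 1 / 2 ^ Suc j) (dyadic j) s) \<le> 1 / 2 ^ Suc j * (1 + 2 * (1/2) ^ card (dyadic j))"
      by (rule c0_estimate_scaled[OF s n dyadic_props(1,2)]) (simp_all only: dyadic_props, simp_all)
    also have "\<dots> \<le> 1 / 2 ^ Suc j * 2"
    proof -
      have "(1/2 :: real) ^ card (dyadic j) \<le> (1/2) ^ 1"
        unfolding dyadic_props(3) by (intro power_decreasing) simp_all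
      then show ?thesis by (intro mult_left_mono) simp_all
    qed
    also have "\<dots> = 1 / 2 ^ j" by simp
    also have "\<dots> < 1 / (2 * C)"
    proof -
      have "real j < 2 ^ j" by (rule of_nat_less_two_power)
      moreover have "4 * C < real j" using m1 by (simp add: j_def)
      ultimately have "4 * C < 2 ^ j" by (rule less_trans[rotated])
      then have "2 * C < 2 ^ j" using C(1) by linarith
      then show ?thesis using C(1) by (intro divide_strict_left_mono) simp_all
    qed
    finally have "norm (\<Sum>l\<in>?D. ?b l *\<^sub>R J (z (q l))) < 1 / (2 * C)" .
    moreover have "1 / (2 * C) + 1 / (2 * C) = 1 / C" using C(1) by simp
    ultimately show False
      using 1 2 norm_triangle_ineq3[of "\<Sum>l\<in>?D. ?b l *\<^sub>R w (q l)" "\<Sum>l\<in>?D. ?b l *\<^sub>R J (z (q l))"]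
      unfolding abs_le_iff by linarith
  qed
  moreover have "range v \<subseteq> Y" using w(1) by (auto simp: v_def)
  ultimately show ?thesis by blast
qed

end

theorem proposition3p18:
  fixes n :: nat
    and J :: "(nat \<Rightarrow> real) \<Rightarrow> 'a::banach"
    and X Y :: "'a set"
  assumes "n \<ge> 1"
    and "is_completion c00 (W_norm n) J X"
    and "subspace Y" and "closed Y" and "Y \<subseteq> X" and "infinite_dimensional Y"
  shows "(\<exists>x :: nat \<Rightarrow> 'a. range x \<subseteq> Y \<and> (\<forall>i. norm (x i) = 1) \<and> weakly_null_in Y x \<and>
            isometric_c0_spreading_model x)
       \<and> (\<forall>k\<in>{0..n - 1}. \<exists>x :: nat \<Rightarrow> 'a. range x \<subseteq> Y \<and> l1_spreading_model (n - k) x \<and>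
            \<not> (\<exists>r :: nat \<Rightarrow> nat. strict_mono r \<and> l1_spreading_model (n - k + 1) (x \<circ> r)))"
proof
  interpret W_completion n J X by unfold_locales (rule assms(2))
  show "\<exists>x :: nat \<Rightarrow> 'a. range x \<subseteq> Y \<and> (\<forall>i. norm (x i) = 1) \<and> weakly_null_in Y x \<and>
            isometric_c0_spreading_model x"
    using c0_spreading_model_exists[OF assms(1,3,5,6)] c0_spreading_model_weakly_null[OF assms(3)] by blast
  show "\<forall>k\<in>{0..n - 1}. \<exists>x :: nat \<Rightarrow> 'a. range x \<subseteq> Y \<and> l1_spreading_model (n - k) x \<and>
            \<not> (\<exists>r :: nat \<Rightarrow> nat. strict_mono r \<and> l1_spreading_model (n - k + 1) (x \<circ> r))"
  proof
    fix k assume "k \<in> {0..n - 1}"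
    then have "k < n" using assms(1) by auto
    then show "\<exists>x :: nat \<Rightarrow> 'a. range x \<subseteq> Y \<and> l1_spreading_model (n - k) x \<and>
            \<not> (\<exists>r :: nat \<Rightarrow> nat. strict_mono r \<and> l1_spreading_model (n - k + 1) (x \<circ> r))"
      by (rule l1_spreading_model_exists[OF assms(1,3,5,6)])
  qed
qed

end
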